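(* Let $\mathsf 1$ be the terminal category with object $\ast$, let $\mathsf 2$ be the category with two objects $0,1$ and a single non-identity arrow $f:0\to1$, and let $p_{\mathsf 2}:\mathsf 1\to\mathsf 2$ be the functor with $p_{\mathsf 2}(\ast)=0$. Let $F:\mathsf 2\to\mathrm{Adj}$ be the functor with $F0=\Delta$, $F1=\Delta_\bot$ and $Ff=(L\dashv R)$. Then the unique morphism of bifibrations $\mathrm{Bif}(p_{\mathsf 2})\to\int_{\mathsf 2}F$ sending the atomic formula $\ast$ to the empty ordinal is an equivalence of categories. In particular, $\Delta$ is equivalent to the fiber category $\mathrm{Bif}(p_{\mathsf 2})_0$.
   Context: $\Delta$ is the category of finite ordinals (including the empty one) and order-preserving maps; $\Delta_\bot$ is the category of non-empty finite ordinals and order-and-least-element-preserving maps. $L:\Delta\to\Delta_\bot$ adds a new least element $\bot$ to an ordinal, and extends an order-preserving map by $\bot\mapsto\bot$; its right adjoint $R:\Delta_\bot\to\Delta$ is the forgetful functor. $\mathrm{Adj}$ is the 2-category of small categories and adjunctions (an arrow $\mathcal A\to\mathcal B$ is an adjunction with left adjoint $\mathcal A\to\mathcal B$). Composition is in diagrammatic order. A (cloven) bifibration is a functor $q:\mathcal E\to\mathcal C$ with, for every $f:A\to B$ in $\mathcal C$ and $S$ over $A$, a chosen $f_S:S\to f^+S$ over $f$ such that each $\alpha:S\to T$ over $fg$ factors uniquely as $\alpha=f_S\beta$ with $\beta$ over $g$; and for every $g:B\to C$ and $T$ over $C$, a chosen $\bar g_T:g^-T\to T$ over $g$ such that each $\alpha:S\to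 T$ over $fg$ factors uniquely as $\alpha=\beta\bar g_T$ with $\beta$ over $f$. Morphisms of bifibrations over $\mathcal C$ are functors over $\mathcal C$ sending chosen liftings to chosen liftings. The free bifibration on $p:\mathcal D\to\mathcal C$ is a bifibration $\Lambda_p:\mathrm{Bif}(p)\to\mathcal C$ with a functor $\eta_p:\mathcal D\to\mathrm{Bif}(p)$, $\Lambda_p\eta_p=p$, such that for every bifibration $q:\mathcal E\to\mathcal C$ and $\theta:\mathcal D\to\mathcal E$ with $q\theta=p$ there is a unique morphism of bifibrations $G$ with $G\eta_p=\theta$. The atomic formula $X$ is the object $\eta_p(X)$. The fiber category over $A$ consists of the objects over $A$ and the arrows over $\mathrm{id}_A$. For $F:\mathcal C\to\mathrm{Adj}$, the category of elements $\int_{\mathcal C}F$ has objects pairs $(A,S)$ with $S\in F(A)$, and arrows $(A,S)\to(B,T)$ pairs $(f,\alpha)$ with $f:A\to B$ and $\alpha:F(f)^+(S)\to T$ in $F(B)$ (equivalently $S\to F(f)^-(T)$ in $F(A)$), where $F(f)^+\dashv F(f)^-$ is the adjunction $F(f)$; its projection to $\mathcal C$ is a bifibration with the evident chosen liftings. *)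

theory Defs
  imports "HOL-Library.FuncSet" "HOL-Library.Infinite_Typeclass"
begin

section \<open>Categories, functors, equivalences\<close>

text \<open>Composition is diagrammatic: \<open>Cmp C f g\<close> is \<open>f\<close> followed by \<open>g\<close>. The values of the
  operations outside the carriers are irrelevant for categories.\<close>

record ('o, 'a) cat =
  Obj :: "'o set"
  Arr :: "'a set"
  Dom :: "'a \<Rightarrow> 'o"
  Cod :: "'a \<Rightarrow> 'o"
  Ide :: "'o \<Rightarrow> 'a"
  Cmp :: "'a \<Rightarrow> 'a \<Rightarrow> 'a"

definition Hom :: "('o, 'a) cat \<Rightarrow> 'o \<Rightarrow> 'o \<Rightarrow> 'a set" where
  "Hom C A B = {f \<in> Arr C. Dom C f = A \<and> Cod C f = B}"

definition is_category :: "('o, 'a) cat \<Rightarrow> bool" where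
  "is_category C \<longleftrightarrow>
     (\<forall>f \<in> Arr C. Dom C f \<in> Obj C \<and> Cod C f \<in> Obj C) \<and>
     (\<forall>A \<in> Obj C. Ide C A \<in> Hom C A A) \<and>
     (\<forall>f \<in> Arr C. \<forall>g \<in> Arr C. Cod C f = Dom C g \<longrightarrow> Cmp C f g \<in> Hom C (Dom C f) (Cod C g)) \<and>
     (\<forall>f \<in> Arr C. Cmp C (Ide C (Dom C f)) f = f \<and> Cmp C f (Ide C (Cod C f)) = f) \<and>
     (\<forall>f \<in> Arr C. \<forall>g \<in> Arr C. \<forall>h \<in> Arr C. Cod C f = Dom C g \<longrightarrow> Cod C g = Dom C h \<longrightarrow>
        Cmp C (Cmp C f g) h = Cmp C f (Cmp C g h))"

definition is_iso :: "('o, 'a) cat \<Rightarrow> 'a \<Rightarrow> bool" where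
  "is_iso C f \<longleftrightarrow> f \<in> Arr C \<and>
     (\<exists>g \<in> Hom C (Cod C f) (Dom C f).
        Cmp C f g = Ide C (Dom C f) \<and> Cmp C g f = Ide C (Cod C f))"

text \<open>Functors (and natural transformations) are extensional outside the carriers, so that
  HOL equality is equality of functors.\<close>

record ('o, 'a, 'p, 'b) fctr =
  omap :: "'o \<Rightarrow> 'p"
  amap :: "'a \<Rightarrow> 'b"

definition is_functor ::
  "('o, 'a) cat \<Rightarrow> ('p, 'b) cat \<Rightarrow> ('o, 'a, 'p, 'b) fctr \<Rightarrow> bool" where
  "is_functor C D F \<longleftrightarrow> is_category C \<and> is_category D \<and>
     omap F \<in> Obj C \<rightarrow>\<^sub>E Obj D \<and> amap F \<in> Arr C \<rightarrow>\<^sub>E Arr D \<and>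
     (\<forall>f \<in> Arr C. amap F f \<in> Hom D (omap F (Dom C f)) (omap F (Cod C f))) \<and>
     (\<forall>A \<in> Obj C. amap F (Ide C A) = Ide D (omap F A)) \<and>
     (\<forall>f \<in> Arr C. \<forall>g \<in> Arr C. Cod C f = Dom C g \<longrightarrow>
        amap F (Cmp C f g) = Cmp D (amap F f) (amap F g))"

definition id_functor :: "('o, 'a) cat \<Rightarrow> ('o, 'a, 'o, 'a) fctr" where
  "id_functor C = \<lparr>omap = (\<lambda>A \<in> Obj C. A), amap = (\<lambda>f \<in> Arr C. f)\<rparr>"

text \<open>\<open>comp_functor C F G\<close> is \<open>F\<close> followed by \<open>G\<close>, where \<open>C\<close> is the source of \<open>F\<close>.\<close>

definition comp_functor ::
  "('o, 'a) cat \<Rightarrow> ('o, 'a, 'p, 'b) fctr \<Rightarrow> ('p, 'b, 'q, 'c) fctr \<Rightarrow> ('o, 'a, 'q, 'c) fctr" where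
  "comp_functor C F G =
     \<lparr>omap = (\<lambda>A \<in> Obj C. omap G (omap F A)), amap = (\<lambda>f \<in> Arr C. amap G (amap F f))\<rparr>"

definition is_nat_trans ::
  "('o, 'a) cat \<Rightarrow> ('p, 'b) cat \<Rightarrow> ('o, 'a, 'p, 'b) fctr \<Rightarrow> ('o, 'a, 'p, 'b) fctr
     \<Rightarrow> ('o \<Rightarrow> 'b) \<Rightarrow> bool" where
  "is_nat_trans C D F G \<tau> \<longleftrightarrow> is_functor C D F \<and> is_functor C D G \<and>
     \<tau> \<in> extensional (Obj C) \<and>
     (\<forall>A \<in> Obj C. \<tau> A \<in> Hom D (omap F A) (omap G A)) \<and>
     (\<forall>f \<in> Arr C. Cmp D (amap F f) (\<tau> (Cod C f)) = Cmp D (\<tau> (Dom C f)) (amap G f))"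

definition is_nat_iso ::
  "('o, 'a) cat \<Rightarrow> ('p, 'b) cat \<Rightarrow> ('o, 'a, 'p, 'b) fctr \<Rightarrow> ('o, 'a, 'p, 'b) fctr
     \<Rightarrow> ('o \<Rightarrow> 'b) \<Rightarrow> bool" where
  "is_nat_iso C D F G \<tau> \<longleftrightarrow> is_nat_trans C D F G \<tau> \<and> (\<forall>A \<in> Obj C. is_iso D (\<tau> A))"

definition is_equivalence ::
  "('o, 'a) cat \<Rightarrow> ('p, 'b) cat \<Rightarrow> ('o, 'a, 'p, 'b) fctr \<Rightarrow> bool" where
  "is_equivalence C D F \<longleftrightarrow> is_functor C D F \<and>
     (\<exists>G. is_functor D C G \<and>
        (\<exists>\<sigma>. is_nat_iso C C (id_functor C) (comp_functor C F G) \<sigma>) \<and>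
        (\<exists>\<tau>. is_nat_iso D D (comp_functor D G F) (id_functor D) \<tau>))"

definition equivalent :: "('o, 'a) cat \<Rightarrow> ('p, 'b) cat \<Rightarrow> bool" where
  "equivalent C D \<longleftrightarrow> (\<exists>F. is_equivalence C D F)"


section \<open>Adjunctions and the category \<open>Adj\<close>\<close>

text \<open>An arrow of \<open>Adj\<close> points in the direction of its left adjoint. Only the underlying
  1-category of the 2-category of adjunctions is needed. Small categories are those with objects
  and arrows in fixed types.\<close>

record ('o, 'a) adjn =
  lower :: "('o, 'a) cat"
  upper :: "('o, 'a) cat"
  left :: "('o, 'a, 'o, 'a) fctr"
  right :: "('o, 'a, 'o, 'a) fctr"
  unit :: "'o \<Rightarrow> 'a"
  counit :: "'o \<Rightarrow> 'a"

definition is_adjunction :: "('o, 'a) adjn \<Rightarrow> bool" where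
  "is_adjunction H \<longleftrightarrow>
     is_functor (lower H) (upper H) (left H) \<and>
     is_functor (upper H) (lower H) (right H) \<and>
     is_nat_trans (lower H) (lower H)
       (id_functor (lower H)) (comp_functor (lower H) (left H) (right H)) (unit H) \<and>
     is_nat_trans (upper H) (upper H)
       (comp_functor (upper H) (right H) (left H)) (id_functor (upper H)) (counit H) \<and>
     (\<forall>S \<in> Obj (lower H).
        Cmp (upper H) (amap (left H) (unit H S)) (counit H (omap (left H) S))
          = Ide (upper H) (omap (left H) S)) \<and>
     (\<forall>T \<in> Obj (upper H).
        Cmp (lower H) (unit H (omap (right H) T)) (amap (right H) (counit H T))
          = Ide (lower H) (omap (right H) T))"

definition id_adjn :: "('o, 'a) cat \<Rightarrow> ('o, 'a) adjn" where
  "id_adjn C = \<lparr>lower = C, upper = C, left = id_functor C, right = id_functor C,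
     unit = (\<lambda>S \<in> Obj C. Ide C S), counit = (\<lambda>S \<in> Obj C. Ide C S)\<rparr>"

definition comp_adjn :: "('o, 'a) adjn \<Rightarrow> ('o, 'a) adjn \<Rightarrow> ('o, 'a) adjn" where
  "comp_adjn H K = \<lparr>lower = lower H, upper = upper K,
     left = comp_functor (lower H) (left H) (left K),
     right = comp_functor (upper K) (right K) (right H),
     unit = (\<lambda>S \<in> Obj (lower H).
       Cmp (lower H) (unit H S) (amap (right H) (unit K (omap (left H) S)))),
     counit = (\<lambda>T \<in> Obj (upper K).
       Cmp (upper K) (amap (left K) (counit H (omap (right K) T))) (counit K T))\<rparr>"

definition Adj :: "(('o, 'a) cat, ('o, 'a) adjn) cat" where
  "Adj = \<lparr>Obj = {C. is_category C}, Arr = {H. is_adjunction H}, Dom = lower, Cod = upper,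
     Ide = id_adjn, Cmp = comp_adjn\<rparr>"


section \<open>Cloven bifibrations\<close>

text \<open>\<open>push Q f S\<close> is the chosen arrow \<open>S \<rightarrow> f\<^sup>+S\<close> and \<open>pull Q g T\<close> the chosen arrow
  \<open>g\<^sup>-T \<rightarrow> T\<close>. They are only meaningful (and only ever compared) when \<open>S\<close> lies over the
  domain of \<open>f\<close>, respectively \<open>T\<close> over the codomain of \<open>g\<close>.\<close>

record ('o, 'a, 'c, 'b) bifib =
  Tot :: "('o, 'a) cat"
  prj :: "('o, 'a, 'c, 'b) fctr"
  push :: "'b \<Rightarrow> 'o \<Rightarrow> 'a"
  pull :: "'b \<Rightarrow> 'o \<Rightarrow> 'a"

definition is_bifibration :: "('c, 'b) cat \<Rightarrow> ('o, 'a, 'c, 'b) bifib \<Rightarrow> bool" where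
  "is_bifibration C Q \<longleftrightarrow> is_functor (Tot Q) C (prj Q) \<and>
     (\<forall>f \<in> Arr C. \<forall>S \<in> Obj (Tot Q). omap (prj Q) S = Dom C f \<longrightarrow>
        push Q f S \<in> Arr (Tot Q) \<and> Dom (Tot Q) (push Q f S) = S \<and>
        amap (prj Q) (push Q f S) = f \<and>
        (\<forall>g \<in> Arr C. \<forall>\<alpha> \<in> Arr (Tot Q). Cod C f = Dom C g \<longrightarrow> Dom (Tot Q) \<alpha> = S \<longrightarrow>
           amap (prj Q) \<alpha> = Cmp C f g \<longrightarrow>
           (\<exists>!\<beta>. \<beta> \<in> Hom (Tot Q) (Cod (Tot Q) (push Q f S)) (Cod (Tot Q) \<alpha>) \<and>
                 amap (prj Q) \<beta> = g \<and> \<alpha> = Cmp (Tot Q) (push Q f S) \<beta>))) \<and>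
     (\<forall>g \<in> Arr C. \<forall>T \<in> Obj (Tot Q). omap (prj Q) T = Cod C g \<longrightarrow>
        pull Q g T \<in> Arr (Tot Q) \<and> Cod (Tot Q) (pull Q g T) = T \<and>
        amap (prj Q) (pull Q g T) = g \<and>
        (\<forall>f \<in> Arr C. \<forall>\<alpha> \<in> Arr (Tot Q). Cod C f = Dom C g \<longrightarrow> Cod (Tot Q) \<alpha> = T \<longrightarrow>
           amap (prj Q) \<alpha> = Cmp C f g \<longrightarrow>
           (\<exists>!\<beta>. \<beta> \<in> Hom (Tot Q) (Dom (Tot Q) \<alpha>) (Dom (Tot Q) (pull Q g T)) \<and>
                 amap (prj Q) \<beta> = f \<and> \<alpha> = Cmp (Tot Q) \<beta> (pull Q g T))))"

definition is_bifib_morphism ::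
  "('c, 'b) cat \<Rightarrow> ('o, 'a, 'c, 'b) bifib \<Rightarrow> ('p, 'd, 'c, 'b) bifib \<Rightarrow> ('o, 'a, 'p, 'd) fctr \<Rightarrow> bool"
where
  "is_bifib_morphism C Q Q' G \<longleftrightarrow> is_bifibration C Q \<and> is_bifibration C Q' \<and>
     is_functor (Tot Q) (Tot Q') G \<and> comp_functor (Tot Q) G (prj Q') = prj Q \<and>
     (\<forall>f \<in> Arr C. \<forall>S \<in> Obj (Tot Q). omap (prj Q) S = Dom C f \<longrightarrow>
        amap G (push Q f S) = push Q' f (omap G S)) \<and>
     (\<forall>g \<in> Arr C. \<forall>T \<in> Obj (Tot Q). omap (prj Q) T = Cod C g \<longrightarrow>
        amap G (pull Q g T) = pull Q' g (omap G T))"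

definition fiber :: "('o, 'a, 'c, 'b) bifib \<Rightarrow> ('c, 'b) cat \<Rightarrow> 'c \<Rightarrow> ('o, 'a) cat" where
  "fiber Q C A = (Tot Q)
     \<lparr>Obj := {S \<in> Obj (Tot Q). omap (prj Q) S = A},
      Arr := {\<alpha> \<in> Arr (Tot Q). amap (prj Q) \<alpha> = Ide C A}\<rparr>"

text \<open>A formula cannot quantify over types, so the universal property of \<open>Q\<close> (with unit \<open>\<eta>\<close>) is
  tested against all bifibrations whose objects and arrows are drawn from the types used by \<open>Q\<close>
  itself; these types play the role of the universe of small categories. They are required to be
  infinite so that, for countable \<open>C\<close> and \<open>D\<close>, every countable bifibration over \<open>C\<close> has an
  isomorphic copy among the test bifibrations. A bifibration that is free with respect to all
  types is in particular free in this sense.\<close>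

definition is_free_bifibration ::
  "('c, 'b) cat \<Rightarrow> ('d, 'e) cat \<Rightarrow> ('d, 'e, 'c, 'b) fctr
     \<Rightarrow> ('o::infinite, 'a::infinite, 'c, 'b) bifib \<Rightarrow> ('d, 'e, 'o, 'a) fctr \<Rightarrow> bool" where
  "is_free_bifibration C D p Q \<eta> \<longleftrightarrow>
     is_functor D C p \<and> is_bifibration C Q \<and>
     is_functor D (Tot Q) \<eta> \<and> comp_functor D \<eta> (prj Q) = p \<and>
     (\<forall>(Q' :: ('o, 'a, 'c, 'b) bifib) \<theta>.
        is_bifibration C Q' \<longrightarrow> is_functor D (Tot Q') \<theta> \<longrightarrow> comp_functor D \<theta> (prj Q') = p \<longrightarrow>
        (\<exists>!G. is_bifib_morphism C Q Q' G \<and> comp_functor D \<eta> G = \<theta>))"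


section \<open>The category of elements\<close>

text \<open>An arrow \<open>(A, S) \<rightarrow> (B, T)\<close> is encoded as a triple \<open>(S, f, \<alpha>)\<close> with \<open>f : A \<rightarrow> B\<close> and
  \<open>\<alpha> : F(f)\<^sup>+(S) \<rightarrow> T\<close>; the component \<open>S\<close> makes the domain a function of the arrow.
  Under the adjunction, the chosen lifting \<open>F(g)\<^sup>-(T) \<rightarrow> T\<close> is given by the counit.\<close>

definition elements ::
  "('c, 'b) cat \<Rightarrow> ('c, 'b, ('o, 'a) cat, ('o, 'a) adjn) fctr
     \<Rightarrow> ('c \<times> 'o, 'o \<times> 'b \<times> 'a, 'c, 'b) bifib" where
  "elements C F =
     (let Ob = {(A, S). A \<in> Obj C \<and> S \<in> Obj (omap F A)};
          Ar = {(S, f, \<alpha>). f \<in> Arr C \<and> S \<in> Obj (omap F (Dom C f)) \<and>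
                  \<alpha> \<in> Arr (omap F (Cod C f)) \<and>
                  Dom (omap F (Cod C f)) \<alpha> = omap (left (amap F f)) S}
      in \<lparr>Tot = \<lparr>Obj = Ob, Arr = Ar,
            Dom = (\<lambda>(S, f, \<alpha>). (Dom C f, S)),
            Cod = (\<lambda>(S, f, \<alpha>). (Cod C f, Cod (omap F (Cod C f)) \<alpha>)),
            Ide = (\<lambda>(A, S). (S, Ide C A, Ide (omap F A) S)),
            Cmp = (\<lambda>(S, f, \<alpha>) (T, g, \<beta>).
              (S, Cmp C f g, Cmp (omap F (Cod C g)) (amap (left (amap F g)) \<alpha>) \<beta>))\<rparr>,
          prj = \<lparr>omap = (\<lambda>(A, S) \<in> Ob. A), amap = (\<lambda>(S, f, \<alpha>) \<in> Ar. f)\<rparr>,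
          push = (\<lambda>f (A, S).
            (S, f, Ide (omap F (Cod C f)) (omap (left (amap F f)) S))),
          pull = (\<lambda>g (B, T).
            (omap (right (amap F g)) T, g, counit (amap F g) T))\<rparr>)"


section \<open>The categories \<open>\<Delta>\<close> and \<open>\<Delta>\<^sub>\<bottom>\<close>\<close>

text \<open>The ordinal \<open>n\<close> is \<open>{..<n}\<close>, with least element \<open>0\<close> if non-empty. An arrow is a triple of
  domain, codomain and (extensional) underlying map.\<close>

type_synonym ord_arr = "nat \<times> nat \<times> (nat \<Rightarrow> nat)"

definition Delta :: "(nat, ord_arr) cat" where
  "Delta = \<lparr>Obj = UNIV,
     Arr = {(m, n, \<phi>). \<phi> \<in> {..<m} \<rightarrow>\<^sub>E {..<n} \<and> mono_on {..<m} \<phi>},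
     Dom = (\<lambda>(m, n, \<phi>). m), Cod = (\<lambda>(m, n, \<phi>). n),
     Ide = (\<lambda>n. (n, n, \<lambda>i \<in> {..<n}. i)),
     Cmp = (\<lambda>(m, n, \<phi>) (n', k, \<psi>). (m, k, \<lambda>i \<in> {..<m}. \<psi> (\<phi> i)))\<rparr>"

definition Delta_bot :: "(nat, ord_arr) cat" where
  "Delta_bot = Delta
     \<lparr>Obj := {n. 0 < n},
      Arr := {(m, n, \<phi>). (m, n, \<phi>) \<in> Arr Delta \<and> 0 < m \<and> 0 < n \<and> \<phi> 0 = 0}\<rparr>"

definition LR_left :: "(nat, ord_arr, nat, ord_arr) fctr" where
  "LR_left = \<lparr>omap = Suc,
     amap = (\<lambda>(m, n, \<phi>) \<in> Arr Delta.
       (Suc m, Suc n, \<lambda>i \<in> {..<Suc m}. case i of 0 \<Rightarrow> 0 | Suc j \<Rightarrow> Suc (\<phi> j)))\<rparr>"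

definition LR_right :: "(nat, ord_arr, nat, ord_arr) fctr" where
  "LR_right = \<lparr>omap = (\<lambda>n \<in> Obj Delta_bot. n), amap = (\<lambda>u \<in> Arr Delta_bot. u)\<rparr>"

text \<open>The counit \<open>n + 1 \<rightarrow> n\<close> merges the new least element with the old one.\<close>

definition LR_adjn :: "(nat, ord_arr) adjn" where
  "LR_adjn = \<lparr>lower = Delta, upper = Delta_bot, left = LR_left, right = LR_right,
     unit = (\<lambda>n. (n, Suc n, \<lambda>i \<in> {..<n}. Suc i)),
     counit = (\<lambda>n \<in> Obj Delta_bot. (Suc n, n, \<lambda>i \<in> {..<Suc n}. i - 1))\<rparr>"


section \<open>The functors \<open>p\<^sub>2 : 1 \<rightarrow> 2\<close> and \<open>F : 2 \<rightarrow> Adj\<close>\<close>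

definition One :: "(unit, unit) cat" where
  "One = \<lparr>Obj = UNIV, Arr = UNIV, Dom = (\<lambda>_. ()), Cod = (\<lambda>_. ()), Ide = (\<lambda>_. ()),
     Cmp = (\<lambda>_ _. ())\<rparr>"

text \<open>The arrow \<open>f : 0 \<rightarrow> 1\<close> of the category \<open>2\<close> is the pair \<open>(0, 1)\<close>.\<close>

definition Two :: "(nat, nat \<times> nat) cat" where
  "Two = \<lparr>Obj = {0, 1}, Arr = {(0, 0), (0, 1), (1, 1)}, Dom = fst, Cod = snd,
     Ide = (\<lambda>i. (i, i)), Cmp = (\<lambda>u v. (fst u, snd v))\<rparr>"

definition p_two :: "(unit, unit, nat, nat \<times> nat) fctr" where
  "p_two = \<lparr>omap = (\<lambda>_. 0), amap = (\<lambda>_. (0, 0))\<rparr>"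

definition F_two :: "(nat, nat \<times> nat, (nat, ord_arr) cat, (nat, ord_arr) adjn) fctr" where
  "F_two = \<lparr>
     omap = (\<lambda>i \<in> Obj Two. if i = 0 then Delta else Delta_bot),
     amap = (\<lambda>u \<in> Arr Two.
       if u = (0, 1) then LR_adjn
       else if u = (0, 0) then id_adjn Delta else id_adjn Delta_bot)\<rparr>"

end

theory Submission
  imports Defs "HOL-Library.Countable_Set"
begin

text \<open>A bifibration over \<open>2\<close> is essentially a pair of categories with an adjunction between them: pushing and
  pulling along the non-identity arrow are a left adjoint \<open>L\<close> and a right adjoint \<open>R\<close>. The free one on
  an object \<open>a\<close> over \<open>0\<close> contains the objects \<open>s n\<close>, obtained by applying \<open>R \<circ> L\<close> to \<open>a\<close> \<open>n\<close> times, and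
  \<open>t (n + 1) = L (s n)\<close>. Between them there are the arrows built from \<open>L\<close>, \<open>R\<close>, the unit and the counit in
  a normal form that mirrors how a monotone map of finite ordinals arises by inserting elements at
  the bottom. Normal forms contain the identities and are closed under composition (\<open>nf_ide\<close>,
  \<open>nf_cmp\<close>), and the canonical morphism \<open>G\<close> to the category of elements maps them bijectively to the
  arrows of \<open>\<Delta>\<close> and \<open>\<Delta>\<^sub>\<bottom>\<close> (\<open>nf_ex1\<close>). Inverting this bijection gives a functor \<open>H\<close> in the opposite
  direction, such that \<open>H\<close> followed by \<open>G\<close> is the identity (\<open>H_G\<close>).

  It remains to see that \<open>G\<close> followed by \<open>H\<close> is isomorphic to the identity of the free bifibration. As
  \<open>H\<close> preserves liftings only up to isomorphism, the universal property does not apply to it directly.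
  Instead, let the objects of a bifibration \<open>P\<close> be the vertical isomorphisms \<open>i : He \<rightarrow> T\<close>, and its
  arrows those between the objects \<open>e\<close>. Both projections of \<open>P\<close> are strict, so the morphism from the
  free bifibration to \<open>P\<close> is a section of the projection to \<open>T\<close> that lies over \<open>G\<close>. It assigns to each
  \<open>T\<close> an isomorphism \<open>HGT \<rightarrow> T\<close> (\<open>free_bifibration_pseudo_retract\<close>).

  The universal property is available only for test bifibrations in the types of the free
  bifibration. It extends to all countable test bifibrations (\<open>free_bifibration_countable_ex1\<close>), because
  those have copies in any infinite types. The category of elements is countable, and so is the free
  bifibration, which is generated by \<open>a\<close> (\<open>countable_free_bifibration\<close>); therefore \<open>P\<close> is countable.\<close>


section \<open>Categories and functors\<close>

lemma HomI: "f \<in> Arr C \<Longrightarrow> Dom C f = A \<Longrightarrow> Cod C f = B \<Longrightarrow> f \<in> Hom C A B"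
  by (simp add: Hom_def)

lemma HomD:
  assumes "f \<in> Hom C A B"
  shows "f \<in> Arr C" "Dom C f = A" "Cod C f = B"
  using assms by (auto simp: Hom_def)

lemma Hom_Dom_Cod: "f \<in> Arr C \<Longrightarrow> f \<in> Hom C (Dom C f) (Cod C f)"
  by (simp add: Hom_def)

lemma Hom_obj:
  assumes "is_category C" "f \<in> Hom C A B"
  shows "A \<in> Obj C" "B \<in> Obj C"
  using assms by (auto simp: Hom_def is_category_def)

lemma ide_Hom: "is_category C \<Longrightarrow> A \<in> Obj C \<Longrightarrow> Ide C A \<in> Hom C A A"
  by (simp add: is_category_def)

lemma cmp_Hom:
  "is_category C \<Longrightarrow> f \<in> Hom C A B \<Longrightarrow> g \<in> Hom C B D \<Longrightarrow> Cmp C f g \<in> Hom C A D"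
  unfolding is_category_def Hom_def by auto

lemma ide_cmp: "is_category C \<Longrightarrow> f \<in> Hom C A B \<Longrightarrow> Cmp C (Ide C A) f = f"
  unfolding is_category_def Hom_def by auto

lemma cmp_ide: "is_category C \<Longrightarrow> f \<in> Hom C A B \<Longrightarrow> Cmp C f (Ide C B) = f"
  unfolding is_category_def Hom_def by auto

lemma cmp_assoc:
  "is_category C \<Longrightarrow> f \<in> Hom C A B \<Longrightarrow> g \<in> Hom C B D \<Longrightarrow> h \<in> Hom C D E \<Longrightarrow>
    Cmp C (Cmp C f g) h = Cmp C f (Cmp C g h)"
  unfolding is_category_def Hom_def by auto

lemma is_categoryI:
  assumes "\<And>f. f \<in> Arr C \<Longrightarrow> Dom C f \<in> Obj C" "\<And>f. f \<in> Arr C \<Longrightarrow> Cod C f \<in> Obj C"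
    and "\<And>A. A \<in> Obj C \<Longrightarrow> Ide C A \<in> Hom C A A"
    and "\<And>f g A B D. f \<in> Hom C A B \<Longrightarrow> g \<in> Hom C B D \<Longrightarrow> Cmp C f g \<in> Hom C A D"
    and "\<And>f A B. f \<in> Hom C A B \<Longrightarrow> Cmp C (Ide C A) f = f"
    and "\<And>f A B. f \<in> Hom C A B \<Longrightarrow> Cmp C f (Ide C B) = f"
    and "\<And>f g h A B D E. f \<in> Hom C A B \<Longrightarrow> g \<in> Hom C B D \<Longrightarrow> h \<in> Hom C D E \<Longrightarrow>
      Cmp C (Cmp C f g) h = Cmp C f (Cmp C g h)"
  shows "is_category C"
  unfolding is_category_def
  by (intro conjI ballI impI; (rule assms; simp add: Hom_def)?)

lemma functor_cat:
  assumes "is_functor C D F" shows "is_category C" "is_category D"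
  using assms by (auto simp: is_functor_def)

lemma functor_obj: "is_functor C D F \<Longrightarrow> A \<in> Obj C \<Longrightarrow> omap F A \<in> Obj D"
  by (auto simp: is_functor_def)

lemma functor_Hom:
  "is_functor C D F \<Longrightarrow> f \<in> Hom C A B \<Longrightarrow> amap F f \<in> Hom D (omap F A) (omap F B)"
  by (auto simp: is_functor_def Hom_def)

lemma functor_ide: "is_functor C D F \<Longrightarrow> A \<in> Obj C \<Longrightarrow> amap F (Ide C A) = Ide D (omap F A)"
  by (auto simp: is_functor_def)

lemma functor_cmp:
  "is_functor C D F \<Longrightarrow> f \<in> Hom C A B \<Longrightarrow> g \<in> Hom C B E \<Longrightarrow>
    amap F (Cmp C f g) = Cmp D (amap F f) (amap F g)"
  by (auto simp: is_functor_def Hom_def)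

lemma functor_extensional:
  assumes "is_functor C D F"
  shows "omap F \<in> extensional (Obj C)" "amap F \<in> extensional (Arr C)"
  using assms by (auto simp: is_functor_def PiE_def)

lemma is_functorI:
  assumes "is_category C" "is_category D"
    and "omap F \<in> extensional (Obj C)" "amap F \<in> extensional (Arr C)"
    and "\<And>A. A \<in> Obj C \<Longrightarrow> omap F A \<in> Obj D"
    and Hm: "\<And>f A B. f \<in> Hom C A B \<Longrightarrow> amap F f \<in> Hom D (omap F A) (omap F B)"
    and "\<And>A. A \<in> Obj C \<Longrightarrow> amap F (Ide C A) = Ide D (omap F A)"
    and "\<And>f g A B E. f \<in> Hom C A B \<Longrightarrow> g \<in> Hom C B E \<Longrightarrow>
      amap F (Cmp C f g) = Cmp D (amap F f) (amap F g)"
  shows "is_functor C D F"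
proof -
  have "amap F f \<in> Arr D" if "f \<in> Arr C" for f
    using HomD(1)[OF Hm[OF Hom_Dom_Cod[OF that]]] .
  moreover have "amap F f \<in> Hom D (omap F (Dom C f)) (omap F (Cod C f))" if "f \<in> Arr C" for f
    using Hm[OF Hom_Dom_Cod[OF that]] .
  ultimately show ?thesis
    unfolding is_functor_def PiE_def using assms by (auto simp: Hom_def)
qed

lemma functor_eqI:
  assumes F: "is_functor C D F" and G: "is_functor C D' G"
    and o: "\<And>A. A \<in> Obj C \<Longrightarrow> omap F A = omap G A"
    and a: "\<And>f. f \<in> Arr C \<Longrightarrow> amap F f = amap G f"
  shows "F = G"
proof -
  have "omap F = omap G"
    by (rule extensionalityI[OF functor_extensional(1)[OF F] functor_extensional(1)[OF G] o])
  moreover have "amap F = amap G"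
    by (rule extensionalityI[OF functor_extensional(2)[OF F] functor_extensional(2)[OF G] a])
  ultimately show ?thesis by simp
qed

lemma id_functor_apply [simp]:
  "A \<in> Obj C \<Longrightarrow> omap (id_functor C) A = A" "f \<in> Arr C \<Longrightarrow> amap (id_functor C) f = f"
  by (simp_all add: id_functor_def)

lemma comp_functor_apply [simp]:
  "A \<in> Obj C \<Longrightarrow> omap (comp_functor C F G) A = omap G (omap F A)"
  "f \<in> Arr C \<Longrightarrow> amap (comp_functor C F G) f = amap G (amap F f)"
  by (simp_all add: comp_functor_def)

lemma id_functor: 
  assumes "is_category C" shows "is_functor C C (id_functor C)"
proof (rule is_functorI)
  fix f A B assume f: "f \<in> Hom C A B"
  then show "amap (id_functor C) f \<in> Hom C (omap (id_functor C) A) (omap (id_functor C) B)"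
    using assms Hom_obj[OF assms f] HomD(1)[OF f] by simp
next
  fix f g A B E assume "f \<in> Hom C A B" "g \<in> Hom C B E"
  then show "amap (id_functor C) (Cmp C f g) = Cmp C (amap (id_functor C) f) (amap (id_functor C) g)"
    using assms HomD(1)[OF cmp_Hom] HomD(1) by (metis id_functor_apply(2))
qed (use assms ide_Hom[OF assms] in \<open>auto simp: id_functor_def Hom_def\<close>)

lemma comp_functor:
  assumes F: "is_functor C D F" and G: "is_functor D E G"
  shows "is_functor C E (comp_functor C F G)"
proof (rule is_functorI)
  fix f A B assume f: "f \<in> Hom C A B"
  then show "amap (comp_functor C F G) f \<in> Hom E (omap (comp_functor C F G) A) (omap (comp_functor C F G) B)"
    using functor_Hom[OF G functor_Hom[OF F f]] Hom_obj[OF functor_cat(1)[OF F] f] HomD(1)[OF f] by simp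
next
  fix A assume A: "A \<in> Obj C"
  then show "amap (comp_functor C F G) (Ide C A) = Ide E (omap (comp_functor C F G) A)"
    using HomD(1)[OF ide_Hom[OF functor_cat(1)[OF F] A]] functor_obj[OF F A]
    by (simp add: functor_ide[OF F] functor_ide[OF G])
next
  fix f g A B L assume f: "f \<in> Hom C A B" and g: "g \<in> Hom C B L"
  then show "amap (comp_functor C F G) (Cmp C f g)
      = Cmp E (amap (comp_functor C F G) f) (amap (comp_functor C F G) g)"
    using HomD(1)[OF f] HomD(1)[OF g] HomD(1)[OF cmp_Hom[OF functor_cat(1)[OF F] f g]]
      functor_cmp[OF F f g] functor_cmp[OF G functor_Hom[OF F f] functor_Hom[OF F g]]
    by simp
qed (use functor_cat[OF F] functor_cat[OF G] functor_obj[OF F] functor_obj[OF G] in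
    \<open>auto simp: comp_functor_def\<close>)

lemma comp_functor_assoc:
  assumes F: "is_functor C D F"
  shows "comp_functor C (comp_functor C F G) H = comp_functor C F (comp_functor D G H)"
  using functor_obj[OF F] HomD(1)[OF functor_Hom[OF F Hom_Dom_Cod]]
  by (auto simp: comp_functor_def intro!: restrict_ext)

lemma comp_id_functor:
  assumes F: "is_functor C D F" shows "comp_functor C F (id_functor D) = F"
  using F functor_obj[OF F] HomD(1)[OF functor_Hom[OF F Hom_Dom_Cod]] functor_cat[OF F]
  by (intro functor_eqI[OF comp_functor[OF F id_functor] F]) auto

lemma id_comp_functor:
  assumes F: "is_functor C D F" shows "comp_functor C (id_functor C) F = F"
  using F functor_cat[OF F] by (intro functor_eqI[OF comp_functor[OF id_functor F] F]) auto

text \<open>An isomorphism together with its inverse.\<close>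

definition iso_pair :: "('o, 'a) cat \<Rightarrow> 'o \<Rightarrow> 'o \<Rightarrow> 'a \<Rightarrow> 'a \<Rightarrow> bool" where
  "iso_pair C X Y i i' \<longleftrightarrow> i \<in> Hom C X Y \<and> i' \<in> Hom C Y X \<and>
     Cmp C i i' = Ide C X \<and> Cmp C i' i = Ide C Y"

lemma iso_pair_sym: "iso_pair C X Y i i' \<Longrightarrow> iso_pair C Y X i' i"
  by (auto simp: iso_pair_def)

lemma iso_pair_iso: "iso_pair C X Y i i' \<Longrightarrow> is_iso C i"
  by (auto simp: iso_pair_def is_iso_def Hom_def)

lemma iso_pair_ide: "is_category C \<Longrightarrow> X \<in> Obj C \<Longrightarrow> iso_pair C X X (Ide C X) (Ide C X)"
  unfolding iso_pair_def using ide_Hom ide_cmp by metis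

lemma iso_pair_cmp:
  assumes C: "is_category C" and i: "iso_pair C X Y i i'" and j: "iso_pair C Y Z j j'"
  shows "iso_pair C X Z (Cmp C i j) (Cmp C j' i')"
proof -
  note h = i[unfolded iso_pair_def] j[unfolded iso_pair_def]
  have ij: "Cmp C i j \<in> Hom C X Z" and ji: "Cmp C j' i' \<in> Hom C Z X"
    using C h cmp_Hom by metis+
  have "Cmp C (Cmp C i j) (Cmp C j' i') = Cmp C i (Cmp C (Cmp C j j') i')"
    using cmp_assoc[OF C _ _ ji, of i X Y j] cmp_assoc[OF C, of j Y Z j' Y i' X] h by simp
  also have "\<dots> = Ide C X"
    using h ide_cmp[OF C, of i' Y X] by simp
  finally have 1: "Cmp C (Cmp C i j) (Cmp C j' i') = Ide C X" .
  have "Cmp C (Cmp C j' i') (Cmp C i j) = Cmp C j' (Cmp C (Cmp C i' i) j)"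
    using cmp_assoc[OF C _ _ ij, of j' Z Y i'] cmp_assoc[OF C, of i' Y X i Y j Z] h by simp
  also have "\<dots> = Ide C Z"
    using h ide_cmp[OF C, of j Y Z] by simp
  finally show ?thesis using 1 ij ji by (simp add: iso_pair_def)
qed

lemma nat_iso_refl:
  assumes F: "is_functor C D F"
  shows "is_nat_iso C D F F (\<lambda>X \<in> Obj C. Ide D (omap F X))"
  unfolding is_nat_iso_def is_nat_trans_def
proof (intro conjI ballI)
  note D = functor_cat(2)[OF F]
  fix X assume X: "X \<in> Obj C"
  show "(\<lambda>X \<in> Obj C. Ide D (omap F X)) X \<in> Hom D (omap F X) (omap F X)"
    using X ide_Hom[OF D functor_obj[OF F X]] by simp
  show "is_iso D ((\<lambda>X \<in> Obj C. Ide D (omap F X)) X)"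
    using X iso_pair_iso[OF iso_pair_ide[OF D functor_obj[OF F X]]] by simp
next
  fix f assume f: "f \<in> Arr C"
  note fH = Hom_Dom_Cod[OF f]
  show "Cmp D (amap F f) ((\<lambda>X \<in> Obj C. Ide D (omap F X)) (Cod C f))
      = Cmp D ((\<lambda>X \<in> Obj C. Ide D (omap F X)) (Dom C f)) (amap F f)"
    using Hom_obj[OF functor_cat(1)[OF F] fH] ide_cmp[OF functor_cat(2)[OF F] functor_Hom[OF F fH]]
      cmp_ide[OF functor_cat(2)[OF F] functor_Hom[OF F fH]] by simp
qed (use F in auto)

lemma nat_iso_inverse:
  assumes "is_nat_iso C D F G \<sigma>"
  shows "\<exists>\<tau>. is_nat_iso C D G F \<tau>"
proof -
  have F: "is_functor C D F" and G: "is_functor C D G"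
    and \<sigma>: "\<And>X. X \<in> Obj C \<Longrightarrow> \<sigma> X \<in> Hom D (omap F X) (omap G X)"
    and nat: "\<And>f. f \<in> Arr C \<Longrightarrow> Cmp D (amap F f) (\<sigma> (Cod C f)) = Cmp D (\<sigma> (Dom C f)) (amap G f)"
    and iso: "\<And>X. X \<in> Obj C \<Longrightarrow> is_iso D (\<sigma> X)"
    using assms by (auto simp: is_nat_iso_def is_nat_trans_def)
  note C = functor_cat(1)[OF F] and D = functor_cat(2)[OF F]
  have "\<exists>i. iso_pair D (omap F X) (omap G X) (\<sigma> X) i" if "X \<in> Obj C" for X
    using iso[OF that] \<sigma>[OF that] unfolding is_iso_def iso_pair_def by (auto simp: HomD)
  then obtain \<tau>' where \<tau>': "\<And>X. X \<in> Obj C \<Longrightarrow> iso_pair D (omap F X) (omap G X) (\<sigma> X) (\<tau>' X)" by metis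
  define \<tau> where "\<tau> = restrict \<tau>' (Obj C)"
  have \<tau>: "\<tau> X \<in> Hom D (omap G X) (omap F X)" "Cmp D (\<sigma> X) (\<tau> X) = Ide D (omap F X)"
    "Cmp D (\<tau> X) (\<sigma> X) = Ide D (omap G X)" "is_iso D (\<tau> X)" if "X \<in> Obj C" for X
    using \<tau>'[OF that] iso_pair_iso[OF iso_pair_sym[OF \<tau>'[OF that]]] that by (auto simp: \<tau>_def iso_pair_def)
  have "is_nat_iso C D G F \<tau>"
    unfolding is_nat_iso_def is_nat_trans_def
  proof (intro conjI ballI)
    fix f assume f: "f \<in> Arr C"
    note fH = Hom_Dom_Cod[OF f]
    note XY = Hom_obj[OF C fH] and Ff = functor_Hom[OF F fH] and Gf = functor_Hom[OF G fH]
    let ?X = "Dom C f" and ?Y = "Cod C f"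
    have "Cmp D (amap G f) (\<tau> ?Y) = Cmp D (Cmp D (\<tau> ?X) (\<sigma> ?X)) (Cmp D (amap G f) (\<tau> ?Y))"
      using \<tau>(3)[OF XY(1)] ide_cmp[OF D cmp_Hom[OF D Gf \<tau>(1)[OF XY(2)]]] by simp
    also have "\<dots> = Cmp D (\<tau> ?X) (Cmp D (Cmp D (\<sigma> ?X) (amap G f)) (\<tau> ?Y))"
      using cmp_assoc[OF D \<tau>(1)[OF XY(1)] \<sigma>[OF XY(1)] cmp_Hom[OF D Gf \<tau>(1)[OF XY(2)]]]
        cmp_assoc[OF D \<sigma>[OF XY(1)] Gf \<tau>(1)[OF XY(2)]] by simp
    also have "Cmp D (Cmp D (\<sigma> ?X) (amap G f)) (\<tau> ?Y) = amap F f"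
      using nat[OF f] cmp_assoc[OF D Ff \<sigma>[OF XY(2)] \<tau>(1)[OF XY(2)]] \<tau>(2)[OF XY(2)] cmp_ide[OF D Ff]
      by simp
    finally show "Cmp D (amap G f) (\<tau> ?Y) = Cmp D (\<tau> ?X) (amap F f)" .
  qed (use F G \<tau> in \<open>auto simp: \<tau>_def\<close>)
  then show ?thesis by blast
qed

lemma is_equivalenceI:
  assumes "is_functor C D F" "is_functor D C G"
    "is_nat_iso C C (id_functor C) (comp_functor C F G) \<sigma>"
    "is_nat_iso D D (comp_functor D G F) (id_functor D) \<tau>"
  shows "is_equivalence C D F"
  unfolding is_equivalence_def by (intro conjI exI) (rule assms)+

lemma equivalence_inverse:
  assumes "is_equivalence C D F" shows "\<exists>G. is_equivalence D C G"
proof -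
  obtain G \<sigma> \<tau> where FG: "is_functor C D F" "is_functor D C G"
    "is_nat_iso C C (id_functor C) (comp_functor C F G) \<sigma>"
    "is_nat_iso D D (comp_functor D G F) (id_functor D) \<tau>"
    using assms by (auto simp: is_equivalence_def)
  obtain \<sigma>' \<tau>' where "is_nat_iso C C (comp_functor C F G) (id_functor C) \<sigma>'"
    "is_nat_iso D D (id_functor D) (comp_functor D G F) \<tau>'"
    using nat_iso_inverse[OF FG(3)] nat_iso_inverse[OF FG(4)] by (elim exE)
  then show ?thesis using is_equivalenceI[OF FG(2,1)] by (intro exI)
qed

section \<open>Cloven bifibrations\<close>

text \<open>The arrows \<open>X \<rightarrow> Y\<close> of the total category lying over \<open>g\<close>.\<close>

definition hom_over :: "('o, 'a, 'c, 'b) bifib \<Rightarrow> 'b \<Rightarrow> 'o \<Rightarrow> 'o \<Rightarrow> 'a set" where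
  "hom_over Q g X Y = {\<alpha> \<in> Hom (Tot Q) X Y. amap (prj Q) \<alpha> = g}"

text \<open>The objects \<open>f\<^sup>+S\<close> and \<open>g\<^sup>-T\<close>.\<close>

abbreviation pushed :: "('o, 'a, 'c, 'b) bifib \<Rightarrow> 'b \<Rightarrow> 'o \<Rightarrow> 'o" where
  "pushed Q f S \<equiv> Cod (Tot Q) (push Q f S)"

abbreviation pulled :: "('o, 'a, 'c, 'b) bifib \<Rightarrow> 'b \<Rightarrow> 'o \<Rightarrow> 'o" where
  "pulled Q g T \<equiv> Dom (Tot Q) (pull Q g T)"

lemma hom_overD:
  assumes "\<alpha> \<in> hom_over Q g X Y"
  shows "\<alpha> \<in> Hom (Tot Q) X Y" "amap (prj Q) \<alpha> = g"
  using assms by (auto simp: hom_over_def)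

lemma hom_overI: "\<alpha> \<in> Hom (Tot Q) X Y \<Longrightarrow> amap (prj Q) \<alpha> = g \<Longrightarrow> \<alpha> \<in> hom_over Q g X Y"
  by (simp add: hom_over_def)

lemma bif_functor: "is_bifibration C Q \<Longrightarrow> is_functor (Tot Q) C (prj Q)"
  by (simp add: is_bifibration_def)

lemma bif_cat:
  assumes "is_bifibration C Q" shows "is_category (Tot Q)" "is_category C"
  using functor_cat[OF bif_functor[OF assms]] by auto

lemma hom_over_obj:
  assumes "is_bifibration C Q" "\<alpha> \<in> hom_over Q g X Y"
  shows "X \<in> Obj (Tot Q)" "Y \<in> Obj (Tot Q)" "g \<in> Hom C (omap (prj Q) X) (omap (prj Q) Y)"
  using Hom_obj[OF bif_cat(1)[OF assms(1)] hom_overD(1)[OF assms(2)]]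
    functor_Hom[OF bif_functor[OF assms(1)] hom_overD(1)[OF assms(2)]] hom_overD(2)[OF assms(2)]
  by auto

lemma hom_over_cmp:
  assumes Q: "is_bifibration C Q"
    and a: "\<alpha> \<in> hom_over Q f X Y" and b: "\<beta> \<in> hom_over Q g Y Z"
  shows "Cmp (Tot Q) \<alpha> \<beta> \<in> hom_over Q (Cmp C f g) X Z"
  using cmp_Hom[OF bif_cat(1)[OF Q] hom_overD(1)[OF a] hom_overD(1)[OF b]]
    functor_cmp[OF bif_functor[OF Q] hom_overD(1)[OF a] hom_overD(1)[OF b]]
    hom_overD(2)[OF a] hom_overD(2)[OF b]
  by (auto intro: hom_overI)

lemma hom_over_ide:
  assumes Q: "is_bifibration C Q" and X: "X \<in> Obj (Tot Q)"
  shows "Ide (Tot Q) X \<in> hom_over Q (Ide C (omap (prj Q) X)) X X"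
  using ide_Hom[OF bif_cat(1)[OF Q] X] functor_ide[OF bif_functor[OF Q] X]
  by (auto intro: hom_overI)

lemma push_over:
  assumes Q: "is_bifibration C Q" and f: "f \<in> Hom C A B"
    and S: "S \<in> Obj (Tot Q)" "omap (prj Q) S = A"
  shows "push Q f S \<in> hom_over Q f S (pushed Q f S)"
    and "pushed Q f S \<in> Obj (Tot Q)" "omap (prj Q) (pushed Q f S) = B"
proof -
  show 1: "push Q f S \<in> hom_over Q f S (pushed Q f S)"
    using Q HomD[OF f] S unfolding is_bifibration_def
    by (intro hom_overI HomI) auto
  show "pushed Q f S \<in> Obj (Tot Q)" "omap (prj Q) (pushed Q f S) = B"
    using hom_over_obj[OF Q 1] f by (auto simp: Hom_def)
qed

lemma pull_over:
  assumes Q: "is_bifibration C Q" and g: "g \<in> Hom C A B"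
    and T: "T \<in> Obj (Tot Q)" "omap (prj Q) T = B"
  shows "pull Q g T \<in> hom_over Q g (pulled Q g T) T"
    and "pulled Q g T \<in> Obj (Tot Q)" "omap (prj Q) (pulled Q g T) = A"
proof -
  show 1: "pull Q g T \<in> hom_over Q g (pulled Q g T) T"
    using Q HomD[OF g] T unfolding is_bifibration_def
    by (intro hom_overI HomI) auto
  show "pulled Q g T \<in> Obj (Tot Q)" "omap (prj Q) (pulled Q g T) = A"
    using hom_over_obj[OF Q 1] g by (auto simp: Hom_def)
qed

lemma push_factor:
  assumes Q: "is_bifibration C Q" and f: "f \<in> Hom C A B" and g: "g \<in> Hom C B D"
    and S: "omap (prj Q) S = A" and \<alpha>: "\<alpha> \<in> hom_over Q (Cmp C f g) S T"
  shows "\<exists>!\<beta>. \<beta> \<in> hom_over Q g (pushed Q f S) T \<and> Cmp (Tot Q) (push Q f S) \<beta> = \<alpha>"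
proof -
  have S': "S \<in> Obj (Tot Q)" "omap (prj Q) S = Dom C f"
    using hom_over_obj[OF Q \<alpha>] S HomD[OF f] by simp_all
  note \<alpha>' = HomD[OF hom_overD(1)[OF \<alpha>]] hom_overD(2)[OF \<alpha>]
  note h = bspec[OF bspec[OF conjunct1[OF conjunct2[OF Q[unfolded is_bifibration_def]]]
    HomD(1)[OF f]] S'(1), THEN mp, OF S'(2), THEN conjunct2, THEN conjunct2, THEN conjunct2]
  have "Cod C f = Dom C g" using HomD[OF f] HomD[OF g] by simp
  from bspec[OF bspec[OF h HomD(1)[OF g]] \<alpha>'(1), THEN mp, OF this, THEN mp, OF \<alpha>'(2), THEN mp, OF \<alpha>'(4)]
  have "\<exists>!\<beta>. \<beta> \<in> Hom (Tot Q) (pushed Q f S) T \<and>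
                 amap (prj Q) \<beta> = g \<and> \<alpha> = Cmp (Tot Q) (push Q f S) \<beta>"
    by (simp only: \<alpha>'(3))
  moreover have "\<beta> \<in> hom_over Q g (pushed Q f S) T \<and> Cmp (Tot Q) (push Q f S) \<beta> = \<alpha> \<longleftrightarrow>
      \<beta> \<in> Hom (Tot Q) (pushed Q f S) T \<and> amap (prj Q) \<beta> = g \<and> \<alpha> = Cmp (Tot Q) (push Q f S) \<beta>" for \<beta>
    by (auto simp only: hom_over_def mem_Collect_eq)
  ultimately show ?thesis by (simp only:)
qed

lemma pull_factor:
  assumes Q: "is_bifibration C Q" and f: "f \<in> Hom C A B" and g: "g \<in> Hom C B D"
    and T: "omap (prj Q) T = D" and \<alpha>: "\<alpha> \<in> hom_over Q (Cmp C f g) S T"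
  shows "\<exists>!\<beta>. \<beta> \<in> hom_over Q f S (pulled Q g T) \<and> Cmp (Tot Q) \<beta> (pull Q g T) = \<alpha>"
proof -
  have T': "T \<in> Obj (Tot Q)" "omap (prj Q) T = Cod C g"
    using hom_over_obj[OF Q \<alpha>] T HomD[OF g] by simp_all
  note \<alpha>' = HomD[OF hom_overD(1)[OF \<alpha>]] hom_overD(2)[OF \<alpha>]
  note h = bspec[OF bspec[OF conjunct2[OF conjunct2[OF Q[unfolded is_bifibration_def]]]
    HomD(1)[OF g]] T'(1), THEN mp, OF T'(2), THEN conjunct2, THEN conjunct2, THEN conjunct2]
  have "Cod C f = Dom C g" using HomD[OF f] HomD[OF g] by simp
  from bspec[OF bspec[OF h HomD(1)[OF f]] \<alpha>'(1), THEN mp, OF this, THEN mp, OF \<alpha>'(3), THEN mp, OF \<alpha>'(4)]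
  have "\<exists>!\<beta>. \<beta> \<in> Hom (Tot Q) S (pulled Q g T) \<and>
                 amap (prj Q) \<beta> = f \<and> \<alpha> = Cmp (Tot Q) \<beta> (pull Q g T)"
    by (simp only: \<alpha>'(2))
  moreover have "\<beta> \<in> hom_over Q f S (pulled Q g T) \<and> Cmp (Tot Q) \<beta> (pull Q g T) = \<alpha> \<longleftrightarrow>
      \<beta> \<in> Hom (Tot Q) S (pulled Q g T) \<and> amap (prj Q) \<beta> = f \<and> \<alpha> = Cmp (Tot Q) \<beta> (pull Q g T)" for \<beta>
    by (auto simp only: hom_over_def mem_Collect_eq)
  ultimately show ?thesis by (simp only:)
qed

lemma is_bifibrationI:
  assumes F: "is_functor (Tot Q) C (prj Q)"
    and push: "\<And>f A B S. f \<in> Hom C A B \<Longrightarrow> S \<in> Obj (Tot Q) \<Longrightarrow> omap (prj Q) S = A \<Longrightarrow>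
      push Q f S \<in> hom_over Q f S (pushed Q f S)"
    and push_factor: "\<And>f g A B D S T \<alpha>. f \<in> Hom C A B \<Longrightarrow> g \<in> Hom C B D \<Longrightarrow>
      S \<in> Obj (Tot Q) \<Longrightarrow> omap (prj Q) S = A \<Longrightarrow> \<alpha> \<in> hom_over Q (Cmp C f g) S T \<Longrightarrow>
      \<exists>!\<beta>. \<beta> \<in> hom_over Q g (pushed Q f S) T \<and> Cmp (Tot Q) (push Q f S) \<beta> = \<alpha>"
    and pull: "\<And>g A B T. g \<in> Hom C A B \<Longrightarrow> T \<in> Obj (Tot Q) \<Longrightarrow> omap (prj Q) T = B \<Longrightarrow>
      pull Q g T \<in> hom_over Q g (pulled Q g T) T"
    and pull_factor: "\<And>f g A B D S T \<alpha>. f \<in> Hom C A B \<Longrightarrow> g \<in> Hom C B D \<Longrightarrow>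
      T \<in> Obj (Tot Q) \<Longrightarrow> omap (prj Q) T = D \<Longrightarrow> \<alpha> \<in> hom_over Q (Cmp C f g) S T \<Longrightarrow>
      \<exists>!\<beta>. \<beta> \<in> hom_over Q f S (pulled Q g T) \<and> Cmp (Tot Q) \<beta> (pull Q g T) = \<alpha>"
  shows "is_bifibration C Q"
  unfolding is_bifibration_def
proof (intro conjI ballI impI)
  fix f S assume f: "f \<in> Arr C" and S: "S \<in> Obj (Tot Q)" "omap (prj Q) S = Dom C f"
  note h = push[OF Hom_Dom_Cod[OF f] S]
  show "push Q f S \<in> Arr (Tot Q)" "Dom (Tot Q) (push Q f S) = S" "amap (prj Q) (push Q f S) = f"
    using h by (auto simp: hom_over_def Hom_def)
  fix g \<alpha> assume "g \<in> Arr C" "\<alpha> \<in> Arr (Tot Q)" "Cod C f = Dom C g"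
    "Dom (Tot Q) \<alpha> = S" "amap (prj Q) \<alpha> = Cmp C f g"
  then have "\<exists>!\<beta>. \<beta> \<in> hom_over Q g (pushed Q f S) (Cod (Tot Q) \<alpha>) \<and> Cmp (Tot Q) (push Q f S) \<beta> = \<alpha>"
    by (intro push_factor[OF Hom_Dom_Cod[OF f] _ S, of g "Cod C g"] hom_overI HomI) simp_all
  then show "\<exists>!\<beta>. \<beta> \<in> Hom (Tot Q) (pushed Q f S) (Cod (Tot Q) \<alpha>) \<and>
                 amap (prj Q) \<beta> = g \<and> \<alpha> = Cmp (Tot Q) (push Q f S) \<beta>"
    by (simp only: hom_over_def mem_Collect_eq conj_assoc eq_commute[of \<alpha>])
next
  fix g T assume g: "g \<in> Arr C" and T: "T \<in> Obj (Tot Q)" "omap (prj Q) T = Cod C g"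
  note h = pull[OF Hom_Dom_Cod[OF g] T]
  show "pull Q g T \<in> Arr (Tot Q)" "Cod (Tot Q) (pull Q g T) = T" "amap (prj Q) (pull Q g T) = g"
    using h by (auto simp: hom_over_def Hom_def)
  fix f \<alpha> assume "f \<in> Arr C" "\<alpha> \<in> Arr (Tot Q)" "Cod C f = Dom C g"
    "Cod (Tot Q) \<alpha> = T" "amap (prj Q) \<alpha> = Cmp C f g"
  then have "\<exists>!\<beta>. \<beta> \<in> hom_over Q f (Dom (Tot Q) \<alpha>) (pulled Q g T) \<and> Cmp (Tot Q) \<beta> (pull Q g T) = \<alpha>"
    by (intro pull_factor[OF _ Hom_Dom_Cod[OF g] T, of f "Dom C f"] hom_overI HomI) simp_all
  then show "\<exists>!\<beta>. \<beta> \<in> Hom (Tot Q) (Dom (Tot Q) \<alpha>) (pulled Q g T) \<and>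
                 amap (prj Q) \<beta> = f \<and> \<alpha> = Cmp (Tot Q) \<beta> (pull Q g T)"
    by (simp only: hom_over_def mem_Collect_eq conj_assoc eq_commute[of \<alpha>])
qed (rule F)

lemma is_bifib_morphismI:
  assumes "is_bifibration C Q" "is_bifibration C Q'" "is_functor (Tot Q) (Tot Q') G"
    and "\<And>X. X \<in> Obj (Tot Q) \<Longrightarrow> omap (prj Q') (omap G X) = omap (prj Q) X"
    and "\<And>\<alpha>. \<alpha> \<in> Arr (Tot Q) \<Longrightarrow> amap (prj Q') (amap G \<alpha>) = amap (prj Q) \<alpha>"
    and "\<And>f A B S. f \<in> Hom C A B \<Longrightarrow> S \<in> Obj (Tot Q) \<Longrightarrow> omap (prj Q) S = A \<Longrightarrow>
      amap G (push Q f S) = push Q' f (omap G S)"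
    and "\<And>g A B T. g \<in> Hom C A B \<Longrightarrow> T \<in> Obj (Tot Q) \<Longrightarrow> omap (prj Q) T = B \<Longrightarrow>
      amap G (pull Q g T) = pull Q' g (omap G T)"
  shows "is_bifib_morphism C Q Q' G"
  unfolding is_bifib_morphism_def
  using assms(1,2,3) assms(6)[OF Hom_Dom_Cod] assms(7)[OF Hom_Dom_Cod]
    functor_eqI[OF comp_functor[OF assms(3) bif_functor[OF assms(2)]] bif_functor[OF assms(1)]]
    assms(4,5)
  by auto

lemma bifib_morphismD:
  assumes "is_bifib_morphism C Q Q' G"
  shows "is_bifibration C Q" "is_bifibration C Q'" "is_functor (Tot Q) (Tot Q') G"
    and "comp_functor (Tot Q) G (prj Q') = prj Q"
  using assms by (auto simp: is_bifib_morphism_def)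

lemma bifib_morphism_prj:
  assumes "is_bifib_morphism C Q Q' G"
  shows "X \<in> Obj (Tot Q) \<Longrightarrow> omap (prj Q') (omap G X) = omap (prj Q) X"
    and "\<alpha> \<in> Arr (Tot Q) \<Longrightarrow> amap (prj Q') (amap G \<alpha>) = amap (prj Q) \<alpha>"
  using bifib_morphismD(4)[OF assms] comp_functor_apply by metis+

lemma bifib_morphism_over:
  assumes "is_bifib_morphism C Q Q' G" "\<alpha> \<in> hom_over Q g X Y"
  shows "amap G \<alpha> \<in> hom_over Q' g (omap G X) (omap G Y)"
  using functor_Hom[OF bifib_morphismD(3)[OF assms(1)] hom_overD(1)[OF assms(2)]]
    bifib_morphism_prj(2)[OF assms(1) HomD(1)[OF hom_overD(1)[OF assms(2)]]]
    hom_overD(2)[OF assms(2)]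
  by (auto intro: hom_overI)

lemma bifib_morphism_push:
  assumes G: "is_bifib_morphism C Q Q' G" and f: "f \<in> Hom C A B"
    and S: "S \<in> Obj (Tot Q)" "omap (prj Q) S = A"
  shows "amap G (push Q f S) = push Q' f (omap G S)"
    and "omap G (pushed Q f S) = pushed Q' f (omap G S)"
proof -
  show 1: "amap G (push Q f S) = push Q' f (omap G S)"
    using G f S by (auto simp: is_bifib_morphism_def Hom_def)
  show "omap G (pushed Q f S) = pushed Q' f (omap G S)"
    using HomD(3)[OF functor_Hom[OF bifib_morphismD(3)[OF G]
        hom_overD(1)[OF push_over(1)[OF bifib_morphismD(1)[OF G] f S]]]] 1 by simp
qed

lemma bifib_morphism_pull:
  assumes G: "is_bifib_morphism C Q Q' G" and g: "g \<in> Hom C A B"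
    and T: "T \<in> Obj (Tot Q)" "omap (prj Q) T = B"
  shows "amap G (pull Q g T) = pull Q' g (omap G T)"
    and "omap G (pulled Q g T) = pulled Q' g (omap G T)"
proof -
  show 1: "amap G (pull Q g T) = pull Q' g (omap G T)"
    using G g T by (auto simp: is_bifib_morphism_def Hom_def)
  show "omap G (pulled Q g T) = pulled Q' g (omap G T)"
    using HomD(2)[OF functor_Hom[OF bifib_morphismD(3)[OF G]
        hom_overD(1)[OF pull_over(1)[OF bifib_morphismD(1)[OF G] g T]]]] 1 by simp
qed

lemma id_bifib_morphism:
  assumes Q: "is_bifibration C Q" shows "is_bifib_morphism C Q Q (id_functor (Tot Q))"
proof (rule is_bifib_morphismI[OF Q Q id_functor[OF bif_cat(1)[OF Q]]])
  fix f A B S assume "f \<in> Hom C A B" "S \<in> Obj (Tot Q)" "omap (prj Q) S = A"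
  then show "amap (id_functor (Tot Q)) (push Q f S) = push Q f (omap (id_functor (Tot Q)) S)"
    using HomD(1)[OF hom_overD(1)[OF push_over(1)[OF Q]]] by simp
next
  fix f A B S assume "f \<in> Hom C A B" "S \<in> Obj (Tot Q)" "omap (prj Q) S = B"
  then show "amap (id_functor (Tot Q)) (pull Q f S) = pull Q f (omap (id_functor (Tot Q)) S)"
    using HomD(1)[OF hom_overD(1)[OF pull_over(1)[OF Q]]] by simp
qed auto

lemma comp_bifib_morphism:
  assumes G: "is_bifib_morphism C Q Q' G" and H: "is_bifib_morphism C Q' Q'' H"
  shows "is_bifib_morphism C Q Q'' (comp_functor (Tot Q) G H)"
proof (rule is_bifib_morphismI[OF bifib_morphismD(1)[OF G] bifib_morphismD(2)[OF H]
      comp_functor[OF bifib_morphismD(3)[OF G] bifib_morphismD(3)[OF H]]])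
  fix X assume X: "X \<in> Obj (Tot Q)"
  then show "omap (prj Q'') (omap (comp_functor (Tot Q) G H) X) = omap (prj Q) X"
    using functor_obj[OF bifib_morphismD(3)[OF G] X]
    by (simp add: bifib_morphism_prj[OF G] bifib_morphism_prj[OF H])
next
  fix X assume X: "X \<in> Arr (Tot Q)"
  then show "amap (prj Q'') (amap (comp_functor (Tot Q) G H) X) = amap (prj Q) X"
    using HomD(1)[OF functor_Hom[OF bifib_morphismD(3)[OF G] Hom_Dom_Cod[OF X]]]
    by (simp add: bifib_morphism_prj[OF G] bifib_morphism_prj[OF H])
next
  fix f A B S assume h: "f \<in> Hom C A B" "S \<in> Obj (Tot Q)" "omap (prj Q) S = A"
  show "amap (comp_functor (Tot Q) G H) (push Q f S) = push Q'' f (omap (comp_functor (Tot Q) G H) S)"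
    using HomD(1)[OF hom_overD(1)[OF push_over(1)[OF bifib_morphismD(1)[OF G] h]]]
      bifib_morphism_push(1)[OF G h] functor_obj[OF bifib_morphismD(3)[OF G] h(2)]
      bifib_morphism_push(1)[OF H h(1), of "omap G S"] bifib_morphism_prj(1)[OF G h(2)] h
    by simp
next
  fix f A B S assume h: "f \<in> Hom C A B" "S \<in> Obj (Tot Q)" "omap (prj Q) S = B"
  show "amap (comp_functor (Tot Q) G H) (pull Q f S) = pull Q'' f (omap (comp_functor (Tot Q) G H) S)"
    using HomD(1)[OF hom_overD(1)[OF pull_over(1)[OF bifib_morphismD(1)[OF G] h]]]
      bifib_morphism_pull(1)[OF G h] functor_obj[OF bifib_morphismD(3)[OF G] h(2)]
      bifib_morphism_pull(1)[OF H h(1), of "omap G S"] bifib_morphism_prj(1)[OF G h(2)] h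
    by simp
qed

lemma fiber_simps [simp]:
  "Obj (fiber Q C A) = {S \<in> Obj (Tot Q). omap (prj Q) S = A}"
  "Arr (fiber Q C A) = {\<alpha> \<in> Arr (Tot Q). amap (prj Q) \<alpha> = Ide C A}"
  "Dom (fiber Q C A) = Dom (Tot Q)" "Cod (fiber Q C A) = Cod (Tot Q)"
  "Ide (fiber Q C A) = Ide (Tot Q)" "Cmp (fiber Q C A) = Cmp (Tot Q)"
  by (simp_all add: fiber_def)

lemma Hom_fiber: "Hom (fiber Q C A) X Y = hom_over Q (Ide C A) X Y"
  by (auto simp: Hom_def hom_over_def)

lemma category_fiber:
  assumes Q: "is_bifibration C Q" and A: "A \<in> Obj C"
  shows "is_category (fiber Q C A)"
proof (rule is_categoryI)
  note QC = bif_cat(1)[OF Q] and C = bif_cat(2)[OF Q]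
  note AA = ide_Hom[OF C A]
  show "Dom (fiber Q C A) f \<in> Obj (fiber Q C A)" "Cod (fiber Q C A) f \<in> Obj (fiber Q C A)"
    if f: "f \<in> Arr (fiber Q C A)" for f
  proof -
    have "f \<in> hom_over Q (Ide C A) (Dom (Tot Q) f) (Cod (Tot Q) f)"
      using f by (auto simp: hom_over_def Hom_def)
    from hom_over_obj[OF Q this]
    show "Dom (fiber Q C A) f \<in> Obj (fiber Q C A)" "Cod (fiber Q C A) f \<in> Obj (fiber Q C A)"
      using AA by (auto simp: Hom_def)
  qed
  show "Ide (fiber Q C A) X \<in> Hom (fiber Q C A) X X" if "X \<in> Obj (fiber Q C A)" for X
    using that hom_over_ide[OF Q, of X] by (simp add: Hom_fiber)
  fix f g h X Y Z W
  assume f: "f \<in> Hom (fiber Q C A) X Y"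
  then show "Cmp (fiber Q C A) (Ide (fiber Q C A) X) f = f" "Cmp (fiber Q C A) f (Ide (fiber Q C A) Y) = f"
    using ide_cmp[OF QC, of f X Y] cmp_ide[OF QC, of f X Y] by (simp_all add: Hom_fiber hom_overD(1))
  assume g: "g \<in> Hom (fiber Q C A) Y Z"
  show "Cmp (fiber Q C A) f g \<in> Hom (fiber Q C A) X Z"
    using hom_over_cmp[OF Q f[unfolded Hom_fiber] g[unfolded Hom_fiber]] ide_cmp[OF C AA] by (simp add: Hom_fiber)
  assume h: "h \<in> Hom (fiber Q C A) Z W"
  show "Cmp (fiber Q C A) (Cmp (fiber Q C A) f g) h = Cmp (fiber Q C A) f (Cmp (fiber Q C A) g h)"
    using cmp_assoc[OF QC hom_overD(1)[OF f[unfolded Hom_fiber]] hom_overD(1)[OF g[unfolded Hom_fiber]]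
        hom_overD(1)[OF h[unfolded Hom_fiber]]] by simp
qed


section \<open>Replacing the objects of a bifibration\<close>

text \<open>Let \<open>\<pi>\<close> map a set \<open>Ob\<close> into the objects of a bifibration \<open>Q\<close>, and suppose that the objects
  \<open>f\<^sup>+(\<pi> x)\<close> and \<open>g\<^sup>-(\<pi> y)\<close> come with chosen preimages \<open>pu f x\<close> and \<open>pl g y\<close> under \<open>\<pi>\<close>. Then \<open>Ob\<close> is
  the object set of a bifibration in which an arrow \<open>x \<rightarrow> y\<close> is an arrow \<open>\<phi> : \<pi> x \<rightarrow> \<pi> y\<close> of \<open>Q\<close>; it
  is encoded as \<open>\<kappa> (x, \<phi>, y)\<close> for an injection \<open>\<kappa>\<close> into a type that may be chosen freely.\<close>

locale inflation =
  fixes C :: "('c, 'b) cat" and Q :: "('o, 'a, 'c, 'b) bifib"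
    and Ob :: "'p set" and \<pi> :: "'p \<Rightarrow> 'o" and \<kappa> :: "'p \<times> 'a \<times> 'p \<Rightarrow> 'd"
    and pu pl :: "'b \<Rightarrow> 'p \<Rightarrow> 'p"
  assumes Q: "is_bifibration C Q"
    and \<pi>: "\<And>x. x \<in> Ob \<Longrightarrow> \<pi> x \<in> Obj (Tot Q)"
    and inj: "inj_on \<kappa> {(x, \<phi>, y). x \<in> Ob \<and> y \<in> Ob \<and> \<phi> \<in> Hom (Tot Q) (\<pi> x) (\<pi> y)}"
    and pu: "\<And>f A B x. f \<in> Hom C A B \<Longrightarrow> x \<in> Ob \<Longrightarrow> omap (prj Q) (\<pi> x) = A \<Longrightarrow>
      pu f x \<in> Ob \<and> \<pi> (pu f x) = pushed Q f (\<pi> x)"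
    and pl: "\<And>g A B y. g \<in> Hom C A B \<Longrightarrow> y \<in> Ob \<Longrightarrow> omap (prj Q) (\<pi> y) = B \<Longrightarrow>
      pl g y \<in> Ob \<and> \<pi> (pl g y) = pulled Q g (\<pi> y)"
begin

text \<open>The triples that represent arrows, their decoding, the inflated bifibration, and its projection
  to \<open>Q\<close>.\<close>

definition Ar :: "('p \<times> 'a \<times> 'p) set" where
  "Ar = {(x, \<phi>, y). x \<in> Ob \<and> y \<in> Ob \<and> \<phi> \<in> Hom (Tot Q) (\<pi> x) (\<pi> y)}"

definition dec :: "'d \<Rightarrow> 'p \<times> 'a \<times> 'p" where
  "dec = inv_into Ar \<kappa>"

definition Infl :: "('p, 'd, 'c, 'b) bifib" where
  "Infl = \<lparr>Tot = \<lparr>Obj = Ob, Arr = \<kappa> ` Ar,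
       Dom = (\<lambda>a. fst (dec a)), Cod = (\<lambda>a. snd (snd (dec a))),
       Ide = (\<lambda>x. \<kappa> (x, Ide (Tot Q) (\<pi> x), x)),
       Cmp = (\<lambda>a b. \<kappa> (fst (dec a), Cmp (Tot Q) (fst (snd (dec a))) (fst (snd (dec b))), snd (snd (dec b))))\<rparr>,
     prj = \<lparr>omap = (\<lambda>x \<in> Ob. omap (prj Q) (\<pi> x)), amap = (\<lambda>a \<in> \<kappa> ` Ar. amap (prj Q) (fst (snd (dec a))))\<rparr>,
     push = (\<lambda>f x. \<kappa> (x, push Q f (\<pi> x), pu f x)),
     pull = (\<lambda>g y. \<kappa> (pl g y, pull Q g (\<pi> y), y))\<rparr>"

definition proj :: "('p, 'd, 'o, 'a) fctr" where
  "proj = \<lparr>omap = (\<lambda>x \<in> Ob. \<pi> x), amap = (\<lambda>a \<in> \<kappa> ` Ar. fst (snd (dec a)))\<rparr>"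

lemma ArI: "x \<in> Ob \<Longrightarrow> y \<in> Ob \<Longrightarrow> \<phi> \<in> Hom (Tot Q) (\<pi> x) (\<pi> y) \<Longrightarrow> (x, \<phi>, y) \<in> Ar"
  by (simp add: Ar_def)

lemma dec [simp]: "t \<in> Ar \<Longrightarrow> dec (\<kappa> t) = t"
  unfolding dec_def using inj by (intro inv_into_f_f) (simp_all add: Ar_def)

lemma Obj_Infl [simp]: "Obj (Tot Infl) = Ob" by (simp add: Infl_def)
lemma Arr_Infl: "Arr (Tot Infl) = \<kappa> ` Ar" by (simp add: Infl_def)

lemma Hom_Infl:
  "a \<in> Hom (Tot Infl) x y \<longleftrightarrow> (\<exists>\<phi>. x \<in> Ob \<and> y \<in> Ob \<and> \<phi> \<in> Hom (Tot Q) (\<pi> x) (\<pi> y) \<and> a = \<kappa> (x, \<phi>, y))"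
proof
  assume "a \<in> Hom (Tot Infl) x y"
  then have a: "a \<in> \<kappa> ` Ar" "fst (dec a) = x" "snd (snd (dec a)) = y"
    by (auto simp: Hom_def Infl_def)
  then obtain t where "t \<in> Ar" "a = \<kappa> t" by auto
  with a show "\<exists>\<phi>. x \<in> Ob \<and> y \<in> Ob \<and> \<phi> \<in> Hom (Tot Q) (\<pi> x) (\<pi> y) \<and> a = \<kappa> (x, \<phi>, y)"
    by (cases t) (auto simp: Ar_def)
next
  assume "\<exists>\<phi>. x \<in> Ob \<and> y \<in> Ob \<and> \<phi> \<in> Hom (Tot Q) (\<pi> x) (\<pi> y) \<and> a = \<kappa> (x, \<phi>, y)"
  then obtain \<phi> where "(x, \<phi>, y) \<in> Ar" "a = \<kappa> (x, \<phi>, y)" by (auto simp: Ar_def)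
  then show "a \<in> Hom (Tot Infl) x y" by (auto simp: Hom_def Infl_def)
qed

lemma cmp_Infl:
  assumes "x \<in> Ob" "y \<in> Ob" "z \<in> Ob" "\<phi> \<in> Hom (Tot Q) (\<pi> x) (\<pi> y)" "\<psi> \<in> Hom (Tot Q) (\<pi> y) (\<pi> z)"
  shows "Cmp (Tot Infl) (\<kappa> (x, \<phi>, y)) (\<kappa> (y, \<psi>, z)) = \<kappa> (x, Cmp (Tot Q) \<phi> \<psi>, z)"
  using assms by (simp add: Infl_def ArI)

lemma ide_Infl: "Ide (Tot Infl) x = \<kappa> (x, Ide (Tot Q) (\<pi> x), x)"
  by (simp add: Infl_def)

lemma prj_Infl:
  "x \<in> Ob \<Longrightarrow> omap (prj Infl) x = omap (prj Q) (\<pi> x)"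
  "(x, \<phi>, y) \<in> Ar \<Longrightarrow> amap (prj Infl) (\<kappa> (x, \<phi>, y)) = amap (prj Q) \<phi>"
  by (simp_all add: Infl_def)

lemma proj_apply:
  "x \<in> Ob \<Longrightarrow> omap proj x = \<pi> x"
  "(x, \<phi>, y) \<in> Ar \<Longrightarrow> amap proj (\<kappa> (x, \<phi>, y)) = \<phi>"
  by (simp_all add: proj_def)

lemma inj_eq:
  assumes "x \<in> Ob" "y \<in> Ob" "\<phi> \<in> Hom (Tot Q) (\<pi> x) (\<pi> y)" "\<psi> \<in> Hom (Tot Q) (\<pi> x) (\<pi> y)"
  shows "\<kappa> (x, \<phi>, y) = \<kappa> (x, \<psi>, y) \<longleftrightarrow> \<phi> = \<psi>"
  using dec[OF ArI[OF assms(1,2,3)]] dec[OF ArI[OF assms(1,2,4)]] by (metis Pair_inject)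

lemma over_Infl:
  "a \<in> hom_over Infl g x y \<longleftrightarrow> (\<exists>\<phi>. x \<in> Ob \<and> y \<in> Ob \<and> \<phi> \<in> hom_over Q g (\<pi> x) (\<pi> y) \<and> a = \<kappa> (x, \<phi>, y))"
  unfolding hom_over_def using prj_Infl(2) ArI by (auto simp: Hom_Infl)

lemma category_Infl: "is_category (Tot Infl)"
proof (rule is_categoryI)
  note C = bif_cat(1)[OF Q]
  show "Dom (Tot Infl) f \<in> Obj (Tot Infl)" "Cod (Tot Infl) f \<in> Obj (Tot Infl)" if "f \<in> Arr (Tot Infl)" for f
    using Hom_Dom_Cod[OF that] by (auto simp: Hom_Infl)
  show "Ide (Tot Infl) A \<in> Hom (Tot Infl) A A" if "A \<in> Obj (Tot Infl)" for A
    using that ide_Hom[OF C \<pi>] by (auto simp: Hom_Infl ide_Infl)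
  fix f A B assume f: "f \<in> Hom (Tot Infl) A B"
  then obtain \<phi> where \<phi>: "A \<in> Ob" "B \<in> Ob" "\<phi> \<in> Hom (Tot Q) (\<pi> A) (\<pi> B)" "f = \<kappa> (A, \<phi>, B)"
    by (auto simp: Hom_Infl)
  show "Cmp (Tot Infl) (Ide (Tot Infl) A) f = f"
    using \<phi> \<pi> ide_Hom[OF C] ide_cmp[OF C] by (simp add: ide_Infl cmp_Infl)
  show "Cmp (Tot Infl) f (Ide (Tot Infl) B) = f"
    using \<phi> \<pi> ide_Hom[OF C] cmp_ide[OF C] by (simp add: ide_Infl cmp_Infl)
  fix g D assume g: "g \<in> Hom (Tot Infl) B D"
  then obtain \<psi> where \<psi>: "D \<in> Ob" "\<psi> \<in> Hom (Tot Q) (\<pi> B) (\<pi> D)" "g = \<kappa> (B, \<psi>, D)"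
    by (auto simp: Hom_Infl)
  note \<phi>\<psi> = cmp_Hom[OF C \<phi>(3) \<psi>(2)]
  show "Cmp (Tot Infl) f g \<in> Hom (Tot Infl) A D"
    using \<phi> \<psi> \<phi>\<psi> by (auto simp: cmp_Infl Hom_Infl)
  fix h E assume h: "h \<in> Hom (Tot Infl) D E"
  then obtain \<chi> where \<chi>: "E \<in> Ob" "\<chi> \<in> Hom (Tot Q) (\<pi> D) (\<pi> E)" "h = \<kappa> (D, \<chi>, E)"
    by (auto simp: Hom_Infl)
  show "Cmp (Tot Infl) (Cmp (Tot Infl) f g) h = Cmp (Tot Infl) f (Cmp (Tot Infl) g h)"
    using \<phi> \<psi> \<chi> \<phi>\<psi> cmp_Hom[OF C \<psi>(2) \<chi>(2)] cmp_assoc[OF C \<phi>(3) \<psi>(2) \<chi>(2)] by (simp add: cmp_Infl)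
qed

lemma functor_proj: "is_functor (Tot Infl) (Tot Q) proj"
proof (rule is_functorI)
  show "amap proj f \<in> Hom (Tot Q) (omap proj A) (omap proj B)" if "f \<in> Hom (Tot Infl) A B" for f A B
    using that proj_apply ArI by (auto simp: Hom_Infl)
  show "amap proj (Ide (Tot Infl) A) = Ide (Tot Q) (omap proj A)" if "A \<in> Obj (Tot Infl)" for A
    using that proj_apply ArI \<pi> ide_Hom[OF bif_cat(1)[OF Q]] by (auto simp: ide_Infl)
  show "amap proj (Cmp (Tot Infl) f g) = Cmp (Tot Q) (amap proj f) (amap proj g)"
    if "f \<in> Hom (Tot Infl) A B" "g \<in> Hom (Tot Infl) B E" for f g A B E
    using that cmp_Infl proj_apply ArI cmp_Hom[OF bif_cat(1)[OF Q]] by (auto simp: Hom_Infl)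
qed (use \<pi> category_Infl bif_cat[OF Q] in \<open>auto simp: proj_def Arr_Infl\<close>)

lemma comp_proj_prj: "comp_functor (Tot Infl) proj (prj Q) = prj Infl"
  by (auto simp: comp_functor_def proj_def Infl_def intro!: restrict_ext)

lemma push_Infl: "push Infl f x = \<kappa> (x, push Q f (\<pi> x), pu f x)"
  and pull_Infl: "pull Infl f x = \<kappa> (pl f x, pull Q f (\<pi> x), x)"
  by (simp_all add: Infl_def)

lemma pushed_Infl:
  assumes f: "f \<in> Hom C A B" and x: "x \<in> Ob" "omap (prj Q) (\<pi> x) = A"
  shows "push Infl f x \<in> hom_over Infl f x (pushed Infl f x)" "pushed Infl f x = pu f x"
proof -
  have 1: "push Q f (\<pi> x) \<in> hom_over Q f (\<pi> x) (\<pi> (pu f x))"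
    using push_over(1)[OF Q f \<pi>[OF x(1)] x(2)] pu[OF f x] by simp
  have 2: "push Infl f x \<in> hom_over Infl f x (pu f x)"
    using 1 x pu[OF f x] by (simp add: push_Infl over_Infl) blast
  then show "pushed Infl f x = pu f x" by (rule HomD(3)[OF hom_overD(1)])
  then show "push Infl f x \<in> hom_over Infl f x (pushed Infl f x)" using 2 by simp
qed

lemma pulled_Infl:
  assumes g: "g \<in> Hom C A B" and y: "y \<in> Ob" "omap (prj Q) (\<pi> y) = B"
  shows "pull Infl g y \<in> hom_over Infl g (pulled Infl g y) y" "pulled Infl g y = pl g y"
proof -
  have 1: "pull Q g (\<pi> y) \<in> hom_over Q g (\<pi> (pl g y)) (\<pi> y)"
    using pull_over(1)[OF Q g \<pi>[OF y(1)] y(2)] pl[OF g y] by simp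
  have 2: "pull Infl g y \<in> hom_over Infl g (pl g y) y"
    using 1 y pl[OF g y] by (simp add: pull_Infl over_Infl) blast
  then show "pulled Infl g y = pl g y" by (rule HomD(2)[OF hom_overD(1)])
  then show "pull Infl g y \<in> hom_over Infl g (pulled Infl g y) y" using 2 by simp
qed

lemma bifibration_Infl: "is_bifibration C Infl"
proof (rule is_bifibrationI)
  show "is_functor (Tot Infl) C (prj Infl)"
    using comp_functor[OF functor_proj bif_functor[OF Q]] by (simp add: comp_proj_prj)
  fix f A B assume f: "f \<in> Hom C A B"
  {
    fix S assume S: "S \<in> Obj (Tot Infl)" "omap (prj Infl) S = A"
    then have S': "S \<in> Ob" "omap (prj Q) (\<pi> S) = A" by (simp_all add: prj_Infl)
    show "push Infl f S \<in> hom_over Infl f S (pushed Infl f S)" by (rule pushed_Infl[OF f S'])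
    fix g D T \<alpha> assume g: "g \<in> Hom C B D" and \<alpha>: "\<alpha> \<in> hom_over Infl (Cmp C f g) S T"
    then obtain \<phi> where \<phi>: "T \<in> Ob" "\<phi> \<in> hom_over Q (Cmp C f g) (\<pi> S) (\<pi> T)" "\<alpha> = \<kappa> (S, \<phi>, T)"
      by (auto simp: over_Infl)
    have p: "push Q f (\<pi> S) \<in> Hom (Tot Q) (\<pi> S) (\<pi> (pu f S))"
      using hom_overD(1)[OF push_over(1)[OF Q f \<pi>[OF S'(1)] S'(2)]] pu[OF f S'] by simp
    have U: "\<exists>!\<beta>. \<beta> \<in> hom_over Q g (\<pi> (pu f S)) (\<pi> T) \<and> Cmp (Tot Q) (push Q f (\<pi> S)) \<beta> = \<phi>"
      using push_factor[OF Q f g S'(2) \<phi>(2)] pu[OF f S'] by simp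
    have eq: "Cmp (Tot Infl) (push Infl f S) (\<kappa> (pu f S, \<beta>, T)) = \<alpha> \<longleftrightarrow> Cmp (Tot Q) (push Q f (\<pi> S)) \<beta> = \<phi>"
      if "\<beta> \<in> Hom (Tot Q) (\<pi> (pu f S)) (\<pi> T)" for \<beta>
      using cmp_Infl[OF S'(1) _ \<phi>(1) p that] pu[OF f S'] \<phi>(3)
        inj_eq[OF S'(1) \<phi>(1) cmp_Hom[OF bif_cat(1)[OF Q] p that] hom_overD(1)[OF \<phi>(2)]]
      by (simp add: push_Infl)
    from U obtain \<beta> where \<beta>: "\<beta> \<in> hom_over Q g (\<pi> (pu f S)) (\<pi> T)" "Cmp (Tot Q) (push Q f (\<pi> S)) \<beta> = \<phi>"
      by blast
    show "\<exists>!\<beta>. \<beta> \<in> hom_over Infl g (pushed Infl f S) T \<and> Cmp (Tot Infl) (push Infl f S) \<beta> = \<alpha>"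
    proof (rule ex1I[of _ "\<kappa> (pu f S, \<beta>, T)"], unfold pushed_Infl(2)[OF f S'])
      show "\<kappa> (pu f S, \<beta>, T) \<in> hom_over Infl g (pu f S) T \<and>
          Cmp (Tot Infl) (push Infl f S) (\<kappa> (pu f S, \<beta>, T)) = \<alpha>"
        using \<beta> eq[OF hom_overD(1)[OF \<beta>(1)]] pu[OF f S'] \<phi>(1) unfolding over_Infl by blast
      fix b assume "b \<in> hom_over Infl g (pu f S) T \<and> Cmp (Tot Infl) (push Infl f S) b = \<alpha>"
      then show "b = \<kappa> (pu f S, \<beta>, T)"
        using U \<beta> eq hom_overD(1) unfolding over_Infl by metis
    qed
  }
  fix T assume T: "T \<in> Obj (Tot Infl)" "omap (prj Infl) T = B"
  then have T': "T \<in> Ob" "omap (prj Q) (\<pi> T) = B" by (simp_all add: prj_Infl)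
  show "pull Infl f T \<in> hom_over Infl f (pulled Infl f T) T" by (rule pulled_Infl[OF f T'])
next
  fix f g A B D S T \<alpha>
  assume f: "f \<in> Hom C A B" and g: "g \<in> Hom C B D" and T: "T \<in> Obj (Tot Infl)" "omap (prj Infl) T = D"
    and \<alpha>: "\<alpha> \<in> hom_over Infl (Cmp C f g) S T"
  then have T': "T \<in> Ob" "omap (prj Q) (\<pi> T) = D" by (simp_all add: prj_Infl)
  from \<alpha> obtain \<phi> where \<phi>: "S \<in> Ob" "\<phi> \<in> hom_over Q (Cmp C f g) (\<pi> S) (\<pi> T)" "\<alpha> = \<kappa> (S, \<phi>, T)"
    by (auto simp: over_Infl)
  have p: "pull Q g (\<pi> T) \<in> Hom (Tot Q) (\<pi> (pl g T)) (\<pi> T)"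
    using hom_overD(1)[OF pull_over(1)[OF Q g \<pi>[OF T'(1)] T'(2)]] pl[OF g T'] by simp
  have U: "\<exists>!\<beta>. \<beta> \<in> hom_over Q f (\<pi> S) (\<pi> (pl g T)) \<and> Cmp (Tot Q) \<beta> (pull Q g (\<pi> T)) = \<phi>"
    using pull_factor[OF Q f g T'(2) \<phi>(2)] pl[OF g T'] by simp
  have eq: "Cmp (Tot Infl) (\<kappa> (S, \<beta>, pl g T)) (pull Infl g T) = \<alpha> \<longleftrightarrow> Cmp (Tot Q) \<beta> (pull Q g (\<pi> T)) = \<phi>"
    if "\<beta> \<in> Hom (Tot Q) (\<pi> S) (\<pi> (pl g T))" for \<beta>
    using cmp_Infl[OF \<phi>(1) _ T'(1) that p] pl[OF g T'] \<phi>(3)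
      inj_eq[OF \<phi>(1) T'(1) cmp_Hom[OF bif_cat(1)[OF Q] that p] hom_overD(1)[OF \<phi>(2)]]
    by (simp add: pull_Infl)
  from U obtain \<beta> where \<beta>: "\<beta> \<in> hom_over Q f (\<pi> S) (\<pi> (pl g T))" "Cmp (Tot Q) \<beta> (pull Q g (\<pi> T)) = \<phi>"
    by blast
  show "\<exists>!\<beta>. \<beta> \<in> hom_over Infl f S (pulled Infl g T) \<and> Cmp (Tot Infl) \<beta> (pull Infl g T) = \<alpha>"
  proof (rule ex1I[of _ "\<kappa> (S, \<beta>, pl g T)"], unfold pulled_Infl(2)[OF g T'])
    show "\<kappa> (S, \<beta>, pl g T) \<in> hom_over Infl f S (pl g T) \<and>
        Cmp (Tot Infl) (\<kappa> (S, \<beta>, pl g T)) (pull Infl g T) = \<alpha>"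
      using \<beta> eq[OF hom_overD(1)[OF \<beta>(1)]] pl[OF g T'] \<phi>(1) unfolding over_Infl by blast
    fix b assume "b \<in> hom_over Infl f S (pl g T) \<and> Cmp (Tot Infl) b (pull Infl g T) = \<alpha>"
    then show "b = \<kappa> (S, \<beta>, pl g T)"
      using U \<beta> eq hom_overD(1) unfolding over_Infl by metis
  qed
qed

lemma morphism_proj: "is_bifib_morphism C Infl Q proj"
  unfolding is_bifib_morphism_def
proof (intro conjI ballI impI)
  fix f S assume "f \<in> Arr C" and S: "S \<in> Obj (Tot Infl)" "omap (prj Infl) S = Dom C f"
  then have f: "f \<in> Hom C (Dom C f) (Cod C f)" and S': "S \<in> Ob" "omap (prj Q) (\<pi> S) = Dom C f"
    by (simp_all add: Hom_Dom_Cod prj_Infl)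
  have "push Q f (\<pi> S) \<in> Hom (Tot Q) (\<pi> S) (\<pi> (pu f S))"
    using hom_overD(1)[OF push_over(1)[OF Q f \<pi>[OF S'(1)] S'(2)]] pu[OF f S'] by simp
  then show "amap proj (push Infl f S) = push Q f (omap proj S)"
    using S' pu[OF f S'] by (simp add: push_Infl proj_apply ArI)
next
  fix g T assume "g \<in> Arr C" and T: "T \<in> Obj (Tot Infl)" "omap (prj Infl) T = Cod C g"
  then have g: "g \<in> Hom C (Dom C g) (Cod C g)" and T': "T \<in> Ob" "omap (prj Q) (\<pi> T) = Cod C g"
    by (simp_all add: Hom_Dom_Cod prj_Infl)
  have "pull Q g (\<pi> T) \<in> Hom (Tot Q) (\<pi> (pl g T)) (\<pi> T)"
    using hom_overD(1)[OF pull_over(1)[OF Q g \<pi>[OF T'(1)] T'(2)]] pl[OF g T'] by simp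
  then show "amap proj (pull Infl g T) = pull Q g (omap proj T)"
    using T' pl[OF g T'] by (simp add: pull_Infl proj_apply ArI)
qed (use Q bifibration_Infl functor_proj comp_proj_prj in auto)

text \<open>A functor into \<open>Q\<close> lifts once its objects are lifted to \<open>Ob\<close>.\<close>

definition lift :: "('x, 'y) cat \<Rightarrow> ('x, 'y, 'o, 'a) fctr \<Rightarrow> ('x \<Rightarrow> 'p) \<Rightarrow> ('x, 'y, 'p, 'd) fctr" where
  "lift B G h = \<lparr>omap = (\<lambda>X \<in> Obj B. h X),
     amap = (\<lambda>\<alpha> \<in> Arr B. \<kappa> (h (Dom B \<alpha>), amap G \<alpha>, h (Cod B \<alpha>)))\<rparr>"

context
  fixes B :: "('x, 'y) cat" and G :: "('x, 'y, 'o, 'a) fctr" and h :: "'x \<Rightarrow> 'p"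
  assumes G: "is_functor B (Tot Q) G"
    and h: "\<And>X. X \<in> Obj B \<Longrightarrow> h X \<in> Ob \<and> \<pi> (h X) = omap G X"
begin

lemma lift_Ar:
  assumes "\<alpha> \<in> Hom B X Y"
  shows "(h X, amap G \<alpha>, h Y) \<in> Ar" "h X \<in> Ob" "h Y \<in> Ob" "amap G \<alpha> \<in> Hom (Tot Q) (\<pi> (h X)) (\<pi> (h Y))"
  using Hom_obj[OF functor_cat(1)[OF G] assms] functor_Hom[OF G assms] h by (auto intro: ArI)

lemma lift_apply:
  "X \<in> Obj B \<Longrightarrow> omap (lift B G h) X = h X"
  "\<alpha> \<in> Hom B X Y \<Longrightarrow> amap (lift B G h) \<alpha> = \<kappa> (h X, amap G \<alpha>, h Y)"
  by (auto simp: lift_def Hom_def)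

lemma functor_lift: "is_functor B (Tot Infl) (lift B G h)"
proof (rule is_functorI)
  note B = functor_cat(1)[OF G]
  show "amap (lift B G h) f \<in> Hom (Tot Infl) (omap (lift B G h) X) (omap (lift B G h) Y)"
    if f: "f \<in> Hom B X Y" for f X Y
    using lift_Ar[OF f] lift_apply(2)[OF f] Hom_obj[OF B f] by (auto simp: lift_apply(1) Hom_Infl)
  show "amap (lift B G h) (Ide B X) = Ide (Tot Infl) (omap (lift B G h) X)" if X: "X \<in> Obj B" for X
    using lift_apply(2)[OF ide_Hom[OF B X]] lift_apply(1)[OF X] h[OF X] functor_ide[OF G X]
    by (simp add: ide_Infl)
  show "amap (lift B G h) (Cmp B f g) = Cmp (Tot Infl) (amap (lift B G h) f) (amap (lift B G h) g)"
    if f: "f \<in> Hom B X Y" and g: "g \<in> Hom B Y Z" for f g X Y Z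
    using lift_Ar[OF f] lift_Ar[OF g] functor_cmp[OF G f g]
    by (simp add: lift_apply(2)[OF f] lift_apply(2)[OF g] lift_apply(2)[OF cmp_Hom[OF B f g]] cmp_Infl)
qed (use functor_cat[OF G] category_Infl h in \<open>auto simp: lift_def\<close>)

lemma comp_lift_proj: "comp_functor B (lift B G h) proj = G"
proof (rule functor_eqI[OF comp_functor[OF functor_lift functor_proj] G])
  fix f assume f: "f \<in> Arr B"
  show "amap (comp_functor B (lift B G h) proj) f = amap G f"
    using lift_Ar(1)[OF Hom_Dom_Cod[OF f]] f
    by (simp add: lift_apply(2)[OF Hom_Dom_Cod[OF f]] proj_apply)
qed (use h in \<open>simp add: lift_apply proj_apply\<close>)

end

lemma morphism_lift:
  assumes G: "is_bifib_morphism C R Q G"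
    and h: "\<And>X. X \<in> Obj (Tot R) \<Longrightarrow> h X \<in> Ob \<and> \<pi> (h X) = omap G X"
    and h_pu: "\<And>f A B S. f \<in> Hom C A B \<Longrightarrow> S \<in> Obj (Tot R) \<Longrightarrow> omap (prj R) S = A \<Longrightarrow>
      h (pushed R f S) = pu f (h S)"
    and h_pl: "\<And>g A B T. g \<in> Hom C A B \<Longrightarrow> T \<in> Obj (Tot R) \<Longrightarrow> omap (prj R) T = B \<Longrightarrow>
      h (pulled R g T) = pl g (h T)"
  shows "is_bifib_morphism C R Infl (lift (Tot R) G h)"
proof (rule is_bifib_morphismI)
  note GF = bifib_morphismD(3)[OF G] and R = bifib_morphismD(1)[OF G]
  show "is_functor (Tot R) (Tot Infl) (lift (Tot R) G h)"
    by (rule functor_lift[OF GF h])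
  show "omap (prj Infl) (omap (lift (Tot R) G h) X) = omap (prj R) X" if X: "X \<in> Obj (Tot R)" for X
    using h[OF X] bifib_morphism_prj(1)[OF G X] by (simp add: lift_apply(1)[OF GF h X] prj_Infl)
  show "amap (prj Infl) (amap (lift (Tot R) G h) \<alpha>) = amap (prj R) \<alpha>" if a: "\<alpha> \<in> Arr (Tot R)" for \<alpha>
    using prj_Infl(2)[OF lift_Ar(1)[OF GF h Hom_Dom_Cod[OF a]]] bifib_morphism_prj(2)[OF G a]
    by (simp add: lift_apply(2)[OF GF h Hom_Dom_Cod[OF a]])
  show "amap (lift (Tot R) G h) (push R f S) = push Infl f (omap (lift (Tot R) G h) S)"
    if f: "f \<in> Hom C A B" and S: "S \<in> Obj (Tot R)" "omap (prj R) S = A" for f A B S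
    using lift_apply(2)[OF GF h hom_overD(1)[OF push_over(1)[OF R f S]]] h_pu[OF f S] h[OF S(1)]
      bifib_morphism_push(1)[OF G f S]
    by (simp add: lift_apply(1)[OF GF h S(1)] push_Infl)
  show "amap (lift (Tot R) G h) (pull R g T) = pull Infl g (omap (lift (Tot R) G h) T)"
    if g: "g \<in> Hom C A B" and T: "T \<in> Obj (Tot R)" "omap (prj R) T = B" for g A B T
    using lift_apply(2)[OF GF h hom_overD(1)[OF pull_over(1)[OF R g T]]] h_pl[OF g T] h[OF T(1)]
      bifib_morphism_pull(1)[OF G g T]
    by (simp add: lift_apply(1)[OF GF h T(1)] pull_Infl)
qed (use G bifibration_Infl bifib_morphismD in auto)

end


section \<open>Free bifibrations and countability\<close>

lemma countable_inj_into_infinite: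
  assumes "countable A"
  shows "\<exists>f :: 'x \<Rightarrow> 'y::infinite. inj_on f A"
proof -
  obtain g :: "'x \<Rightarrow> nat" where g: "inj_on g A" using assms by (auto simp: countable_def)
  obtain h :: "nat \<Rightarrow> 'y" where "inj h"
    using infinite_countable_subset[OF infinite_UNIV] by blast
  then have "inj_on (h \<circ> g) A" using g by (meson comp_inj_on inj_on_subset subset_UNIV)
  then show ?thesis by blast
qed

lemma free_bifibrationD:
  assumes "is_free_bifibration C D p Q \<eta>"
  shows "is_functor D C p" "is_bifibration C Q" "is_functor D (Tot Q) \<eta>" "comp_functor D \<eta> (prj Q) = p"
  using assms by (auto simp: is_free_bifibration_def)

lemma free_bifibration_ex1:
  fixes Q :: "('o::infinite, 'a::infinite, 'c, 'b) bifib" and Q' :: "('o, 'a, 'c, 'b) bifib"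
  assumes "is_free_bifibration C D p Q \<eta>" "is_bifibration C Q'" "is_functor D (Tot Q') \<theta>"
    "comp_functor D \<theta> (prj Q') = p"
  shows "\<exists>!G. is_bifib_morphism C Q Q' G \<and> comp_functor D \<eta> G = \<theta>"
  using assms unfolding is_free_bifibration_def by blast

text \<open>The universal property of a free bifibration extends from test bifibrations in its own types to
  countable ones in arbitrary types: transport the test bifibration along injections into these
  types, as an inflation.\<close>

theorem free_bifibration_countable_ex1:
  fixes Q :: "('o::infinite, 'a::infinite, 'c, 'b) bifib" and Q' :: "('p, 'q, 'c, 'b) bifib"
  assumes free: "is_free_bifibration C D p Q \<eta>" and Q': "is_bifibration C Q'"
    and co: "countable (Obj (Tot Q'))" and ca: "countable (Arr (Tot Q'))"
    and \<theta>: "is_functor D (Tot Q') \<theta>" "comp_functor D \<theta> (prj Q') = p"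
  shows "\<exists>!G. is_bifib_morphism C Q Q' G \<and> comp_functor D \<eta> G = \<theta>"
proof -
  note \<eta> = free_bifibrationD(3)[OF free]
  obtain io :: "'p \<Rightarrow> 'o" where io: "inj_on io (Obj (Tot Q'))"
    using countable_inj_into_infinite[OF co] by blast
  obtain ia :: "'q \<Rightarrow> 'a" where ia: "inj_on ia (Arr (Tot Q'))"
    using countable_inj_into_infinite[OF ca] by blast
  define \<pi> where "\<pi> = inv_into (Obj (Tot Q')) io"
  have \<pi>: "\<pi> (io X) = X" if "X \<in> Obj (Tot Q')" for X
    using that io by (simp add: \<pi>_def)
  interpret I: inflation C Q' "io ` Obj (Tot Q')" \<pi> "\<lambda>(x, \<phi>, y). ia \<phi>"
    "\<lambda>f x. io (pushed Q' f (\<pi> x))" "\<lambda>g y. io (pulled Q' g (\<pi> y))"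
  proof (unfold_locales, goal_cases)
    case 3
    show ?case
    proof (rule inj_onI)
      fix t u
      assume "t \<in> {(x, \<phi>, y). x \<in> io ` Obj (Tot Q') \<and> y \<in> io ` Obj (Tot Q') \<and> \<phi> \<in> Hom (Tot Q') (\<pi> x) (\<pi> y)}"
        "u \<in> {(x, \<phi>, y). x \<in> io ` Obj (Tot Q') \<and> y \<in> io ` Obj (Tot Q') \<and> \<phi> \<in> Hom (Tot Q') (\<pi> x) (\<pi> y)}"
      then obtain X \<phi> Y X' \<psi> Y' where *: "t = (io X, \<phi>, io Y)" "u = (io X', \<psi>, io Y')"
        "X \<in> Obj (Tot Q')" "Y \<in> Obj (Tot Q')" "X' \<in> Obj (Tot Q')" "Y' \<in> Obj (Tot Q')"
        "\<phi> \<in> Hom (Tot Q') X Y" "\<psi> \<in> Hom (Tot Q') X' Y'"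
        by (auto simp: \<pi>)
      assume "(case t of (x, \<phi>, y) \<Rightarrow> ia \<phi>) = (case u of (x, \<phi>, y) \<Rightarrow> ia \<phi>)"
      then have "\<phi> = \<psi>" using * inj_onD[OF ia _ HomD(1)[OF *(7)] HomD(1)[OF *(8)]] by simp
      then show "t = u" using * by (simp add: Hom_def)
    qed
  next
    case (4 f A B x)
    then show ?case using push_over(2)[OF Q' 4(1)] \<pi> by auto
  next
    case (5 f A B x)
    then show ?case using pull_over(2)[OF Q' 5(1)] \<pi> by auto
  qed (use Q' \<pi> in auto)
  have lift_\<theta>: "io (omap \<theta> X) \<in> io ` Obj (Tot Q') \<and> \<pi> (io (omap \<theta> X)) = omap \<theta> X" if "X \<in> Obj D" for X
    using functor_obj[OF \<theta>(1) that] \<pi> by simp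
  define \<theta>' where "\<theta>' = I.lift D \<theta> (\<lambda>X. io (omap \<theta> X))"
  have \<theta>': "is_functor D (Tot I.Infl) \<theta>'" "comp_functor D \<theta>' I.proj = \<theta>"
    unfolding \<theta>'_def
    using I.functor_lift[OF \<theta>(1) lift_\<theta>] I.comp_lift_proj[OF \<theta>(1) lift_\<theta>] by simp_all
  have "comp_functor D \<theta>' (prj I.Infl) = p"
    using comp_functor_assoc[OF \<theta>'(1), of I.proj "prj Q'"] \<theta>'(2) \<theta>(2) by (simp add: I.comp_proj_prj)
  note ex1 = free_bifibration_ex1[OF free I.bifibration_Infl \<theta>'(1) this]
  then obtain G' where G': "is_bifib_morphism C Q I.Infl G'" "comp_functor D \<eta> G' = \<theta>'" by blast
  let ?G = "comp_functor (Tot Q) G' I.proj"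
  show ?thesis
  proof (rule ex1I[of _ ?G])
    show "is_bifib_morphism C Q Q' ?G \<and> comp_functor D \<eta> ?G = \<theta>"
      using comp_bifib_morphism[OF G'(1) I.morphism_proj] G'(2) \<theta>'(2)
        comp_functor_assoc[OF \<eta>, of G' I.proj] by simp
    fix G assume "is_bifib_morphism C Q Q' G \<and> comp_functor D \<eta> G = \<theta>"
    then have G: "is_bifib_morphism C Q Q' G" and G\<theta>: "comp_functor D \<eta> G = \<theta>" by auto
    note GF = bifib_morphismD(3)[OF G] and Qb = free_bifibrationD(2)[OF free]
    have lift_G: "io (omap G X) \<in> io ` Obj (Tot Q') \<and> \<pi> (io (omap G X)) = omap G X" if "X \<in> Obj (Tot Q)" for X
      using functor_obj[OF GF that] \<pi> by simp
    \<comment> \<open>A morphism is determined by its lift to the copy, where uniqueness is known.\<close>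
    let ?h = "\<lambda>X. io (omap G X)"
    let ?L = "I.lift (Tot Q) G ?h"
    have L: "is_bifib_morphism C Q I.Infl ?L"
    proof (rule I.morphism_lift[OF G lift_G])
      show "io (omap G (pushed Q f S)) = io (pushed Q' f (\<pi> (io (omap G S))))"
        if "f \<in> Hom C A B" "S \<in> Obj (Tot Q)" "omap (prj Q) S = A" for f A B S
        using bifib_morphism_push(2)[OF G that] functor_obj[OF GF that(2)] by (simp add: \<pi>)
      show "io (omap G (pulled Q f S)) = io (pulled Q' f (\<pi> (io (omap G S))))"
        if "f \<in> Hom C A B" "S \<in> Obj (Tot Q)" "omap (prj Q) S = B" for f A B S
        using bifib_morphism_pull(2)[OF G that] functor_obj[OF GF that(2)] by (simp add: \<pi>)
    qed
    have "comp_functor D \<eta> ?L = \<theta>'"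
    proof (rule functor_eqI[OF comp_functor[OF \<eta> bifib_morphismD(3)[OF L]] \<theta>'(1)])
      fix X assume X: "X \<in> Obj D"
      show "omap (comp_functor D \<eta> ?L) X = omap \<theta>' X"
        using X functor_obj[OF \<eta> X] by (simp add: \<theta>'_def I.lift_def flip: G\<theta>)
    next
      fix \<alpha> assume "\<alpha> \<in> Arr D"
      then have \<alpha>: "\<alpha> \<in> Hom D (Dom D \<alpha>) (Cod D \<alpha>)" by (rule Hom_Dom_Cod)
      show "amap (comp_functor D \<eta> ?L) \<alpha> = amap \<theta>' \<alpha>"
        using \<alpha> HomD[OF functor_Hom[OF \<eta> \<alpha>]]
        by (simp add: \<theta>'_def I.lift_def HomD(1) flip: G\<theta>)
    qed
    with L G' ex1 have "?L = G'" by blast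
    then show "G = ?G" using I.comp_lift_proj[OF GF lift_G] by metis
  qed
qed

text \<open>A set \<open>A\<close> of arrows, closed under the operations of a bifibration, spans a bifibration whose
  objects are those with identity in \<open>A\<close>.\<close>

locale subbifibration =
  fixes C :: "('c, 'b) cat" and Q :: "('o, 'a, 'c, 'b) bifib" and A :: "'a set"
  assumes Q: "is_bifibration C Q" and A: "A \<subseteq> Arr (Tot Q)"
    and ide: "\<And>\<alpha>. \<alpha> \<in> A \<Longrightarrow> Ide (Tot Q) (Dom (Tot Q) \<alpha>) \<in> A"
      "\<And>\<alpha>. \<alpha> \<in> A \<Longrightarrow> Ide (Tot Q) (Cod (Tot Q) \<alpha>) \<in> A"
    and cmp: "\<And>\<alpha> \<beta>. \<alpha> \<in> A \<Longrightarrow> \<beta> \<in> A \<Longrightarrow> Cod (Tot Q) \<alpha> = Dom (Tot Q) \<beta> \<Longrightarrow> Cmp (Tot Q) \<alpha> \<beta> \<in> A"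
    and push: "\<And>f B S. f \<in> Hom C (omap (prj Q) S) B \<Longrightarrow> S \<in> Obj (Tot Q) \<Longrightarrow> Ide (Tot Q) S \<in> A \<Longrightarrow>
      push Q f S \<in> A"
    and pull: "\<And>f B S. f \<in> Hom C B (omap (prj Q) S) \<Longrightarrow> S \<in> Obj (Tot Q) \<Longrightarrow> Ide (Tot Q) S \<in> A \<Longrightarrow>
      pull Q f S \<in> A"
    and push_fac: "\<And>f g B D S T \<alpha> \<beta>. f \<in> Hom C (omap (prj Q) S) B \<Longrightarrow> g \<in> Hom C B D \<Longrightarrow>
      \<alpha> \<in> A \<Longrightarrow> \<alpha> \<in> hom_over Q (Cmp C f g) S T \<Longrightarrow> \<beta> \<in> hom_over Q g (pushed Q f S) T \<Longrightarrow>
      Cmp (Tot Q) (push Q f S) \<beta> = \<alpha> \<Longrightarrow> \<beta> \<in> A"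
    and pull_fac: "\<And>f g B D S T \<alpha> \<beta>. f \<in> Hom C D B \<Longrightarrow> g \<in> Hom C B (omap (prj Q) T) \<Longrightarrow>
      \<alpha> \<in> A \<Longrightarrow> \<alpha> \<in> hom_over Q (Cmp C f g) S T \<Longrightarrow> \<beta> \<in> hom_over Q f S (pulled Q g T) \<Longrightarrow>
      Cmp (Tot Q) \<beta> (pull Q g T) = \<alpha> \<Longrightarrow> \<beta> \<in> A"
begin

text \<open>The objects of the subbifibration, the subbifibration itself, and its inclusion.\<close>

definition SubObj :: "'o set" where
  "SubObj = {X \<in> Obj (Tot Q). Ide (Tot Q) X \<in> A}"

definition Sub :: "('o, 'a, 'c, 'b) bifib" where
  "Sub = Q\<lparr>Tot := (Tot Q)\<lparr>Obj := SubObj, Arr := A\<rparr>,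
     prj := \<lparr>omap = restrict (omap (prj Q)) SubObj, amap = restrict (amap (prj Q)) A\<rparr>\<rparr>"

definition incl :: "('o, 'a, 'o, 'a) fctr" where
  "incl = \<lparr>omap = (\<lambda>X \<in> SubObj. X), amap = (\<lambda>\<alpha> \<in> A. \<alpha>)\<rparr>"

lemma Sub_simps [simp]:
  "Obj (Tot Sub) = SubObj" "Arr (Tot Sub) = A" "Dom (Tot Sub) = Dom (Tot Q)" "Cod (Tot Sub) = Cod (Tot Q)"
  "Ide (Tot Sub) = Ide (Tot Q)" "Cmp (Tot Sub) = Cmp (Tot Q)" "push Sub = push Q" "pull Sub = pull Q"
  "X \<in> SubObj \<Longrightarrow> omap (prj Sub) X = omap (prj Q) X" "\<alpha> \<in> A \<Longrightarrow> amap (prj Sub) \<alpha> = amap (prj Q) \<alpha>"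
  by (simp_all add: Sub_def)

lemma SubObjD:
  assumes "X \<in> SubObj" shows "X \<in> Obj (Tot Q)" "Ide (Tot Q) X \<in> A"
  using assms by (auto simp: SubObj_def)

lemma Hom_Sub: "\<alpha> \<in> Hom (Tot Sub) X Y \<longleftrightarrow> \<alpha> \<in> A \<and> \<alpha> \<in> Hom (Tot Q) X Y"
  using A by (auto simp: Hom_def)

lemma over_Sub: "\<alpha> \<in> hom_over Sub g X Y \<longleftrightarrow> \<alpha> \<in> A \<and> \<alpha> \<in> hom_over Q g X Y"
  by (auto simp: hom_over_def Hom_Sub)

lemma Sub_dom_cod:
  assumes "\<alpha> \<in> A" shows "Dom (Tot Q) \<alpha> \<in> SubObj" "Cod (Tot Q) \<alpha> \<in> SubObj"
  using assms ide[OF assms] A Hom_obj[OF bif_cat(1)[OF Q] Hom_Dom_Cod[of \<alpha>]]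
  by (auto simp: SubObj_def)

lemma category_Sub: "is_category (Tot Sub)"
proof (rule is_categoryI)
  note C = bif_cat(1)[OF Q]
  show "Cmp (Tot Sub) f g \<in> Hom (Tot Sub) X Z"
    if "f \<in> Hom (Tot Sub) X Y" "g \<in> Hom (Tot Sub) Y Z" for f g X Y Z
    using that cmp[of f g] cmp_Hom[OF C, of f X Y g Z] HomD[of f "Tot Q" X Y] HomD[of g "Tot Q" Y Z]
    by (simp add: Hom_Sub)
  show "Cmp (Tot Sub) (Cmp (Tot Sub) f g) h = Cmp (Tot Sub) f (Cmp (Tot Sub) g h)"
    if "f \<in> Hom (Tot Sub) X Y" "g \<in> Hom (Tot Sub) Y Z" "h \<in> Hom (Tot Sub) Z W" for f g h X Y Z W
    using that cmp_assoc[OF C, of f X Y g Z h W] by (simp add: Hom_Sub)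
qed (use Sub_dom_cod SubObjD ide_Hom[OF bif_cat(1)[OF Q]] ide_cmp[OF bif_cat(1)[OF Q]]
    cmp_ide[OF bif_cat(1)[OF Q]] in \<open>auto simp: Hom_Sub\<close>)

lemma functor_incl: "is_functor (Tot Sub) (Tot Q) incl"
proof (rule is_functorI)
  show "amap incl f \<in> Hom (Tot Q) (omap incl X) (omap incl Y)" if "f \<in> Hom (Tot Sub) X Y" for f X Y
    using that Hom_obj[OF category_Sub that] by (simp add: Hom_Sub incl_def)
  show "amap incl (Cmp (Tot Sub) f g) = Cmp (Tot Q) (amap incl f) (amap incl g)"
    if "f \<in> Hom (Tot Sub) X Y" "g \<in> Hom (Tot Sub) Y Z" for f g X Y Z
    using that cmp[of f g] by (auto simp: Hom_Sub Hom_def incl_def)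
qed (use category_Sub bif_cat[OF Q] SubObjD in \<open>auto simp: incl_def\<close>)

lemma comp_incl_prj: "comp_functor (Tot Sub) incl (prj Q) = prj Sub"
  by (auto simp: comp_functor_def incl_def Sub_def intro!: restrict_ext)

lemma bifibration_Sub: "is_bifibration C Sub"
proof (rule is_bifibrationI)
  show "is_functor (Tot Sub) C (prj Sub)"
    using comp_functor[OF functor_incl bif_functor[OF Q]] by (simp add: comp_incl_prj)
  show "push Sub f S \<in> hom_over Sub f S (pushed Sub f S)"
    if f: "f \<in> Hom C X Y" and S: "S \<in> Obj (Tot Sub)" "omap (prj Sub) S = X" for f X Y S
    using push_over(1)[OF Q f, of S] push[of f S Y] f S SubObjD by (simp add: over_Sub)
  show "pull Sub f S \<in> hom_over Sub f (pulled Sub f S) S"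
    if f: "f \<in> Hom C X Y" and S: "S \<in> Obj (Tot Sub)" "omap (prj Sub) S = Y" for f X Y S
    using pull_over(1)[OF Q f, of S] pull[of f X S] f S SubObjD by (simp add: over_Sub)
next
  fix f g X Y Z S T \<alpha>
  assume f: "f \<in> Hom C X Y" and g: "g \<in> Hom C Y Z" and \<alpha>: "\<alpha> \<in> hom_over Sub (Cmp C f g) S T"
  {
    assume S: "S \<in> Obj (Tot Sub)" "omap (prj Sub) S = X"
    then have S': "omap (prj Q) S = X" by simp
    have "\<exists>!\<beta>. \<beta> \<in> hom_over Q g (pushed Q f S) T \<and> Cmp (Tot Q) (push Q f S) \<beta> = \<alpha>"
      using push_factor[OF Q f g S'] \<alpha> by (simp add: over_Sub)
    moreover have "\<beta> \<in> A" if "\<beta> \<in> hom_over Q g (pushed Q f S) T" "Cmp (Tot Q) (push Q f S) \<beta> = \<alpha>" for \<beta>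
      using push_fac[OF _ g _ _ that] f S' \<alpha> by (simp add: over_Sub)
    ultimately show "\<exists>!\<beta>. \<beta> \<in> hom_over Sub g (pushed Sub f S) T \<and> Cmp (Tot Sub) (push Sub f S) \<beta> = \<alpha>"
      unfolding over_Sub Sub_simps by blast
  next
    assume T: "T \<in> Obj (Tot Sub)" "omap (prj Sub) T = Z"
    then have T': "omap (prj Q) T = Z" by simp
    have "\<exists>!\<beta>. \<beta> \<in> hom_over Q f S (pulled Q g T) \<and> Cmp (Tot Q) \<beta> (pull Q g T) = \<alpha>"
      using pull_factor[OF Q f g T'] \<alpha> by (simp add: over_Sub)
    moreover have "\<beta> \<in> A" if "\<beta> \<in> hom_over Q f S (pulled Q g T)" "Cmp (Tot Q) \<beta> (pull Q g T) = \<alpha>" for \<beta>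
      using pull_fac[OF f _ _ _ that] g T' \<alpha> by (simp add: over_Sub)
    ultimately show "\<exists>!\<beta>. \<beta> \<in> hom_over Sub f S (pulled Sub g T) \<and> Cmp (Tot Sub) \<beta> (pull Sub g T) = \<alpha>"
      unfolding over_Sub Sub_simps by blast
  }
qed

lemma morphism_incl: "is_bifib_morphism C Sub Q incl"
proof (rule is_bifib_morphismI[OF bifibration_Sub Q functor_incl])
  show "amap incl (push Sub f S) = push Q f (omap incl S)"
    if "f \<in> Hom C X Y" "S \<in> Obj (Tot Sub)" "omap (prj Sub) S = X" for f X Y S
    using that push[of f S Y] SubObjD by (simp add: incl_def)
  show "amap incl (pull Sub f S) = pull Q f (omap incl S)"
    if "f \<in> Hom C X Y" "S \<in> Obj (Tot Sub)" "omap (prj Sub) S = Y" for f X Y S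
    using that pull[of f X S] SubObjD by (simp add: incl_def)
qed (auto simp: incl_def)

end

text \<open>Terms for the arrows that can be built from the arrows in the image of \<open>\<eta>\<close>. Not every term is
  meaningful, and a meaningless one may denote anything; hence only those denotations are used that
  are arrows. An object to be pushed or pulled is represented by any arrow of which it is
  the domain.\<close>

datatype ('e, 'b) arrow_term =
    Gen 'e
  | IdeDom "('e, 'b) arrow_term"
  | IdeCod "('e, 'b) arrow_term"
  | Comp "('e, 'b) arrow_term" "('e, 'b) arrow_term"
  | Push 'b "('e, 'b) arrow_term"
  | Pull 'b "('e, 'b) arrow_term"
  | PushFac 'b 'b "('e, 'b) arrow_term"
  | PullFac 'b 'b "('e, 'b) arrow_term"

instance arrow_term :: (countable, countable) countable
  by countable_datatype

primrec denote :: "('o, 'a, 'c, 'b) bifib \<Rightarrow> ('d, 'e, 'o, 'a) fctr \<Rightarrow> ('e, 'b) arrow_term \<Rightarrow> 'a" where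
  "denote Q \<eta> (Gen e) = amap \<eta> e"
| "denote Q \<eta> (IdeDom t) = Ide (Tot Q) (Dom (Tot Q) (denote Q \<eta> t))"
| "denote Q \<eta> (IdeCod t) = Ide (Tot Q) (Cod (Tot Q) (denote Q \<eta> t))"
| "denote Q \<eta> (Comp t u) = Cmp (Tot Q) (denote Q \<eta> t) (denote Q \<eta> u)"
| "denote Q \<eta> (Push f t) = push Q f (Dom (Tot Q) (denote Q \<eta> t))"
| "denote Q \<eta> (Pull f t) = pull Q f (Dom (Tot Q) (denote Q \<eta> t))"
| "denote Q \<eta> (PushFac f g t) = (let \<alpha> = denote Q \<eta> t; S = Dom (Tot Q) \<alpha> in
     THE \<beta>. \<beta> \<in> hom_over Q g (pushed Q f S) (Cod (Tot Q) \<alpha>) \<and> Cmp (Tot Q) (push Q f S) \<beta> = \<alpha>)"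
| "denote Q \<eta> (PullFac f g t) = (let \<alpha> = denote Q \<eta> t; T = Cod (Tot Q) \<alpha> in
     THE \<beta>. \<beta> \<in> hom_over Q f (Dom (Tot Q) \<alpha>) (pulled Q g T) \<and> Cmp (Tot Q) \<beta> (pull Q g T) = \<alpha>)"

lemma subbifibration_denote:
  assumes Q: "is_bifibration C Q"
  shows "subbifibration C Q (range (denote Q \<eta>) \<inter> Arr (Tot Q))"
proof (unfold_locales, goal_cases)
  note C = bif_cat(1)[OF Q]
  {
    case (3 \<alpha>)
    then show ?case
      using Hom_obj(1)[OF C Hom_Dom_Cod[of \<alpha>]] HomD(1)[OF ide_Hom[OF C]]
      by (auto intro: range_eqI[of _ _ "IdeDom _"])
  next
    case (4 \<alpha>)
    then show ?case
      using Hom_obj(2)[OF C Hom_Dom_Cod[of \<alpha>]] HomD(1)[OF ide_Hom[OF C]]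
      by (auto intro: range_eqI[of _ _ "IdeCod _"])
  next
    case (5 \<alpha> \<beta>)
    then have "Cmp (Tot Q) \<alpha> \<beta> \<in> Arr (Tot Q)"
      by (intro HomD(1)[OF cmp_Hom[OF C Hom_Dom_Cod[of \<alpha>], of \<beta> "Cod (Tot Q) \<beta>"]] HomI) simp_all
    with 5 show ?case by (auto intro: range_eqI[of _ _ "Comp _ _"])
  next
    case (6 f B S)
    then obtain t where "Ide (Tot Q) S = denote Q \<eta> t" by auto
    then have "push Q f S = denote Q \<eta> (Push f t)"
      using HomD(2)[OF ide_Hom[OF C 6(2)]] by simp
    then show ?case
      using HomD(1)[OF hom_overD(1)[OF push_over(1)[OF Q 6(1,2) refl]]] by blast
  next
    case (7 f B S)
    then obtain t where "Ide (Tot Q) S = denote Q \<eta> t" by auto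
    then have "pull Q f S = denote Q \<eta> (Pull f t)"
      using HomD(2)[OF ide_Hom[OF C 7(2)]] by simp
    then show ?case
      using HomD(1)[OF hom_overD(1)[OF pull_over(1)[OF Q 7(1,2) refl]]] by blast
  next
    case (8 f g B D S T \<alpha> \<beta>)
    then obtain t where t: "\<alpha> = denote Q \<eta> t" by auto
    have "denote Q \<eta> (PushFac f g t) =
        (THE \<beta>. \<beta> \<in> hom_over Q g (pushed Q f S) T \<and> Cmp (Tot Q) (push Q f S) \<beta> = \<alpha>)"
      using HomD[OF hom_overD(1)[OF 8(4)]] by (simp flip: t)
    also have "\<dots> = \<beta>"
      using push_factor[OF Q 8(1,2) refl 8(4)] 8(5,6) by (intro the1_equality conjI)
    finally show ?case using HomD(1)[OF hom_overD(1)[OF 8(5)]] by blast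
  next
    case (9 f g B D S T \<alpha> \<beta>)
    then obtain t where t: "\<alpha> = denote Q \<eta> t" by auto
    have "denote Q \<eta> (PullFac f g t) =
        (THE \<beta>. \<beta> \<in> hom_over Q f S (pulled Q g T) \<and> Cmp (Tot Q) \<beta> (pull Q g T) = \<alpha>)"
      using HomD[OF hom_overD(1)[OF 9(4)]] by (simp flip: t)
    also have "\<dots> = \<beta>"
      using pull_factor[OF Q 9(1,2) refl 9(4)] 9(5,6) by (intro the1_equality conjI)
    finally show ?case using HomD(1)[OF hom_overD(1)[OF 9(5)]] by blast
  }
qed (use Q in auto)

text \<open>A free bifibration is generated by the image of \<open>\<eta>\<close>: by freeness it retracts onto the
  subbifibration of the arrows denoted by terms.\<close>

theorem countable_free_bifibration:
  fixes Q :: "('o::infinite, 'a::infinite, 'c, 'b::countable) bifib"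
    and D :: "('d, 'e::countable) cat"
  assumes free: "is_free_bifibration C D p Q \<eta>"
  shows "countable (Arr (Tot Q))" "countable (Obj (Tot Q))"
proof -
  note Q = free_bifibrationD(2)[OF free] and \<eta> = free_bifibrationD(3)[OF free]
  note D = functor_cat(1)[OF \<eta>]
  define A where "A = range (denote Q \<eta>) \<inter> Arr (Tot Q)"
  interpret S: subbifibration C Q A
    unfolding A_def by (rule subbifibration_denote[OF Q])
  have A: "amap \<eta> e \<in> A" if "e \<in> Hom D X Y" for e X Y
    using HomD(1)[OF functor_Hom[OF \<eta> that]] unfolding A_def
    by (auto intro: range_eqI[of _ _ "Gen e"])
  have \<eta>': "is_functor D (Tot S.Sub) \<eta>"
  proof (rule is_functorI)
    show "omap \<eta> X \<in> Obj (Tot S.Sub)" if X: "X \<in> Obj D" for X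
      using A[OF ide_Hom[OF D X]] functor_ide[OF \<eta> X] functor_obj[OF \<eta> X]
      by (simp add: S.SubObj_def)
    show "amap \<eta> f \<in> Hom (Tot S.Sub) (omap \<eta> X) (omap \<eta> Y)" if "f \<in> Hom D X Y" for f X Y
      using A[OF that] functor_Hom[OF \<eta> that] by (simp add: S.Hom_Sub)
  qed (use D S.category_Sub functor_extensional[OF \<eta>] functor_ide[OF \<eta>] functor_cmp[OF \<eta>] in auto)
  have \<eta>_incl: "comp_functor D \<eta> S.incl = \<eta>"
    using functor_obj[OF \<eta>'] A[OF Hom_Dom_Cod]
    by (intro functor_eqI[OF comp_functor[OF \<eta>' S.functor_incl] \<eta>]) (simp_all add: S.incl_def)
  have "comp_functor D \<eta> (prj S.Sub) = p"
    using comp_functor_assoc[OF \<eta>', of S.incl "prj Q"] free_bifibrationD(4)[OF free]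
    by (simp add: \<eta>_incl S.comp_incl_prj)
  then obtain G where G: "is_bifib_morphism C Q S.Sub G" "comp_functor D \<eta> G = \<eta>"
    using free_bifibration_ex1[OF free S.bifibration_Sub \<eta>'] by blast
  \<comment> \<open>The retraction followed by the inclusion and the identity both extend \<open>\<eta>\<close>.\<close>
  have "is_bifib_morphism C Q Q (comp_functor (Tot Q) G S.incl)"
    "comp_functor D \<eta> (comp_functor (Tot Q) G S.incl) = \<eta>"
    using comp_bifib_morphism[OF G(1) S.morphism_incl] comp_functor_assoc[OF \<eta>, of G S.incl] G(2) \<eta>_incl
    by simp_all
  moreover have "is_bifib_morphism C Q Q (id_functor (Tot Q))" "comp_functor D \<eta> (id_functor (Tot Q)) = \<eta>"
    using id_bifib_morphism[OF Q] comp_id_functor[OF \<eta>] by auto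
  ultimately have eq: "comp_functor (Tot Q) G S.incl = id_functor (Tot Q)"
    using free_bifibration_ex1[OF free Q \<eta> free_bifibrationD(4)[OF free]] by blast
  have "Arr (Tot Q) \<subseteq> A"
  proof
    fix \<alpha> assume \<alpha>: "\<alpha> \<in> Arr (Tot Q)"
    have "amap G \<alpha> \<in> A"
      using HomD(1)[OF functor_Hom[OF bifib_morphismD(3)[OF G(1)] Hom_Dom_Cod[OF \<alpha>]]] by simp
    moreover have "amap S.incl (amap G \<alpha>) = \<alpha>"
      using comp_functor_apply(2)[OF \<alpha>, of G S.incl] \<alpha> by (simp add: eq)
    ultimately show "\<alpha> \<in> A" by (simp add: S.incl_def)
  qed
  then show *: "countable (Arr (Tot Q))"
    unfolding A_def by (meson countable_Int1 countableI_type countable_image countable_subset)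
  have "Obj (Tot Q) \<subseteq> Dom (Tot Q) ` Arr (Tot Q)"
    using HomD(1,2)[OF ide_Hom[OF bif_cat(1)[OF Q]]] by (metis image_eqI subsetI)
  then show "countable (Obj (Tot Q))"
    using * countable_image countable_subset by blast
qed


section \<open>Pseudo-inverses of comparison morphisms\<close>

text \<open>An isomorphism and its inverse, both in a fiber.\<close>

definition vert_iso :: "('c, 'b) cat \<Rightarrow> ('o, 'a, 'c, 'b) bifib \<Rightarrow> 'o \<Rightarrow> 'o \<Rightarrow> 'a \<Rightarrow> 'a \<Rightarrow> bool" where
  "vert_iso C Q X Y i i' \<longleftrightarrow> iso_pair (Tot Q) X Y i i' \<and>
     amap (prj Q) i = Ide C (omap (prj Q) X) \<and> amap (prj Q) i' = Ide C (omap (prj Q) X)"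

lemma vert_isoD:
  assumes Q: "is_bifibration C Q" and i: "vert_iso C Q X Y i i'"
  shows "i \<in> hom_over Q (Ide C (omap (prj Q) X)) X Y" "i' \<in> hom_over Q (Ide C (omap (prj Q) X)) Y X"
    "Cmp (Tot Q) i i' = Ide (Tot Q) X" "Cmp (Tot Q) i' i = Ide (Tot Q) Y"
    "X \<in> Obj (Tot Q)" "Y \<in> Obj (Tot Q)" "omap (prj Q) Y = omap (prj Q) X"
proof -
  show 1: "i \<in> hom_over Q (Ide C (omap (prj Q) X)) X Y" "i' \<in> hom_over Q (Ide C (omap (prj Q) X)) Y X"
    "Cmp (Tot Q) i i' = Ide (Tot Q) X" "Cmp (Tot Q) i' i = Ide (Tot Q) Y"
    using i by (auto simp: vert_iso_def iso_pair_def hom_over_def)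
  show "X \<in> Obj (Tot Q)" "Y \<in> Obj (Tot Q)"
    using hom_over_obj[OF Q 1(1)] by auto
  then have "Ide C (omap (prj Q) X) \<in> Hom C (omap (prj Q) X) (omap (prj Q) X)"
    using ide_Hom[OF bif_cat(2)[OF Q] functor_obj[OF bif_functor[OF Q]]] by simp
  then show "omap (prj Q) Y = omap (prj Q) X"
    using hom_over_obj(3)[OF Q 1(1)] by (simp add: Hom_def)
qed

lemma vert_isoI:
  assumes "iso_pair (Tot Q) X Y i i'" "i \<in> hom_over Q (Ide C A) X Y" "i' \<in> hom_over Q (Ide C A) Y X"
    "omap (prj Q) X = A"
  shows "vert_iso C Q X Y i i'"
  using assms by (auto simp: vert_iso_def hom_over_def)

lemma vert_iso_ide:
  assumes Q: "is_bifibration C Q" and X: "X \<in> Obj (Tot Q)"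
  shows "vert_iso C Q X X (Ide (Tot Q) X) (Ide (Tot Q) X)"
  using iso_pair_ide[OF bif_cat(1)[OF Q] X] functor_ide[OF bif_functor[OF Q] X]
  by (simp add: vert_iso_def)

lemma vert_iso_sym:
  assumes Q: "is_bifibration C Q" and i: "vert_iso C Q X Y i i'" shows "vert_iso C Q Y X i' i"
  using i iso_pair_sym[of "Tot Q" X Y i i'] vert_isoD(7)[OF Q i] by (auto simp: vert_iso_def)

lemma vert_iso_cmp:
  assumes Q: "is_bifibration C Q" and i: "vert_iso C Q X Y i i'" and j: "vert_iso C Q Y Z j j'"
  shows "vert_iso C Q X Z (Cmp (Tot Q) i j) (Cmp (Tot Q) j' i')"
proof -
  note I = vert_isoD[OF Q i] and J = vert_isoD[OF Q j]
  have A: "Ide C (omap (prj Q) X) \<in> Hom C (omap (prj Q) X) (omap (prj Q) X)"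
    using ide_Hom[OF bif_cat(2)[OF Q] functor_obj[OF bif_functor[OF Q] I(5)]] .
  note II = ide_cmp[OF bif_cat(2)[OF Q] A]
  show ?thesis
  proof (rule vert_isoI[OF _ _ _ refl])
    show "iso_pair (Tot Q) X Z (Cmp (Tot Q) i j) (Cmp (Tot Q) j' i')"
      using iso_pair_cmp[OF bif_cat(1)[OF Q], of X Y i i' Z j j'] i j by (simp add: vert_iso_def)
    show "Cmp (Tot Q) i j \<in> hom_over Q (Ide C (omap (prj Q) X)) X Z"
      using hom_over_cmp[OF Q I(1), of j "Ide C (omap (prj Q) X)" Z] J(1) I(7) by (simp add: II)
    show "Cmp (Tot Q) j' i' \<in> hom_over Q (Ide C (omap (prj Q) X)) Z X"
      using hom_over_cmp[OF Q J(2), of i' "Ide C (omap (prj Q) X)" X] I(2,7) by (simp add: II)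
  qed
qed

text \<open>Let \<open>G : Q \<rightarrow> E\<close> be a strict morphism out of a free bifibration and \<open>H : E \<rightarrow> Q\<close> a functor over
  the base that preserves chosen liftings up to vertical isomorphism. If \<open>G\<close> followed by \<open>H\<close> fixes
  the generators, it is isomorphic to the identity: vertical isomorphisms \<open>i : He \<rightarrow> T\<close> are the
  objects of a bifibration \<open>P\<close> with strict projections to \<open>E\<close> and \<open>Q\<close>, and freeness yields a section
  \<open>Q \<rightarrow> P\<close>, whose value at \<open>T\<close> is an isomorphism \<open>HGT \<rightarrow> T\<close>.\<close>

theorem free_bifibration_pseudo_retract:
  fixes Q :: "('o::infinite, 'a::infinite, 'c, 'b::countable) bifib"
    and D :: "('d, 'e::countable) cat" and E :: "('p, 'q, 'c, 'b) bifib"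
  assumes free: "is_free_bifibration C D p Q \<eta>"
    and cE: "countable (Obj (Tot E))" "countable (Arr (Tot E))"
    and G: "is_bifib_morphism C Q E G"
    and H: "is_functor (Tot E) (Tot Q) H" and H_prj: "comp_functor (Tot E) H (prj Q) = prj E"
    and HG\<eta>: "comp_functor D \<eta> (comp_functor (Tot Q) G H) = \<eta>"
    and push: "\<And>f A B e T i i'. f \<in> Hom C A B \<Longrightarrow> e \<in> Obj (Tot E) \<Longrightarrow> omap (prj E) e = A \<Longrightarrow>
      vert_iso C Q (omap H e) T i i' \<Longrightarrow>
      \<exists>j j'. vert_iso C Q (omap H (pushed E f e)) (pushed Q f T) j j' \<and>
        Cmp (Tot Q) (amap H (push E f e)) j = Cmp (Tot Q) i (push Q f T)"
    and pull: "\<And>f A B e T i i'. f \<in> Hom C A B \<Longrightarrow> e \<in> Obj (Tot E) \<Longrightarrow> omap (prj E) e = B \<Longrightarrow>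
      vert_iso C Q (omap H e) T i i' \<Longrightarrow>
      \<exists>j j'. vert_iso C Q (omap H (pulled E f e)) (pulled Q f T) j j' \<and>
        Cmp (Tot Q) (amap H (pull E f e)) i = Cmp (Tot Q) j (pull Q f T)"
  shows "\<exists>\<sigma>. is_nat_iso (Tot Q) (Tot Q) (id_functor (Tot Q)) (comp_functor (Tot Q) G H) \<sigma> \<and>
    (\<forall>X \<in> Obj (Tot Q). \<exists>i. vert_iso C Q X (omap H (omap G X)) (\<sigma> X) i)"
proof -
  note Q = free_bifibrationD(2)[OF free] and \<eta> = free_bifibrationD(3)[OF free]
  note D = functor_cat(1)[OF \<eta>] and E = bifib_morphismD(2)[OF G] and GF = bifib_morphismD(3)[OF G]
  note QC = bif_cat(1)[OF Q]
  have prj_H: "omap (prj Q) (omap H e) = omap (prj E) e" if "e \<in> Obj (Tot E)" for e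
    using that by (simp flip: H_prj)
  have prj_H': "amap (prj Q) (amap H \<phi>) = amap (prj E) \<phi>" if "\<phi> \<in> Arr (Tot E)" for \<phi>
    using that by (simp flip: H_prj)
  define Ob where "Ob = {(e, T, i, i'). e \<in> Obj (Tot E) \<and> vert_iso C Q (omap H e) T i i'}"
  define pu_iso :: "'b \<Rightarrow> 'p \<times> 'o \<times> 'a \<times> 'a \<Rightarrow> 'a \<times> 'a" where
    "pu_iso f x = (case x of (e, T, i, i') \<Rightarrow>
      SOME (j, j'). vert_iso C Q (omap H (pushed E f e)) (pushed Q f T) j j' \<and>
        Cmp (Tot Q) (amap H (push E f e)) j = Cmp (Tot Q) i (push Q f T))" for f x
  define pl_iso :: "'b \<Rightarrow> 'p \<times> 'o \<times> 'a \<times> 'a \<Rightarrow> 'a \<times> 'a" where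
    "pl_iso f x = (case x of (e, T, i, i') \<Rightarrow>
      SOME (j, j'). vert_iso C Q (omap H (pulled E f e)) (pulled Q f T) j j' \<and>
        Cmp (Tot Q) (amap H (pull E f e)) i = Cmp (Tot Q) j (pull Q f T))" for f x
  define pu :: "'b \<Rightarrow> 'p \<times> 'o \<times> 'a \<times> 'a \<Rightarrow> 'p \<times> 'o \<times> 'a \<times> 'a" where
    "pu f x = (pushed E f (fst x), pushed Q f (fst (snd x)), pu_iso f x)" for f x
  define pl :: "'b \<Rightarrow> 'p \<times> 'o \<times> 'a \<times> 'a \<Rightarrow> 'p \<times> 'o \<times> 'a \<times> 'a" where
    "pl f x = (pulled E f (fst x), pulled Q f (fst (snd x)), pl_iso f x)" for f x
  \<comment> \<open>The liftings in \<open>P\<close> carry the comparison isomorphisms provided for \<open>H\<close>.\<close>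
  have pu_props: "\<exists>j j'. pu f (e, T, i, i') = (pushed E f e, pushed Q f T, j, j') \<and>
      vert_iso C Q (omap H (pushed E f e)) (pushed Q f T) j j' \<and>
      Cmp (Tot Q) (amap H (push E f e)) j = Cmp (Tot Q) i (push Q f T) \<and> pushed E f e \<in> Obj (Tot E)"
    if f: "f \<in> Hom C A B" and x: "(e, T, i, i') \<in> Ob" "omap (prj E) e = A" for f A B e T i i'
  proof -
    have "(\<lambda>(j, j'). vert_iso C Q (omap H (pushed E f e)) (pushed Q f T) j j' \<and>
        Cmp (Tot Q) (amap H (push E f e)) j = Cmp (Tot Q) i (push Q f T)) (pu_iso f (e, T, i, i'))"
      unfolding pu_iso_def prod.case by (rule someI_ex) (use push[OF f _ x(2)] x(1) in \<open>auto simp: Ob_def\<close>)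
    then show ?thesis
      using push_over(2)[OF E f _ x(2)] x(1) by (auto simp: pu_def Ob_def split: prod.splits)
  qed
  have pl_props: "\<exists>j j'. pl f (e, T, i, i') = (pulled E f e, pulled Q f T, j, j') \<and>
      vert_iso C Q (omap H (pulled E f e)) (pulled Q f T) j j' \<and>
      Cmp (Tot Q) (amap H (pull E f e)) i = Cmp (Tot Q) j (pull Q f T) \<and> pulled E f e \<in> Obj (Tot E)"
    if f: "f \<in> Hom C A B" and x: "(e, T, i, i') \<in> Ob" "omap (prj E) e = B" for f A B e T i i'
  proof -
    have "(\<lambda>(j, j'). vert_iso C Q (omap H (pulled E f e)) (pulled Q f T) j j' \<and>
        Cmp (Tot Q) (amap H (pull E f e)) i = Cmp (Tot Q) j (pull Q f T)) (pl_iso f (e, T, i, i'))"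
      unfolding pl_iso_def prod.case by (rule someI_ex) (use pull[OF f _ x(2)] x(1) in \<open>auto simp: Ob_def\<close>)
    then show ?thesis
      using pull_over(2)[OF E f _ x(2)] x(1) by (auto simp: pl_def Ob_def split: prod.splits)
  qed
  interpret P: inflation C E Ob fst "\<lambda>t. t" pu pl
  proof (unfold_locales, goal_cases)
    case (4 f A B x)
    then show ?case using pu_props[OF 4(1)] by (cases x) (force simp: Ob_def)
  next
    case (5 f A B x)
    then show ?case using pl_props[OF 5(1)] by (cases x) (force simp: Ob_def)
  qed (use E in \<open>auto simp: Ob_def\<close>)
  have "Ob \<subseteq> Obj (Tot E) \<times> Obj (Tot Q) \<times> Arr (Tot Q) \<times> Arr (Tot Q)"
  proof
    fix x assume "x \<in> Ob"
    then obtain e T i i' where x: "x = (e, T, i, i')" "e \<in> Obj (Tot E)" and v: "vert_iso C Q (omap H e) T i i'"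
      by (auto simp: Ob_def)
    then show "x \<in> Obj (Tot E) \<times> Obj (Tot Q) \<times> Arr (Tot Q) \<times> Arr (Tot Q)"
      using vert_isoD(6)[OF Q v] HomD(1)[OF hom_overD(1)[OF vert_isoD(1)[OF Q v]]]
        HomD(1)[OF hom_overD(1)[OF vert_isoD(2)[OF Q v]]] by simp
  qed
  then have cOb: "countable Ob"
    using cE countable_free_bifibration[OF free] countable_SIGMA countable_subset by metis
  have "Arr (Tot P.Infl) \<subseteq> Ob \<times> Arr (Tot E) \<times> Ob"
    by (auto simp: P.Arr_Infl P.Ar_def Hom_def)
  then have cAr: "countable (Arr (Tot P.Infl))"
    using cE cOb countable_SIGMA countable_subset by metis

  \<comment> \<open>The projection to \<open>Q\<close>; on arrows, conjugation by the given isomorphisms.\<close>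
  define \<Psi> :: "('p \<times> 'o \<times> 'a \<times> 'a, ('p \<times> 'o \<times> 'a \<times> 'a) \<times> 'q \<times> 'p \<times> 'o \<times> 'a \<times> 'a, 'o, 'a) fctr" where
    "\<Psi> = \<lparr>omap = (\<lambda>x \<in> Ob. fst (snd x)),
      amap = (\<lambda>t \<in> P.Ar. case t of (x, \<phi>, y) \<Rightarrow>
        Cmp (Tot Q) (snd (snd (snd x))) (Cmp (Tot Q) (amap H \<phi>) (fst (snd (snd y)))))\<rparr>"
  have \<Psi>_obj: "omap \<Psi> (e, T, i, i') = T" if "(e, T, i, i') \<in> Ob" for e T i i'
    using that by (simp add: \<Psi>_def)
  have \<Psi>_arr: "amap \<Psi> ((e, T, i, i'), \<phi>, (d, S, j, j')) = Cmp (Tot Q) i' (Cmp (Tot Q) (amap H \<phi>) j)"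
    if "((e, T, i, i'), \<phi>, (d, S, j, j')) \<in> P.Ar" for e T i i' \<phi> d S j j'
    using that by (simp add: \<Psi>_def)
  have comps: "i' \<in> Hom (Tot Q) T (omap H e)" "i \<in> Hom (Tot Q) (omap H e) T"
    "Cmp (Tot Q) i i' = Ide (Tot Q) (omap H e)" "Cmp (Tot Q) i' i = Ide (Tot Q) T"
    "e \<in> Obj (Tot E)" "T \<in> Obj (Tot Q)"
    if "(e, T, i, i') \<in> Ob" for e T i i'
  proof -
    have v: "vert_iso C Q (omap H e) T i i'" using that by (simp add: Ob_def)
    show "i' \<in> Hom (Tot Q) T (omap H e)" "i \<in> Hom (Tot Q) (omap H e) T"
      "Cmp (Tot Q) i i' = Ide (Tot Q) (omap H e)" "Cmp (Tot Q) i' i = Ide (Tot Q) T" "T \<in> Obj (Tot Q)"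
      using vert_isoD[OF Q v] hom_overD(1) by auto
    show "e \<in> Obj (Tot E)" using that by (simp add: Ob_def)
  qed
  have \<Psi>_Hom: "Cmp (Tot Q) (amap H \<phi>) j \<in> Hom (Tot Q) (omap H e) S"
    "Cmp (Tot Q) i' (Cmp (Tot Q) (amap H \<phi>) j) \<in> Hom (Tot Q) T S"
    if x: "(e, T, i, i') \<in> Ob" and y: "(d, S, j, j') \<in> Ob" and \<phi>: "\<phi> \<in> Hom (Tot E) e d"
    for e T i i' \<phi> d S j j'
    using cmp_Hom[OF QC functor_Hom[OF H \<phi>] comps(2)[OF y]]
      cmp_Hom[OF QC comps(1)[OF x] cmp_Hom[OF QC functor_Hom[OF H \<phi>] comps(2)[OF y]]] by auto
  have \<Psi>: "is_functor (Tot P.Infl) (Tot Q) \<Psi>"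
  proof (rule is_functorI)
    show "omap \<Psi> x \<in> Obj (Tot Q)" if "x \<in> Obj (Tot P.Infl)" for x
      using that \<Psi>_obj comps(6) by (cases x) simp
    fix a x y assume "a \<in> Hom (Tot P.Infl) x y"
    then obtain e T i i' d S j j' \<phi>
      where a: "x = (e, T, i, i')" "y = (d, S, j, j')" "x \<in> Ob" "y \<in> Ob" "\<phi> \<in> Hom (Tot E) e d" "a = (x, \<phi>, y)"
      by (cases x; cases y) (auto simp: P.Hom_Infl)
    show "amap \<Psi> a \<in> Hom (Tot Q) (omap \<Psi> x) (omap \<Psi> y)"
      using a \<Psi>_Hom(2)[of e T i i' d S j j' \<phi>] by (simp add: \<Psi>_obj \<Psi>_arr P.ArI)
    fix b z assume "b \<in> Hom (Tot P.Infl) y z"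
    then obtain c R k k' \<psi>
      where b: "z = (c, R, k, k')" "z \<in> Ob" "\<psi> \<in> Hom (Tot E) d c" "b = (y, \<psi>, z)"
      using a(2) by (cases z) (auto simp: P.Hom_Infl)
    have Ob: "(e, T, i, i') \<in> Ob" "(d, S, j, j') \<in> Ob" "(c, R, k, k') \<in> Ob" using a b by simp_all
    note I = comps[OF Ob(1)] and J = comps[OF Ob(2)] and K = comps[OF Ob(3)]
    note \<phi> = functor_Hom[OF H a(5)] and \<psi> = functor_Hom[OF H b(3)]
    note \<phi>\<psi> = functor_cmp[OF H a(5) b(3)]
    have "Cmp (Tot Q) (Cmp (Tot Q) i' (Cmp (Tot Q) (amap H \<phi>) j)) (Cmp (Tot Q) j' (Cmp (Tot Q) (amap H \<psi>) k))
      = Cmp (Tot Q) i' (Cmp (Tot Q) (Cmp (Tot Q) (amap H \<phi>) j) (Cmp (Tot Q) j' (Cmp (Tot Q) (amap H \<psi>) k)))"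
      by (rule cmp_assoc[OF QC I(1) \<Psi>_Hom(1)[OF Ob(1,2) a(5)] \<Psi>_Hom(2)[OF Ob(2,3) b(3)]])
    also have "Cmp (Tot Q) (Cmp (Tot Q) (amap H \<phi>) j) (Cmp (Tot Q) j' (Cmp (Tot Q) (amap H \<psi>) k))
      = Cmp (Tot Q) (amap H \<phi>) (Cmp (Tot Q) j (Cmp (Tot Q) j' (Cmp (Tot Q) (amap H \<psi>) k)))"
      by (rule cmp_assoc[OF QC \<phi> J(2) \<Psi>_Hom(2)[OF Ob(2,3) b(3)]])
    also have "Cmp (Tot Q) j (Cmp (Tot Q) j' (Cmp (Tot Q) (amap H \<psi>) k)) = Cmp (Tot Q) (amap H \<psi>) k"
      using cmp_assoc[OF QC J(2,1) \<Psi>_Hom(1)[OF Ob(2,3) b(3)]] J(3) ide_cmp[OF QC \<Psi>_Hom(1)[OF Ob(2,3) b(3)]]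
      by simp
    also have "Cmp (Tot Q) (amap H \<phi>) (Cmp (Tot Q) (amap H \<psi>) k)
        = Cmp (Tot Q) (amap H (Cmp (Tot E) \<phi> \<psi>)) k"
      using cmp_assoc[OF QC \<phi> \<psi> K(2)] \<phi>\<psi> by simp
    finally show "amap \<Psi> (Cmp (Tot P.Infl) a b) = Cmp (Tot Q) (amap \<Psi> a) (amap \<Psi> b)"
      using a b P.cmp_Infl[of x y z \<phi> \<psi>] cmp_Hom[OF bif_cat(1)[OF E] a(5) b(3)] P.ArI by (simp add: \<Psi>_arr)
  next
    fix x assume "x \<in> Obj (Tot P.Infl)"
    then obtain e T i i' where x: "x = (e, T, i, i')" "(e, T, i, i') \<in> Ob" by (cases x) simp
    have "(x, Ide (Tot E) e, x) \<in> P.Ar"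
      using x comps(5)[OF x(2)] ide_Hom[OF bif_cat(1)[OF E]] by (simp add: P.ArI)
    then show "amap \<Psi> (Ide (Tot P.Infl) x) = Ide (Tot Q) (omap \<Psi> x)"
      using x comps[OF x(2)] functor_ide[OF H comps(5)[OF x(2)]] ide_cmp[OF QC comps(2)[OF x(2)]]
      by (simp add: P.ide_Infl \<Psi>_arr \<Psi>_obj)
  qed (use P.category_Infl QC in \<open>auto simp: \<Psi>_def P.Arr_Infl\<close>)
  have \<Psi>_morphism: "is_bifib_morphism C P.Infl Q \<Psi>"
  proof (rule is_bifib_morphismI[OF P.bifibration_Infl Q \<Psi>])
    fix x assume "x \<in> Obj (Tot P.Infl)"
    then obtain e T i i' where x: "x = (e, T, i, i')" "(e, T, i, i') \<in> Ob" by (cases x) simp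
    then have "vert_iso C Q (omap H e) T i i'" by (simp add: Ob_def)
    then show "omap (prj Q) (omap \<Psi> x) = omap (prj P.Infl) x"
      using vert_isoD(7)[OF Q, of "omap H e" T i i'] prj_H[of e] comps(5)[OF x(2)] x
      by (simp add: \<Psi>_obj P.prj_Infl)
  next
    fix a assume "a \<in> Arr (Tot P.Infl)"
    then obtain e T i i' d S j j' \<phi> where a: "a = ((e, T, i, i'), \<phi>, (d, S, j, j'))" "a \<in> P.Ar"
      by (simp add: P.Arr_Infl) (metis surj_pair)
    then have x: "(e, T, i, i') \<in> Ob" and y: "(d, S, j, j') \<in> Ob" and \<phi>: "\<phi> \<in> Hom (Tot E) e d"
      by (auto simp: P.Ar_def)
    have vi: "vert_iso C Q (omap H e) T i i'" and vj: "vert_iso C Q (omap H d) S j j'"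
      using x y by (auto simp: Ob_def)
    have p\<phi>: "amap (prj E) \<phi> \<in> Hom C (omap (prj E) e) (omap (prj E) d)"
      using functor_Hom[OF bif_functor[OF E] \<phi>] .
    have "amap (prj Q) (Cmp (Tot Q) i' (Cmp (Tot Q) (amap H \<phi>) j))
      = Cmp C (amap (prj Q) i') (Cmp C (amap (prj Q) (amap H \<phi>)) (amap (prj Q) j))"
      using functor_cmp[OF bif_functor[OF Q] comps(1)[OF x] \<Psi>_Hom(1)[OF x y \<phi>]]
        functor_cmp[OF bif_functor[OF Q] functor_Hom[OF H \<phi>] comps(2)[OF y]] by simp
    also have "\<dots> = amap (prj E) \<phi>"
      using hom_overD(2)[OF vert_isoD(2)[OF Q vi]] hom_overD(2)[OF vert_isoD(1)[OF Q vj]]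
        prj_H'[OF HomD(1)[OF \<phi>]] prj_H[OF comps(5)[OF x]] prj_H[OF comps(5)[OF y]]
        ide_cmp[OF bif_cat(2)[OF Q] p\<phi>] cmp_ide[OF bif_cat(2)[OF Q] p\<phi>] by simp
    finally show "amap (prj Q) (amap \<Psi> a) = amap (prj P.Infl) a"
      using a by (simp add: \<Psi>_arr P.prj_Infl)
  next
    fix f A B x assume f: "f \<in> Hom C A B" and "x \<in> Obj (Tot P.Infl)" "omap (prj P.Infl) x = A"
    then obtain e T i i' where x: "x = (e, T, i, i')" "(e, T, i, i') \<in> Ob" and e: "omap (prj E) e = A"
      by (cases x) (simp add: P.prj_Infl)
    obtain j j' where pu: "pu f (e, T, i, i') = (pushed E f e, pushed Q f T, j, j')"
      "Cmp (Tot Q) (amap H (push E f e)) j = Cmp (Tot Q) i (push Q f T)"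
      using pu_props[OF f x(2) e] by blast
    have T: "omap (prj Q) T = A"
      using vert_isoD(7)[OF Q, of "omap H e" T i i'] prj_H[of e] x(2) e by (simp add: Ob_def)
    note pT = hom_overD(1)[OF push_over(1)[OF Q f comps(6)[OF x(2)] T]]
    have "push P.Infl f x \<in> P.Ar"
      using P.pushed_Infl(1)[OF f, of x] x e by (auto simp: hom_over_def Hom_def P.Arr_Infl)
    then have "amap \<Psi> (push P.Infl f x) = Cmp (Tot Q) i' (Cmp (Tot Q) i (push Q f T))"
      using x pu by (simp add: P.push_Infl \<Psi>_arr)
    also have "\<dots> = push Q f T"
      using cmp_assoc[OF QC comps(1,2)[OF x(2)] pT] comps(4)[OF x(2)] ide_cmp[OF QC pT] by simp
    finally show "amap \<Psi> (push P.Infl f x) = push Q f (omap \<Psi> x)"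
      using x by (simp add: \<Psi>_obj)
  next
    fix f A B x assume f: "f \<in> Hom C A B" and "x \<in> Obj (Tot P.Infl)" "omap (prj P.Infl) x = B"
    then obtain e T i i' where x: "x = (e, T, i, i')" "(e, T, i, i') \<in> Ob" and e: "omap (prj E) e = B"
      by (cases x) (simp add: P.prj_Infl)
    obtain j j' where pl: "pl f (e, T, i, i') = (pulled E f e, pulled Q f T, j, j')"
      "vert_iso C Q (omap H (pulled E f e)) (pulled Q f T) j j'"
      "Cmp (Tot Q) (amap H (pull E f e)) i = Cmp (Tot Q) j (pull Q f T)"
      using pl_props[OF f x(2) e] by blast
    have T: "omap (prj Q) T = B"
      using vert_isoD(7)[OF Q, of "omap H e" T i i'] prj_H[of e] x(2) e by (simp add: Ob_def)
    note pT = hom_overD(1)[OF pull_over(1)[OF Q f comps(6)[OF x(2)] T]]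
    note J = vert_isoD[OF Q pl(2)]
    have "pull P.Infl f x \<in> P.Ar"
      using P.pulled_Infl(1)[OF f, of x] x e by (auto simp: hom_over_def Hom_def P.Arr_Infl)
    then have "amap \<Psi> (pull P.Infl f x) = Cmp (Tot Q) j' (Cmp (Tot Q) j (pull Q f T))"
      using x pl by (simp add: P.pull_Infl \<Psi>_arr)
    also have "\<dots> = pull Q f T"
      using cmp_assoc[OF QC hom_overD(1)[OF J(2)] hom_overD(1)[OF J(1)] pT] J(4) ide_cmp[OF QC pT] by simp
    finally show "amap \<Psi> (pull P.Infl f x) = pull Q f (omap \<Psi> x)"
      using x by (simp add: \<Psi>_obj)
  qed

  \<comment> \<open>On generators, take identity isomorphisms.\<close>
  let ?h = "\<lambda>X. (omap G (omap \<eta> X), omap \<eta> X, Ide (Tot Q) (omap \<eta> X), Ide (Tot Q) (omap \<eta> X))"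
  let ?\<theta> = "P.lift D (comp_functor D \<eta> G) ?h"
  have HG\<eta>_obj: "omap H (omap G (omap \<eta> X)) = omap \<eta> X" if "X \<in> Obj D" for X
    using comp_functor_apply(1)[OF that, of \<eta> "comp_functor (Tot Q) G H"] functor_obj[OF \<eta> that]
    by (simp add: HG\<eta>)
  have HG\<eta>_arr: "amap H (amap G (amap \<eta> \<alpha>)) = amap \<eta> \<alpha>" if "\<alpha> \<in> Hom D X Y" for \<alpha> X Y
    using comp_functor_apply(2)[OF HomD(1)[OF that], of \<eta> "comp_functor (Tot Q) G H"]
      HomD(1)[OF functor_Hom[OF \<eta> that]] by (simp add: HG\<eta>)
  have h: "?h X \<in> Ob \<and> fst (?h X) = omap (comp_functor D \<eta> G) X" if "X \<in> Obj D" for X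
    using that vert_iso_ide[OF Q functor_obj[OF \<eta> that]] functor_obj[OF GF functor_obj[OF \<eta> that]]
    by (simp add: Ob_def HG\<eta>_obj)
  note \<eta>G = comp_functor[OF \<eta> GF]
  note \<theta> = P.functor_lift[OF \<eta>G h] and \<theta>_proj = P.comp_lift_proj[OF \<eta>G h]
  have \<theta>_\<Psi>: "comp_functor D ?\<theta> \<Psi> = \<eta>"
  proof (rule functor_eqI[OF comp_functor[OF \<theta> \<Psi>] \<eta>])
    show "omap (comp_functor D ?\<theta> \<Psi>) X = omap \<eta> X" if "X \<in> Obj D" for X
      using that h[OF that] P.lift_apply(1)[OF \<eta>G h that] by (simp add: \<Psi>_obj)
    fix \<alpha> assume \<alpha>: "\<alpha> \<in> Arr D"
    note \<alpha>' = Hom_Dom_Cod[OF \<alpha>]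
    show "amap (comp_functor D ?\<theta> \<Psi>) \<alpha> = amap \<eta> \<alpha>"
      using \<alpha> P.lift_apply(2)[OF \<eta>G h \<alpha>'] P.lift_Ar(1)[OF \<eta>G h \<alpha>'] HG\<eta>_arr[OF \<alpha>']
        ide_cmp[OF QC functor_Hom[OF \<eta> \<alpha>']] cmp_ide[OF QC functor_Hom[OF \<eta> \<alpha>']]
      by (simp add: \<Psi>_arr)
  qed
  have "comp_functor D ?\<theta> (prj P.Infl) = comp_functor D (comp_functor D \<eta> G) (prj E)"
    using comp_functor_assoc[OF \<theta>, of P.proj "prj E"] by (simp add: P.comp_proj_prj \<theta>_proj)
  also have "\<dots> = p"
    using comp_functor_assoc[OF \<eta>, of G "prj E"] bifib_morphismD(4)[OF G] free_bifibrationD(4)[OF free]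
    by simp
  finally have \<theta>_prj: "comp_functor D ?\<theta> (prj P.Infl) = p" .
  obtain S where S: "is_bifib_morphism C Q P.Infl S" "comp_functor D \<eta> S = ?\<theta>"
    using free_bifibration_countable_ex1[OF free P.bifibration_Infl _ cAr \<theta> \<theta>_prj] cOb by auto
  note SF = bifib_morphismD(3)[OF S(1)]
  \<comment> \<open>By uniqueness, \<open>S\<close> is a section of \<open>\<Psi>\<close> and lies over \<open>G\<close>.\<close>
  have S_\<Psi>: "comp_functor (Tot Q) S \<Psi> = id_functor (Tot Q)"
  proof -
    have "is_bifib_morphism C Q Q (comp_functor (Tot Q) S \<Psi>)"
      "comp_functor D \<eta> (comp_functor (Tot Q) S \<Psi>) = \<eta>"
      using comp_bifib_morphism[OF S(1) \<Psi>_morphism] comp_functor_assoc[OF \<eta>, of S \<Psi>] S(2) \<theta>_\<Psi> by simp_all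
    then show ?thesis
      using free_bifibration_ex1[OF free Q \<eta> free_bifibrationD(4)[OF free]]
        id_bifib_morphism[OF Q] comp_id_functor[OF \<eta>] by blast
  qed
  have S_proj: "comp_functor (Tot Q) S P.proj = G"
  proof -
    have 1: "is_bifib_morphism C Q E (comp_functor (Tot Q) S P.proj)"
      "comp_functor D \<eta> (comp_functor (Tot Q) S P.proj) = comp_functor D \<eta> G"
      using comp_bifib_morphism[OF S(1) P.morphism_proj] comp_functor_assoc[OF \<eta>, of S P.proj] S(2) \<theta>_proj
      by simp_all
    have "comp_functor D (comp_functor D \<eta> G) (prj E) = p"
      using comp_functor_assoc[OF \<eta>, of G "prj E"] bifib_morphismD(4)[OF G] free_bifibrationD(4)[OF free]
      by simp
    from free_bifibration_countable_ex1[OF free E cE \<eta>G this] 1 G show ?thesis by blast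
  qed
  define \<sigma> where "\<sigma> = (\<lambda>X \<in> Obj (Tot Q). snd (snd (snd (omap S X))))"
  have S_obj: "\<exists>i. omap S X = (omap G X, X, i, \<sigma> X) \<and> (omap G X, X, i, \<sigma> X) \<in> Ob"
    if X: "X \<in> Obj (Tot Q)" for X
  proof -
    obtain e T i i' where *: "omap S X = (e, T, i, i')" by (cases "omap S X")
    have **: "(e, T, i, i') \<in> Ob" using functor_obj[OF SF X] * by simp
    have "T = X" using comp_functor_apply(1)[OF X, of S \<Psi>] X * ** by (simp add: S_\<Psi> \<Psi>_obj)
    moreover have "e = omap G X"
      using comp_functor_apply(1)[OF X, of S P.proj] X * ** by (simp add: S_proj P.proj_apply)
    ultimately show ?thesis using X * ** by (simp add: \<sigma>_def)
  qed
  have nat: "Cmp (Tot Q) \<alpha> (\<sigma> Y) = Cmp (Tot Q) (\<sigma> X) (amap H (amap G \<alpha>))"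
    if \<alpha>: "\<alpha> \<in> Hom (Tot Q) X Y" for \<alpha> X Y
  proof -
    note XY = Hom_obj[OF QC \<alpha>]
    obtain i where i: "omap S X = (omap G X, X, i, \<sigma> X)" "(omap G X, X, i, \<sigma> X) \<in> Ob"
      using S_obj[OF XY(1)] by blast
    obtain j where j: "omap S Y = (omap G Y, Y, j, \<sigma> Y)" "(omap G Y, Y, j, \<sigma> Y) \<in> Ob"
      using S_obj[OF XY(2)] by blast
    obtain \<phi> where \<phi>: "amap S \<alpha> = (omap S X, \<phi>, omap S Y)" "amap S \<alpha> \<in> P.Ar"
      using functor_Hom[OF SF \<alpha>] P.ArI unfolding P.Hom_Infl by metis
    have "\<phi> = amap G \<alpha>"
      using comp_functor_apply(2)[OF HomD(1)[OF \<alpha>], of S P.proj] \<phi> by (simp add: S_proj P.proj_apply)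
    moreover have "amap \<Psi> (amap S \<alpha>) = \<alpha>"
      using comp_functor_apply(2)[OF HomD(1)[OF \<alpha>], of S \<Psi>] HomD(1)[OF \<alpha>] by (simp add: S_\<Psi>)
    ultimately have eq: "Cmp (Tot Q) (\<sigma> X) (Cmp (Tot Q) (amap H (amap G \<alpha>)) j) = \<alpha>"
      using i j \<phi> by (simp add: \<Psi>_arr)
    note a = functor_Hom[OF H functor_Hom[OF GF \<alpha>]]
    have "Cmp (Tot Q) \<alpha> (\<sigma> Y)
        = Cmp (Tot Q) (\<sigma> X) (Cmp (Tot Q) (Cmp (Tot Q) (amap H (amap G \<alpha>)) j) (\<sigma> Y))"
      using cmp_assoc[OF QC comps(1)[OF i(2)] \<Psi>_Hom(1)[OF i(2) j(2) functor_Hom[OF GF \<alpha>]] comps(1)[OF j(2)]]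
      by (simp add: eq)
    also have "Cmp (Tot Q) (Cmp (Tot Q) (amap H (amap G \<alpha>)) j) (\<sigma> Y) = amap H (amap G \<alpha>)"
      using cmp_assoc[OF QC a comps(2,1)[OF j(2)]] comps(3)[OF j(2)] cmp_ide[OF QC a] by simp
    finally show ?thesis .
  qed
  have "is_nat_iso (Tot Q) (Tot Q) (id_functor (Tot Q)) (comp_functor (Tot Q) G H) \<sigma>"
    unfolding is_nat_iso_def is_nat_trans_def
  proof (intro conjI ballI)
    show "is_functor (Tot Q) (Tot Q) (id_functor (Tot Q))" by (rule id_functor[OF QC])
    show "is_functor (Tot Q) (Tot Q) (comp_functor (Tot Q) G H)" by (rule comp_functor[OF GF H])
    show "\<sigma> \<in> extensional (Obj (Tot Q))" by (simp add: \<sigma>_def)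
    fix X assume X: "X \<in> Obj (Tot Q)"
    then obtain i where i: "(omap G X, X, i, \<sigma> X) \<in> Ob" using S_obj by blast
    show "\<sigma> X \<in> Hom (Tot Q) (omap (id_functor (Tot Q)) X) (omap (comp_functor (Tot Q) G H) X)"
      using X comps(1)[OF i] by simp
    have "iso_pair (Tot Q) X (omap H (omap G X)) (\<sigma> X) i"
      using comps[OF i] by (simp add: iso_pair_def)
    then show "is_iso (Tot Q) (\<sigma> X)" by (rule iso_pair_iso)
  next
    fix \<alpha> assume \<alpha>: "\<alpha> \<in> Arr (Tot Q)"
    then show "Cmp (Tot Q) (amap (id_functor (Tot Q)) \<alpha>) (\<sigma> (Cod (Tot Q) \<alpha>))
        = Cmp (Tot Q) (\<sigma> (Dom (Tot Q) \<alpha>)) (amap (comp_functor (Tot Q) G H) \<alpha>)"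
      using nat[OF Hom_Dom_Cod[OF \<alpha>]] by simp
  qed
  moreover have "\<exists>i. vert_iso C Q X (omap H (omap G X)) (\<sigma> X) i" if X: "X \<in> Obj (Tot Q)" for X
  proof -
    obtain i where i: "(omap G X, X, i, \<sigma> X) \<in> Ob" using S_obj X by blast
    then have "vert_iso C Q (omap H (omap G X)) X i (\<sigma> X)" by (simp add: Ob_def)
    then show ?thesis using vert_iso_sym[OF Q] by blast
  qed
  ultimately show ?thesis by blast
qed


section \<open>Adjunctions\<close>

lemma id_adjunction:
  assumes C: "is_category C" shows "is_adjunction (id_adjn C)"
proof -
  note I = id_functor[OF C] and J = comp_id_functor[OF id_functor[OF C]]
  have "is_nat_trans C C (id_functor C) (id_functor C) (\<lambda>S \<in> Obj C. Ide C S)"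
    unfolding is_nat_trans_def
  proof (intro conjI ballI)
    fix f assume f: "f \<in> Arr C"
    show "Cmp C (amap (id_functor C) f) (restrict (Ide C) (Obj C) (Cod C f))
        = Cmp C (restrict (Ide C) (Obj C) (Dom C f)) (amap (id_functor C) f)"
      using f Hom_obj[OF C Hom_Dom_Cod[OF f]] ide_cmp[OF C Hom_Dom_Cod[OF f]] cmp_ide[OF C Hom_Dom_Cod[OF f]]
      by simp
  qed (use I ide_Hom[OF C] in auto)
  then show ?thesis
    using I J ide_Hom[OF C] HomD(1)[OF ide_Hom[OF C]] ide_cmp[OF C ide_Hom[OF C]]
    by (auto simp: is_adjunction_def id_adjn_def)
qed

lemma comp_id_adjn:
  assumes H: "is_adjunction H"
  shows "comp_adjn H (id_adjn (upper H)) = H" "comp_adjn (id_adjn (lower H)) H = H"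
proof -
  note H' = H[unfolded is_adjunction_def is_nat_trans_def]
  have L: "is_functor (lower H) (upper H) (left H)" and R: "is_functor (upper H) (lower H) (right H)"
    using H' by auto
  note A = functor_cat(1)[OF L] and B = functor_cat(2)[OF L]
  have u: "unit H X \<in> Hom (lower H) X (omap (right H) (omap (left H) X))" if "X \<in> Obj (lower H)" for X
    using H' that by auto
  have e: "counit H X \<in> Hom (upper H) (omap (left H) (omap (right H) X)) X" if "X \<in> Obj (upper H)" for X
    using H' that by auto
  have ext: "unit H \<in> extensional (Obj (lower H))" "counit H \<in> extensional (Obj (upper H))"
    using H' by auto
  have 1: "(\<lambda>S \<in> Obj (lower H). Cmp (lower H) (unit H S) (amap (right H) (Ide (upper H) (omap (left H) S)))) = unit H"
    using ext(1) functor_ide[OF R functor_obj[OF L]] cmp_ide[OF A u]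
    by (intro extensionalityI[of _ "Obj (lower H)"]) auto
  have 2: "(\<lambda>T \<in> Obj (upper H). Cmp (upper H) (amap (id_functor (upper H)) (counit H T)) (Ide (upper H) T)) = counit H"
    using ext(2) cmp_ide[OF B e] HomD(1)[OF e]
    by (intro extensionalityI[of _ "Obj (upper H)"]) auto
  have 3: "(\<lambda>S \<in> Obj (lower H). Cmp (lower H) (Ide (lower H) S) (amap (id_functor (lower H)) (unit H S))) = unit H"
    using ext(1) ide_cmp[OF A u] HomD(1)[OF u]
    by (intro extensionalityI[of _ "Obj (lower H)"]) auto
  have 4: "(\<lambda>T \<in> Obj (upper H). Cmp (upper H) (amap (left H) (Ide (lower H) (omap (right H) T))) (counit H T)) = counit H"
    using ext(2) functor_ide[OF L functor_obj[OF R]] ide_cmp[OF B e]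
    by (intro extensionalityI[of _ "Obj (upper H)"]) auto
  have eta: "(\<lambda>S \<in> Obj (lower H). Cmp (lower H) (unit H S)
        (amap (right H) (restrict (Ide (upper H)) (Obj (upper H)) (omap (left H) S)))) = unit H"
    using functor_obj[OF L] by (subst (2) 1[symmetric]) (auto intro!: restrict_ext)
  have eps: "(\<lambda>T \<in> Obj (upper H). Cmp (upper H)
        (amap (left H) (restrict (Ide (lower H)) (Obj (lower H)) (omap (right H) T))) (counit H T)) = counit H"
    using functor_obj[OF R] by (subst (2) 4[symmetric]) (auto intro!: restrict_ext)
  have obj: "(\<lambda>T \<in> Obj (upper H). Cmp (upper H) (amap (id_functor (upper H)) (counit H (omap (id_functor (upper H)) T)))
        (restrict (Ide (upper H)) (Obj (upper H)) T)) = counit H"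
    by (subst (2) 2[symmetric]) (auto intro!: restrict_ext)
  have obj': "(\<lambda>S \<in> Obj (lower H). Cmp (lower H) (restrict (Ide (lower H)) (Obj (lower H)) S)
        (amap (id_functor (lower H)) (unit H (omap (id_functor (lower H)) S)))) = unit H"
    by (subst (2) 3[symmetric]) (auto intro!: restrict_ext)
  show "comp_adjn H (id_adjn (upper H)) = H"
    using comp_id_functor[OF L] id_comp_functor[OF R] eta obj
    by (simp add: comp_adjn_def id_adjn_def)
  show "comp_adjn (id_adjn (lower H)) H = H"
    using id_comp_functor[OF L] comp_id_functor[OF R] eps obj'
    by (simp add: comp_adjn_def id_adjn_def)
qed

text \<open>Transposition along an adjunction.\<close>

lemma adjunction_transpose_ex1:
  assumes H: "is_adjunction H" and S: "S \<in> Obj (lower H)" and T: "T \<in> Obj (upper H)"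
    and a: "a \<in> Hom (upper H) (omap (left H) S) T"
  shows "\<exists>!b. b \<in> Hom (lower H) S (omap (right H) T) \<and> Cmp (upper H) (amap (left H) b) (counit H T) = a"
proof (rule ex1I)
  note H' = H[unfolded is_adjunction_def is_nat_trans_def]
  let ?L = "left H" and ?R = "right H" and ?A = "lower H" and ?B = "upper H"
  have L: "is_functor ?A ?B ?L" and R: "is_functor ?B ?A ?R" using H' by auto
  note A = functor_cat(1)[OF L] and B = functor_cat(2)[OF L]
  have u: "unit H X \<in> Hom ?A X (omap ?R (omap ?L X))" if "X \<in> Obj ?A" for X
    using H' that by auto
  have e: "counit H X \<in> Hom ?B (omap ?L (omap ?R X)) X" if "X \<in> Obj ?B" for X
    using H' that by auto
  have u_nat: "Cmp ?A f (unit H Y) = Cmp ?A (unit H X) (amap ?R (amap ?L f))" if "f \<in> Hom ?A X Y" for f X Y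
    using H' that by (auto simp: Hom_def)
  have e_nat: "Cmp ?B (amap ?L (amap ?R f)) (counit H Y) = Cmp ?B (counit H X) f" if "f \<in> Hom ?B X Y" for f X Y
    using H' that by (auto simp: Hom_def)
  have tri1: "Cmp ?B (amap ?L (unit H X)) (counit H (omap ?L X)) = Ide ?B (omap ?L X)" if "X \<in> Obj ?A" for X
    using H' that by auto
  have tri2: "Cmp ?A (unit H (omap ?R X)) (amap ?R (counit H X)) = Ide ?A (omap ?R X)" if "X \<in> Obj ?B" for X
    using H' that by auto
  have b: "Cmp ?A (unit H S) (amap ?R a) \<in> Hom ?A S (omap ?R T)"
    using cmp_Hom[OF A u[OF S] functor_Hom[OF R a]] .
  have "Cmp ?B (amap ?L (Cmp ?A (unit H S) (amap ?R a))) (counit H T)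
      = Cmp ?B (amap ?L (unit H S)) (Cmp ?B (amap ?L (amap ?R a)) (counit H T))"
    using functor_cmp[OF L u[OF S] functor_Hom[OF R a]]
      cmp_assoc[OF B functor_Hom[OF L u[OF S]] functor_Hom[OF L functor_Hom[OF R a]] e[OF T]] by simp
  also have "\<dots> = Cmp ?B (Cmp ?B (amap ?L (unit H S)) (counit H (omap ?L S))) a"
    using e_nat[OF a] cmp_assoc[OF B functor_Hom[OF L u[OF S]] e[OF functor_obj[OF L S]] a] by simp
  also have "\<dots> = a"
    using tri1[OF S] ide_cmp[OF B a] by simp
  finally show "Cmp ?A (unit H S) (amap ?R a) \<in> Hom ?A S (omap ?R T) \<and>
      Cmp ?B (amap ?L (Cmp ?A (unit H S) (amap ?R a))) (counit H T) = a"
    using b by simp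
  fix c assume c: "c \<in> Hom ?A S (omap ?R T) \<and> Cmp ?B (amap ?L c) (counit H T) = a"
  then have c': "c \<in> Hom ?A S (omap ?R T)" by simp
  note Lc = functor_Hom[OF L c']
  have "amap ?R a = Cmp ?A (amap ?R (amap ?L c)) (amap ?R (counit H T))"
    using c functor_cmp[OF R Lc e[OF T]] by simp
  then have "Cmp ?A (unit H S) (amap ?R a)
      = Cmp ?A (Cmp ?A (unit H S) (amap ?R (amap ?L c))) (amap ?R (counit H T))"
    using cmp_assoc[OF A u[OF S] functor_Hom[OF R Lc] functor_Hom[OF R e[OF T]]] by simp
  also have "\<dots> = Cmp ?A c (Cmp ?A (unit H (omap ?R T)) (amap ?R (counit H T)))"
    using u_nat[OF c'] cmp_assoc[OF A c' u[OF functor_obj[OF R T]] functor_Hom[OF R e[OF T]]] by simp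
  also have "\<dots> = c"
    using tri2[OF T] cmp_ide[OF A c'] by simp
  finally show "c = Cmp ?A (unit H S) (amap ?R a)" by simp
qed

section \<open>The category of elements is a bifibration\<close>

text \<open>The part of functoriality of \<open>F : C \<rightarrow> Adj\<close> that the category of elements depends on.\<close>

locale indexed_adjunctions =
  fixes C :: "('c, 'b) cat" and F :: "('c, 'b, ('o, 'a) cat, ('o, 'a) adjn) fctr"
  assumes C: "is_category C"
    and adj: "\<And>f A B. f \<in> Hom C A B \<Longrightarrow>
      is_adjunction (amap F f) \<and> lower (amap F f) = omap F A \<and> upper (amap F f) = omap F B"
    and F_ide: "\<And>A. A \<in> Obj C \<Longrightarrow> amap F (Ide C A) = id_adjn (omap F A)"
    and F_cmp: "\<And>f g A B D. f \<in> Hom C A B \<Longrightarrow> g \<in> Hom C B D \<Longrightarrow>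
      amap F (Cmp C f g) = comp_adjn (amap F f) (amap F g)"
begin

abbreviation E :: "('c \<times> 'o, 'o \<times> 'b \<times> 'a, 'c, 'b) bifib" where
  "E \<equiv> elements C F"

lemma elements_simps:
  "Obj (Tot E) = {(A, S). A \<in> Obj C \<and> S \<in> Obj (omap F A)}"
  "Arr (Tot E) = {(S, f, \<alpha>). f \<in> Arr C \<and> S \<in> Obj (omap F (Dom C f)) \<and>
     \<alpha> \<in> Arr (omap F (Cod C f)) \<and> Dom (omap F (Cod C f)) \<alpha> = omap (left (amap F f)) S}"
  "Dom (Tot E) (S, f, \<alpha>) = (Dom C f, S)"
  "Cod (Tot E) (S, f, \<alpha>) = (Cod C f, Cod (omap F (Cod C f)) \<alpha>)"
  "Ide (Tot E) (A, S) = (S, Ide C A, Ide (omap F A) S)"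
  "Cmp (Tot E) (S, f, \<alpha>) (T, g, \<beta>) = (S, Cmp C f g, Cmp (omap F (Cod C g)) (amap (left (amap F g)) \<alpha>) \<beta>)"
  "push E f (A, S) = (S, f, Ide (omap F (Cod C f)) (omap (left (amap F f)) S))"
  "pull E g (B, T) = (omap (right (amap F g)) T, g, counit (amap F g) T)"
  by (simp_all add: elements_def Let_def)

lemma elements_prj:
  "x \<in> Obj (Tot E) \<Longrightarrow> omap (prj E) x = fst x"
  "a \<in> Arr (Tot E) \<Longrightarrow> amap (prj E) a = fst (snd a)"
  "omap (prj E) \<in> extensional (Obj (Tot E))" "amap (prj E) \<in> extensional (Arr (Tot E))"
  by (auto simp: elements_def Let_def)

lemma left_functor: "f \<in> Hom C A B \<Longrightarrow> is_functor (omap F A) (omap F B) (left (amap F f))"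
  using adj[of f A B] by (auto simp: is_adjunction_def)

lemma right_functor: "f \<in> Hom C A B \<Longrightarrow> is_functor (omap F B) (omap F A) (right (amap F f))"
  using adj[of f A B] by (auto simp: is_adjunction_def)

lemma counit_Hom:
  assumes f: "f \<in> Hom C A B" and T: "T \<in> Obj (omap F B)"
  shows "counit (amap F f) T \<in> Hom (omap F B) (omap (left (amap F f)) (omap (right (amap F f)) T)) T"
  using adj[OF f] T by (auto simp: is_adjunction_def is_nat_trans_def)

lemma F_category: "A \<in> Obj C \<Longrightarrow> is_category (omap F A)"
  using functor_cat(1)[OF left_functor[OF ide_Hom[OF C]]] .

lemma left_ide:
  "A \<in> Obj C \<Longrightarrow> S \<in> Obj (omap F A) \<Longrightarrow> omap (left (amap F (Ide C A))) S = S"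
  "A \<in> Obj C \<Longrightarrow> \<alpha> \<in> Hom (omap F A) S T \<Longrightarrow> amap (left (amap F (Ide C A))) \<alpha> = \<alpha>"
  by (simp_all add: F_ide id_adjn_def HomD(1))

lemma left_cmp:
  assumes f: "f \<in> Hom C A B" and g: "g \<in> Hom C B D"
  shows "S \<in> Obj (omap F A) \<Longrightarrow>
      omap (left (amap F (Cmp C f g))) S = omap (left (amap F g)) (omap (left (amap F f)) S)"
    and "\<alpha> \<in> Hom (omap F A) S T \<Longrightarrow>
      amap (left (amap F (Cmp C f g))) \<alpha> = amap (left (amap F g)) (amap (left (amap F f)) \<alpha>)"
  using adj[OF f] by (simp_all add: F_cmp[OF f g] comp_adjn_def HomD(1))

lemma elements_Hom:
  "(S, f, \<alpha>) \<in> Hom (Tot E) (A, S') (B, T) \<longleftrightarrow>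
    S' = S \<and> f \<in> Hom C A B \<and> S \<in> Obj (omap F A) \<and> \<alpha> \<in> Hom (omap F B) (omap (left (amap F f)) S) T"
  by (auto simp: Hom_def elements_simps)

lemma elements_HomE:
  assumes "a \<in> Hom (Tot E) (A, S) (B, T)"
  obtains f \<alpha> where "a = (S, f, \<alpha>)" "f \<in> Hom C A B" "S \<in> Obj (omap F A)"
    "\<alpha> \<in> Hom (omap F B) (omap (left (amap F f)) S) T"
  using assms by (cases a) (auto simp: elements_Hom)

lemma elements_cmp:
  "g \<in> Hom C B D \<Longrightarrow>
    Cmp (Tot E) (S, f, \<alpha>) (T, g, \<beta>) = (S, Cmp C f g, Cmp (omap F D) (amap (left (amap F g)) \<alpha>) \<beta>)"
  by (simp add: elements_simps HomD)

lemma elements_category: "is_category (Tot E)"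
proof (rule is_categoryI)
  fix a assume "a \<in> Arr (Tot E)"
  then obtain S f \<alpha> where a: "a = (S, f, \<alpha>)" "f \<in> Arr C" "S \<in> Obj (omap F (Dom C f))"
     "\<alpha> \<in> Arr (omap F (Cod C f))"
    by (auto simp: elements_simps)
  note f = Hom_Dom_Cod[OF a(2)]
  show "Dom (Tot E) a \<in> Obj (Tot E)" "Cod (Tot E) a \<in> Obj (Tot E)"
    using a Hom_obj[OF C f] Hom_obj(2)[OF F_category[OF Hom_obj(2)[OF C f]] Hom_Dom_Cod[OF a(4)]]
    by (simp_all add: elements_simps)
next
  fix x assume "x \<in> Obj (Tot E)"
  then obtain A S where x: "x = (A, S)" "A \<in> Obj C" "S \<in> Obj (omap F A)" by (auto simp: elements_simps)
  then show "Ide (Tot E) x \<in> Hom (Tot E) x x"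
    using ide_Hom[OF C] ide_Hom[OF F_category] left_ide(1) by (simp add: elements_simps(5) elements_Hom)
next
  fix a x y assume "a \<in> Hom (Tot E) x y"
  moreover obtain A S B T where xy: "x = (A, S)" "y = (B, T)" by (cases x; cases y)
  ultimately obtain f \<alpha> where a: "a = (S, f, \<alpha>)" and f: "f \<in> Hom C A B" and S: "S \<in> Obj (omap F A)"
    and \<alpha>: "\<alpha> \<in> Hom (omap F B) (omap (left (amap F f)) S) T"
    by (auto elim: elements_HomE)
  note FB = F_category[OF Hom_obj(2)[OF C f]]
  show "Cmp (Tot E) (Ide (Tot E) x) a = a"
    using xy a elements_cmp[OF f] ide_cmp[OF C f] functor_ide[OF left_functor[OF f] S] ide_cmp[OF FB \<alpha>]
    by (simp add: elements_simps(5))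
  show "Cmp (Tot E) a (Ide (Tot E) y) = a"
    using xy a elements_cmp[OF ide_Hom[OF C Hom_obj(2)[OF C f]]] cmp_ide[OF C f]
      left_ide(2)[OF Hom_obj(2)[OF C f] \<alpha>] cmp_ide[OF FB \<alpha>]
    by (simp add: elements_simps(5))
  fix b z assume "b \<in> Hom (Tot E) y z"
  moreover obtain D U where z: "z = (D, U)" by (cases z)
  ultimately obtain g \<beta> where b: "b = (T, g, \<beta>)" and g: "g \<in> Hom C B D" and T: "T \<in> Obj (omap F B)"
    and \<beta>: "\<beta> \<in> Hom (omap F D) (omap (left (amap F g)) T) U"
    using xy by (auto elim: elements_HomE)
  note FD = F_category[OF Hom_obj(2)[OF C g]]
  note g\<alpha> = functor_Hom[OF left_functor[OF g] \<alpha>]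
  show "Cmp (Tot E) a b \<in> Hom (Tot E) x z"
    using xy z a b S cmp_Hom[OF C f g] cmp_Hom[OF FD g\<alpha> \<beta>]
    by (simp add: elements_cmp[OF g] elements_Hom left_cmp(1)[OF f g])
  fix c w assume "c \<in> Hom (Tot E) z w"
  moreover obtain D' V where w: "w = (D', V)" by (cases w)
  ultimately obtain h \<gamma> where c: "c = (U, h, \<gamma>)" and h: "h \<in> Hom C D D'"
    and \<gamma>: "\<gamma> \<in> Hom (omap F D') (omap (left (amap F h)) U) V"
    using z by (auto elim: elements_HomE)
  note FD' = F_category[OF Hom_obj(2)[OF C h]]
  show "Cmp (Tot E) (Cmp (Tot E) a b) c = Cmp (Tot E) a (Cmp (Tot E) b c)"
    using a b c cmp_assoc[OF C f g h] functor_cmp[OF left_functor[OF h] g\<alpha> \<beta>]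
      cmp_assoc[OF FD' functor_Hom[OF left_functor[OF h] g\<alpha>] functor_Hom[OF left_functor[OF h] \<beta>] \<gamma>]
      left_cmp(2)[OF g h \<alpha>]
    by (simp add: elements_cmp[OF g] elements_cmp[OF h] elements_cmp[OF cmp_Hom[OF C g h]])
qed

lemma elements_prj_functor: "is_functor (Tot E) C (prj E)"
proof (rule is_functorI[OF elements_category C elements_prj(3,4)])
  show "omap (prj E) x \<in> Obj C" if "x \<in> Obj (Tot E)" for x
    using that by (auto simp: elements_prj(1)) (auto simp: elements_simps)
  show "amap (prj E) (Ide (Tot E) x) = Ide C (omap (prj E) x)" if "x \<in> Obj (Tot E)" for x
    using HomD(1)[OF ide_Hom[OF elements_category that]] that
    by (cases x) (simp add: elements_prj(1,2) elements_simps(5))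
  fix a x y assume a: "a \<in> Hom (Tot E) x y"
  show "amap (prj E) a \<in> Hom C (omap (prj E) x) (omap (prj E) y)"
    using a Hom_obj[OF elements_category a] HomD(1)[OF a]
    by (cases a, cases x, cases y) (simp add: elements_prj(1,2) elements_Hom)
  fix b z assume b: "b \<in> Hom (Tot E) y z"
  show "amap (prj E) (Cmp (Tot E) a b) = Cmp C (amap (prj E) a) (amap (prj E) b)"
    using HomD(1)[OF a] HomD(1)[OF b] HomD(1)[OF cmp_Hom[OF elements_category a b]]
    by (cases a, cases b) (simp add: elements_prj(2) elements_simps(6))
qed

lemma elements_over:
  "a \<in> hom_over E g (A, S) (B, T) \<longleftrightarrow> (\<exists>\<alpha>. a = (S, g, \<alpha>) \<and> g \<in> Hom C A B \<and> S \<in> Obj (omap F A) \<and>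
    \<alpha> \<in> Hom (omap F B) (omap (left (amap F g)) S) T)"
  using elements_prj(2)[of a] HomD(1)[of a "Tot E"]
  by (cases a) (auto simp: hom_over_def elements_Hom)

lemma elements_pushed:
  assumes f: "f \<in> Hom C A B" and S: "S \<in> Obj (omap F A)"
  shows "pushed E f (A, S) = (B, omap (left (amap F f)) S)"
  using HomD[OF f] HomD(3)[OF ide_Hom[OF F_category[OF Hom_obj(2)[OF C f]] functor_obj[OF left_functor[OF f] S]]]
  by (simp add: elements_simps)

lemma elements_pulled:
  assumes f: "f \<in> Hom C A B"
  shows "pulled E f (B, T) = (A, omap (right (amap F f)) T)"
  using HomD[OF f] by (simp add: elements_simps)

theorem elements_bifibration: "is_bifibration C E"
proof (rule is_bifibrationI[OF elements_prj_functor])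
  fix f A B x assume f: "f \<in> Hom C A B" and x: "x \<in> Obj (Tot E)" 
  then obtain A' S where xS: "x = (A', S)" "A' \<in> Obj C" "S \<in> Obj (omap F A')" by (auto simp: elements_simps)
  {
    assume "omap (prj E) x = A"
    then have "A' = A" using x xS elements_prj(1)[OF x] by simp
    then show "push E f x \<in> hom_over E f x (pushed E f x)"
      using xS f ide_Hom[OF F_category[OF Hom_obj(2)[OF C f]] functor_obj[OF left_functor[OF f]]] HomD[OF f]
        elements_pushed[OF f, of S]
      by (simp only: elements_over) (simp add: elements_simps(7))
  next
    assume "omap (prj E) x = B"
    then have "A' = B" using x xS elements_prj(1)[OF x] by simp
    then show "pull E f x \<in> hom_over E f (pulled E f x) x"
      using xS f counit_Hom[OF f] functor_obj[OF right_functor[OF f]] elements_pulled[OF f, of S]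
      by (simp only: elements_over) (simp add: elements_simps(8))
  }
next
  fix f g A B D x y a
  assume f: "f \<in> Hom C A B" and g: "g \<in> Hom C B D" and a: "a \<in> hom_over E (Cmp C f g) x y"
  obtain A' S D' T where xy: "x = (A', S)" "y = (D', T)" by (cases x; cases y)
  from a xy obtain \<alpha> where \<alpha>: "a = (S, Cmp C f g, \<alpha>)" "Cmp C f g \<in> Hom C A' D'" "S \<in> Obj (omap F A')"
    "\<alpha> \<in> Hom (omap F D') (omap (left (amap F (Cmp C f g))) S) T"
    by (auto simp: elements_over)
  have AD: "A' = A" "D' = D" using \<alpha>(2) cmp_Hom[OF C f g] by (auto simp: Hom_def)
  have S: "S \<in> Obj (omap F A)" using \<alpha>(3) AD by simp
  have \<alpha>': "\<alpha> \<in> Hom (omap F D) (omap (left (amap F g)) (omap (left (amap F f)) S)) T"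
    using \<alpha>(4) AD left_cmp(1)[OF f g S] by simp
  note FD = F_category[OF Hom_obj(2)[OF C g]]
  note LS = functor_obj[OF left_functor[OF f] S]
  {
    have "Cmp (Tot E) (push E f x) (omap (left (amap F f)) S, g, \<beta>) = (S, Cmp C f g, \<beta>)"
      if "\<beta> \<in> Hom (omap F D) (omap (left (amap F g)) (omap (left (amap F f)) S)) T" for \<beta>
      using xy that elements_cmp[OF g] functor_ide[OF left_functor[OF g] LS] ide_cmp[OF FD that] HomD[OF f]
      by (simp add: elements_simps(7))
    then show "\<exists>!\<beta>. \<beta> \<in> hom_over E g (pushed E f x) y \<and> Cmp (Tot E) (push E f x) \<beta> = a"
      using \<alpha> \<alpha>' xy g LS unfolding xy AD elements_pushed[OF f S] elements_over by auto
  next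
    have T: "T \<in> Obj (omap F D)" using Hom_obj(2)[OF FD \<alpha>'] .
    have g': "lower (amap F g) = omap F B" "upper (amap F g) = omap F D" "is_adjunction (amap F g)"
      using adj[OF g] by auto
    have "\<exists>!b. b \<in> Hom (omap F B) (omap (left (amap F f)) S) (omap (right (amap F g)) T) \<and>
        Cmp (omap F D) (amap (left (amap F g)) b) (counit (amap F g) T) = \<alpha>"
      using adjunction_transpose_ex1[OF g'(3), of "omap (left (amap F f)) S" T \<alpha>] LS T \<alpha>' g' by simp
    then obtain b where b: "b \<in> Hom (omap F B) (omap (left (amap F f)) S) (omap (right (amap F g)) T)"
        "Cmp (omap F D) (amap (left (amap F g)) b) (counit (amap F g) T) = \<alpha>"
      and b_unique: "\<And>c. c \<in> Hom (omap F B) (omap (left (amap F f)) S) (omap (right (amap F g)) T) \<Longrightarrow>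
        Cmp (omap F D) (amap (left (amap F g)) c) (counit (amap F g) T) = \<alpha> \<Longrightarrow> c = b"
      by blast
    show "\<exists>!\<beta>. \<beta> \<in> hom_over E f x (pulled E g y) \<and> Cmp (Tot E) \<beta> (pull E g y) = a"
    proof (rule ex1I[of _ "(S, f, b)"])
      show "(S, f, b) \<in> hom_over E f x (pulled E g y) \<and> Cmp (Tot E) (S, f, b) (pull E g y) = a"
        using b f S \<alpha>(1) unfolding xy AD elements_pulled[OF g] elements_over
        unfolding elements_simps(8) elements_cmp[OF g]
        by simp
      fix c assume "c \<in> hom_over E f x (pulled E g y) \<and> Cmp (Tot E) c (pull E g y) = a"
      then show "c = (S, f, b)"
        using b_unique \<alpha>(1) unfolding xy AD elements_pulled[OF g] elements_over
        unfolding elements_simps(8)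
        by (auto simp: elements_cmp[OF g])
    qed
  }
qed

end


section \<open>The adjunction between \<open>\<Delta>\<close> and \<open>\<Delta>\<^sub>\<bottom>\<close>\<close>

text \<open>Underlying maps of the arrows of \<open>\<Delta>\<close> and \<open>\<Delta>\<^sub>\<bottom>\<close>.\<close>

definition mono_maps :: "nat \<Rightarrow> nat \<Rightarrow> (nat \<Rightarrow> nat) set" where
  "mono_maps m n = {\<phi> \<in> {..<m} \<rightarrow>\<^sub>E {..<n}. mono_on {..<m} \<phi>}"

definition bot_maps :: "nat \<Rightarrow> nat \<Rightarrow> (nat \<Rightarrow> nat) set" where
  "bot_maps m n = {\<phi> \<in> mono_maps m n. 0 < m \<and> 0 < n \<and> \<phi> 0 = 0}"

lemma mono_mapsI:
  assumes "\<And>i. i < m \<Longrightarrow> \<phi> i < n" "\<And>i. m \<le> i \<Longrightarrow> \<phi> i = undefined"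
    and "\<And>i j. i \<le> j \<Longrightarrow> j < m \<Longrightarrow> \<phi> i \<le> \<phi> j"
  shows "\<phi> \<in> mono_maps m n"
  using assms by (auto simp: mono_maps_def PiE_def extensional_def intro!: mono_onI)

lemma mono_mapsD:
  assumes "\<phi> \<in> mono_maps m n"
  shows "i < m \<Longrightarrow> \<phi> i < n" "m \<le> i \<Longrightarrow> \<phi> i = undefined" "i \<le> j \<Longrightarrow> j < m \<Longrightarrow> \<phi> i \<le> \<phi> j"
  using assms by (auto simp: mono_maps_def PiE_def extensional_def mono_on_def)

lemma mono_maps_eqI:
  assumes "\<phi> \<in> mono_maps m n" "\<psi> \<in> mono_maps m n'" "\<And>i. i < m \<Longrightarrow> \<phi> i = \<psi> i"
  shows "\<phi> = \<psi>"
  using mono_mapsD(2)[OF assms(1)] mono_mapsD(2)[OF assms(2)] assms(3) by (metis ext not_le)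

lemma Hom_Delta: "u \<in> Hom Delta m n \<longleftrightarrow> (\<exists>\<phi> \<in> mono_maps m n. u = (m, n, \<phi>))"
  by (cases u) (auto simp: Hom_def Delta_def mono_maps_def)

lemma Hom_Delta_bot: "u \<in> Hom Delta_bot m n \<longleftrightarrow> (\<exists>\<phi> \<in> bot_maps m n. u = (m, n, \<phi>))"
  by (cases u) (auto simp: Hom_def Delta_bot_def Delta_def mono_maps_def bot_maps_def)

lemma Delta_simps:
  "Obj Delta = UNIV" "Obj Delta_bot = {n. 0 < n}"
  "Dom Delta (m, n, \<phi>) = m" "Cod Delta (m, n, \<phi>) = n"
  "Dom Delta_bot (m, n, \<phi>) = m" "Cod Delta_bot (m, n, \<phi>) = n"
  "Ide Delta n = (n, n, \<lambda>i \<in> {..<n}. i)" "Ide Delta_bot n = (n, n, \<lambda>i \<in> {..<n}. i)"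
  "Cmp Delta (m, n, \<phi>) (n', k, \<psi>) = (m, k, \<lambda>i \<in> {..<m}. \<psi> (\<phi> i))"
  "Cmp Delta_bot (m, n, \<phi>) (n', k, \<psi>) = (m, k, \<lambda>i \<in> {..<m}. \<psi> (\<phi> i))"
  by (simp_all add: Delta_def Delta_bot_def)

lemma Arr_Delta:
  "(m, n, \<phi>) \<in> Arr Delta \<longleftrightarrow> \<phi> \<in> mono_maps m n"
  "(m, n, \<phi>) \<in> Arr Delta_bot \<longleftrightarrow> \<phi> \<in> bot_maps m n"
  by (auto simp: Delta_def Delta_bot_def mono_maps_def bot_maps_def)

lemma mono_maps_comp:
  "\<phi> \<in> mono_maps m n \<Longrightarrow> \<psi> \<in> mono_maps n k \<Longrightarrow> (\<lambda>i \<in> {..<m}. \<psi> (\<phi> i)) \<in> mono_maps m k"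
  using mono_mapsD[of \<phi> m n] mono_mapsD[of \<psi> n k] by (intro mono_mapsI) auto

lemma mono_maps_id: "(\<lambda>i \<in> {..<n}. i) \<in> mono_maps n n"
  by (rule mono_mapsI) auto

lemma bot_maps_comp:
  "\<phi> \<in> bot_maps m n \<Longrightarrow> \<psi> \<in> bot_maps n k \<Longrightarrow> (\<lambda>i \<in> {..<m}. \<psi> (\<phi> i)) \<in> bot_maps m k"
  using mono_maps_comp by (auto simp: bot_maps_def)

lemma bot_maps_mono: "\<phi> \<in> bot_maps m n \<Longrightarrow> \<phi> \<in> mono_maps m n"
  by (simp add: bot_maps_def)

lemma mono_maps_unit_assoc:
  assumes "\<phi> \<in> mono_maps m n"
  shows "(\<lambda>i \<in> {..<m}. \<phi> ((\<lambda>i \<in> {..<m}. i) i)) = \<phi>" "(\<lambda>i \<in> {..<m}. (\<lambda>i \<in> {..<n}. i) (\<phi> i)) = \<phi>"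
    and "(\<lambda>i \<in> {..<m}. \<chi> ((\<lambda>i \<in> {..<m}. \<psi> (\<phi> i)) i)) = (\<lambda>i \<in> {..<m}. (\<lambda>i \<in> {..<n}. \<chi> (\<psi> i)) (\<phi> i))"
  using mono_mapsD(1,2)[OF assms] by (auto simp: fun_eq_iff restrict_def)

lemma category_Delta: "is_category Delta"
proof (rule is_categoryI)
  fix f g h A B D E
  assume "f \<in> Hom Delta A B"
  then obtain \<phi> where f: "f = (A, B, \<phi>)" "\<phi> \<in> mono_maps A B" by (auto simp: Hom_Delta)
  then show "Cmp Delta (Ide Delta A) f = f" "Cmp Delta f (Ide Delta B) = f"
    by (simp_all only: Delta_simps mono_maps_unit_assoc(1,2)[OF f(2)])
  assume "g \<in> Hom Delta B D"
  then obtain \<psi> where g: "g = (B, D, \<psi>)" "\<psi> \<in> mono_maps B D" by (auto simp: Hom_Delta)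
  then show "Cmp Delta f g \<in> Hom Delta A D"
    using f mono_maps_comp by (auto simp: Hom_Delta Delta_simps)
  assume "h \<in> Hom Delta D E"
  then obtain \<chi> where h: "h = (D, E, \<chi>)" by (auto simp: Hom_Delta)
  show "Cmp Delta (Cmp Delta f g) h = Cmp Delta f (Cmp Delta g h)"
    by (simp only: f(1) g(1) h Delta_simps mono_maps_unit_assoc(3)[OF f(2)])
qed (auto simp: Hom_Delta Delta_simps mono_maps_id)

lemma category_Delta_bot: "is_category Delta_bot"
proof (rule is_categoryI)
  fix f g h A B D E
  assume "f \<in> Hom Delta_bot A B"
  then obtain \<phi> where f: "f = (A, B, \<phi>)" "\<phi> \<in> bot_maps A B" by (auto simp: Hom_Delta_bot)
  note f' = bot_maps_mono[OF f(2)]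
  show "Cmp Delta_bot (Ide Delta_bot A) f = f" "Cmp Delta_bot f (Ide Delta_bot B) = f"
    by (simp_all only: f(1) Delta_simps mono_maps_unit_assoc(1,2)[OF f'])
  assume "g \<in> Hom Delta_bot B D"
  then obtain \<psi> where g: "g = (B, D, \<psi>)" "\<psi> \<in> bot_maps B D" by (auto simp: Hom_Delta_bot)
  then show "Cmp Delta_bot f g \<in> Hom Delta_bot A D"
    using f bot_maps_comp by (auto simp: Hom_Delta_bot Delta_simps)
  assume "h \<in> Hom Delta_bot D E"
  then obtain \<chi> where h: "h = (D, E, \<chi>)" by (auto simp: Hom_Delta_bot)
  show "Cmp Delta_bot (Cmp Delta_bot f g) h = Cmp Delta_bot f (Cmp Delta_bot g h)"
    by (simp only: f(1) g(1) h Delta_simps mono_maps_unit_assoc(3)[OF f'])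
next
  show "Dom Delta_bot f \<in> Obj Delta_bot" "Cod Delta_bot f \<in> Obj Delta_bot" if "f \<in> Arr Delta_bot" for f
    using that by (cases f; simp add: Arr_Delta Delta_simps bot_maps_def)+
qed (auto simp: Hom_Delta_bot Delta_simps bot_maps_def mono_maps_id)

text \<open>The map underlying \<open>L \<phi>\<close> for \<open>\<phi>\<close> with domain \<open>m\<close>.\<close>

definition add_bot :: "nat \<Rightarrow> (nat \<Rightarrow> nat) \<Rightarrow> nat \<Rightarrow> nat" where
  "add_bot m \<phi> = (\<lambda>i \<in> {..<Suc m}. case i of 0 \<Rightarrow> 0 | Suc j \<Rightarrow> Suc (\<phi> j))"

lemma add_bot_simps [simp]: "add_bot m \<phi> 0 = 0" "j < m \<Longrightarrow> add_bot m \<phi> (Suc j) = Suc (\<phi> j)"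
  by (simp_all add: add_bot_def)

lemma add_bot_maps:
  assumes "\<phi> \<in> mono_maps m n" shows "add_bot m \<phi> \<in> bot_maps (Suc m) (Suc n)"
proof -
  have "add_bot m \<phi> \<in> mono_maps (Suc m) (Suc n)"
    using mono_mapsD[OF assms]
    by (intro mono_mapsI) (auto simp: add_bot_def split: nat.split)
  then show ?thesis by (simp add: bot_maps_def)
qed

lemma add_bot_comp:
  assumes "\<phi> \<in> mono_maps m n"
  shows "add_bot m (\<lambda>i \<in> {..<m}. \<psi> (\<phi> i)) = (\<lambda>i \<in> {..<Suc m}. add_bot n \<psi> (add_bot m \<phi> i))"
  using mono_mapsD(1)[OF assms] by (auto simp: add_bot_def fun_eq_iff split: nat.split)

lemma add_bot_id: "add_bot m (\<lambda>i \<in> {..<m}. i) = (\<lambda>i \<in> {..<Suc m}. i)"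
  by (auto simp: add_bot_def fun_eq_iff split: nat.split)

lemma LR_left_simps:
  "omap LR_left n = Suc n"
  "\<phi> \<in> mono_maps m n \<Longrightarrow> amap LR_left (m, n, \<phi>) = (Suc m, Suc n, add_bot m \<phi>)"
  by (simp_all add: LR_left_def Arr_Delta add_bot_def)

lemma LR_right_simps:
  "0 < n \<Longrightarrow> omap LR_right n = n"
  "\<phi> \<in> bot_maps m n \<Longrightarrow> amap LR_right (m, n, \<phi>) = (m, n, \<phi>)"
  by (simp_all add: LR_right_def Arr_Delta Delta_simps)

text \<open>The maps underlying the counit \<open>n + 1 \<rightarrow> n\<close> and the unit \<open>n \<rightarrow> n + 1\<close> of the adjunction.\<close>

definition merge :: "nat \<Rightarrow> nat \<Rightarrow> nat" where
  "merge n = (\<lambda>i \<in> {..<Suc n}. i - 1)"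

definition shift :: "nat \<Rightarrow> nat \<Rightarrow> nat" where
  "shift n = (\<lambda>i \<in> {..<n}. Suc i)"

lemma merge_maps: "0 < n \<Longrightarrow> merge n \<in> bot_maps (Suc n) n"
  using mono_mapsI[of "Suc n" "merge n" n] by (auto simp: merge_def bot_maps_def)

lemma shift_maps: "shift n \<in> mono_maps n (Suc n)"
  by (rule mono_mapsI) (auto simp: shift_def)

lemma functor_LR_left: "is_functor Delta Delta_bot LR_left"
proof (rule is_functorI[OF category_Delta category_Delta_bot])
  show "amap LR_left f \<in> Hom Delta_bot (omap LR_left A) (omap LR_left B)" if "f \<in> Hom Delta A B" for f A B
    using that add_bot_maps by (auto simp: Hom_Delta Hom_Delta_bot LR_left_simps)
  show "amap LR_left (Ide Delta A) = Ide Delta_bot (omap LR_left A)" for A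
    by (simp add: Delta_simps LR_left_simps mono_maps_id add_bot_id)
  show "amap LR_left (Cmp Delta f g) = Cmp Delta_bot (amap LR_left f) (amap LR_left g)"
    if "f \<in> Hom Delta A B" "g \<in> Hom Delta B D" for f g A B D
    using that by (auto simp: Hom_Delta Delta_simps LR_left_simps mono_maps_comp add_bot_comp)
qed (auto simp: LR_left_def Delta_simps)

lemma functor_LR_right: "is_functor Delta_bot Delta LR_right"
proof (rule is_functorI[OF category_Delta_bot category_Delta])
  show "amap LR_right f \<in> Hom Delta (omap LR_right A) (omap LR_right B)" if f: "f \<in> Hom Delta_bot A B" for f A B
  proof -
    obtain \<phi> where "f = (A, B, \<phi>)" "\<phi> \<in> bot_maps A B" using f by (auto simp: Hom_Delta_bot)
    moreover from this have "\<phi> \<in> mono_maps A B" "0 < A" "0 < B" by (simp_all add: bot_maps_def)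
    ultimately show ?thesis by (simp add: Hom_Delta LR_right_simps)
  qed
  show "amap LR_right (Ide Delta_bot A) = Ide Delta (omap LR_right A)" if "A \<in> Obj Delta_bot" for A
    using that by (simp add: Delta_simps LR_right_simps mono_maps_id bot_maps_def)
  show "amap LR_right (Cmp Delta_bot f g) = Cmp Delta (amap LR_right f) (amap LR_right g)"
    if "f \<in> Hom Delta_bot A B" "g \<in> Hom Delta_bot B D" for f g A B D
    using that by (auto simp: Hom_Delta_bot Delta_simps LR_right_simps bot_maps_comp)
qed (auto simp: LR_right_def Delta_simps)

lemma LR_adjn_simps:
  "lower LR_adjn = Delta" "upper LR_adjn = Delta_bot" "left LR_adjn = LR_left" "right LR_adjn = LR_right"
  "unit LR_adjn n = (n, Suc n, shift n)" "0 < n \<Longrightarrow> counit LR_adjn n = (Suc n, n, merge n)"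
  "counit LR_adjn \<in> extensional {n. 0 < n}"
  by (simp_all add: LR_adjn_def shift_def merge_def Delta_simps)

lemma adjunction_LR: "is_adjunction LR_adjn"
  unfolding is_adjunction_def is_nat_trans_def LR_adjn_simps(1-4)
proof (intro conjI ballI)
  show "unit LR_adjn S \<in> Hom Delta (omap (id_functor Delta) S) (omap (comp_functor Delta LR_left LR_right) S)" for S
    using shift_maps by (simp add: Delta_simps LR_left_simps LR_right_simps LR_adjn_simps Hom_Delta)
  show "Cmp Delta (amap (id_functor Delta) f) (unit LR_adjn (Cod Delta f)) =
         Cmp Delta (unit LR_adjn (Dom Delta f)) (amap (comp_functor Delta LR_left LR_right) f)"
    if f: "f \<in> Arr Delta" for f
  proof -
    obtain m n \<phi> where \<phi>: "f = (m, n, \<phi>)" "\<phi> \<in> mono_maps m n"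
      using f by (cases f) (simp add: Arr_Delta)
    then show ?thesis
      using f mono_mapsD(1)[OF \<phi>(2)]
      by (auto simp: LR_left_simps LR_right_simps LR_adjn_simps Delta_simps add_bot_maps shift_def fun_eq_iff)
  qed
  show "counit LR_adjn S \<in> Hom Delta_bot (omap (comp_functor Delta_bot LR_right LR_left) S) (omap (id_functor Delta_bot) S)"
    if "S \<in> Obj Delta_bot" for S
    using that merge_maps by (simp add: Delta_simps LR_left_simps LR_right_simps LR_adjn_simps Hom_Delta_bot)
  show "Cmp Delta_bot (amap (comp_functor Delta_bot LR_right LR_left) f) (counit LR_adjn (Cod Delta_bot f)) =
         Cmp Delta_bot (counit LR_adjn (Dom Delta_bot f)) (amap (id_functor Delta_bot) f)"
    if f: "f \<in> Arr Delta_bot" for f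
  proof -
    obtain m n \<phi> where \<phi>: "f = (m, n, \<phi>)" "\<phi> \<in> bot_maps m n"
      using f by (cases f) (simp add: Arr_Delta)
    note \<phi>' = bot_maps_mono[OF \<phi>(2)]
    have "merge n (add_bot m \<phi> i) = \<phi> (merge m i)" if "i < Suc m" for i
      using that \<phi>(2) mono_mapsD(1)[OF \<phi>', of "i - 1"]
      by (cases i) (auto simp: merge_def bot_maps_def)
    then show ?thesis
      using f \<phi> \<phi>'
      by (auto simp: LR_left_simps LR_right_simps LR_adjn_simps Delta_simps bot_maps_def[of m n] fun_eq_iff)
  qed
  show "Cmp Delta_bot (amap LR_left (unit LR_adjn S)) (counit LR_adjn (omap LR_left S)) =
         Ide Delta_bot (omap LR_left S)" for S
    using shift_maps
    by (auto simp: LR_left_simps LR_adjn_simps Delta_simps fun_eq_iff merge_def add_bot_def shift_def split: nat.split)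
  show "Cmp Delta (unit LR_adjn (omap LR_right T)) (amap LR_right (counit LR_adjn T)) =
         Ide Delta (omap LR_right T)" if "T \<in> Obj Delta_bot" for T
    using that merge_maps
    by (auto simp: LR_right_simps LR_adjn_simps Delta_simps fun_eq_iff merge_def shift_def)
  show "is_functor Delta Delta (id_functor Delta)" "is_functor Delta_bot Delta_bot (id_functor Delta_bot)"
    using id_functor category_Delta category_Delta_bot by auto
  show "is_functor Delta Delta (comp_functor Delta LR_left LR_right)"
    "is_functor Delta_bot Delta_bot (comp_functor Delta_bot LR_right LR_left)"
    by (rule comp_functor[OF functor_LR_left functor_LR_right] comp_functor[OF functor_LR_right functor_LR_left])+
qed (use functor_LR_left functor_LR_right in \<open>auto simp: Delta_simps LR_adjn_simps\<close>)


section \<open>The bifibration of elements over \<open>2\<close>\<close>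

lemma Two_simps [simp]:
  "Obj Two = {0, 1}" "Arr Two = {(0, 0), (0, 1), (1, 1)}" "Dom Two f = fst f" "Cod Two f = snd f"
  "Ide Two i = (i, i)" "Cmp Two f g = (fst f, snd g)"
  by (simp_all add: Two_def)

lemma category_Two: "is_category Two"
  by (rule is_categoryI) (auto simp: Hom_def)

lemma Hom_Two: "f \<in> Hom Two A B \<longleftrightarrow> f = (A, B) \<and> (A, B) \<in> {(0, 0), (0, 1), (1, 1)}"
  by (auto simp: Hom_def)

lemma F_two_simps:
  "omap F_two 0 = Delta" "omap F_two 1 = Delta_bot"
  "amap F_two (0, 0) = id_adjn Delta" "amap F_two (0, 1) = LR_adjn" "amap F_two (1, 1) = id_adjn Delta_bot"
  by (simp_all add: F_two_def)

interpretation El: indexed_adjunctions Two F_two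
proof
  show "is_adjunction (amap F_two f) \<and> lower (amap F_two f) = omap F_two A \<and> upper (amap F_two f) = omap F_two B"
    if "f \<in> Hom Two A B" for f A B
    using that id_adjunction[OF category_Delta] id_adjunction[OF category_Delta_bot] adjunction_LR
    unfolding Hom_Two by (elim conjE insertE) (auto simp only: F_two_simps LR_adjn_simps id_adjn_def prod.inject adjn.simps empty_iff)
  show "amap F_two (Ide Two A) = id_adjn (omap F_two A)" if "A \<in> Obj Two" for A
    using that by (auto simp only: Two_simps insert_iff empty_iff F_two_simps)
  have *: "comp_adjn H K = H" if "K = id_adjn (upper H)" "is_adjunction H" for H K :: "(nat, ord_arr) adjn"
    using comp_id_adjn(1) that by simp
  have **: "comp_adjn K H = H" if "K = id_adjn (lower H)" "is_adjunction H" for H K :: "(nat, ord_arr) adjn"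
    using comp_id_adjn(2) that by simp
  have "comp_adjn (id_adjn Delta) (id_adjn Delta) = id_adjn Delta"
    "comp_adjn (id_adjn Delta_bot) (id_adjn Delta_bot) = id_adjn Delta_bot"
    by (rule *, simp_all add: id_adjn_def id_adjunction[OF category_Delta, unfolded id_adjn_def]
        id_adjunction[OF category_Delta_bot, unfolded id_adjn_def])+
  moreover have "comp_adjn (id_adjn Delta) LR_adjn = LR_adjn" "comp_adjn LR_adjn (id_adjn Delta_bot) = LR_adjn"
    by (simp_all add: * ** LR_adjn_simps adjunction_LR)
  ultimately have comps: "comp_adjn (amap F_two (0, 0)) (amap F_two (0, 0)) = amap F_two (0, 0)"
    "comp_adjn (amap F_two (1, 1)) (amap F_two (1, 1)) = amap F_two (1, 1)"
    "comp_adjn (amap F_two (0, 0)) (amap F_two (0, 1)) = amap F_two (0, 1)"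
    "comp_adjn (amap F_two (0, 1)) (amap F_two (1, 1)) = amap F_two (0, 1)"
    unfolding F_two_simps by auto
  show "amap F_two (Cmp Two f g) = comp_adjn (amap F_two f) (amap F_two g)"
    if "f \<in> Hom Two A B" "g \<in> Hom Two B D" for f g A B D
  proof -
    have "f = (0, 0) \<and> g = (0, 0) \<or> f = (1, 1) \<and> g = (1, 1) \<or> f = (0, 0) \<and> g = (0, 1) \<or> f = (0, 1) \<and> g = (1, 1)"
      using that by (auto simp: Hom_Two)
    then show ?thesis
      by (elim disjE conjE) (simp_all only: Two_simps fst_conv snd_conv comps)
  qed
qed (rule category_Two)

abbreviation El :: "(nat \<times> nat, nat \<times> (nat \<times> nat) \<times> ord_arr, nat, nat \<times> nat) bifib" where
  "El \<equiv> elements Two F_two"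

lemma El_Obj: "Obj (Tot El) = {(0, n) | n. True} \<union> {(1, n) | n. 0 < n}"
  using F_two_simps by (auto simp: El.elements_simps Delta_simps)

lemma El_over:
  "a \<in> hom_over El (0, 0) (0, m) (0, n) \<longleftrightarrow> (\<exists>\<phi> \<in> mono_maps m n. a = (m, (0, 0), (m, n, \<phi>)))"
  "a \<in> hom_over El (1, 1) (1, m) (1, n) \<longleftrightarrow> (\<exists>\<phi> \<in> bot_maps m n. a = (m, (1, 1), (m, n, \<phi>)))"
  "a \<in> hom_over El (0, 1) (0, m) (1, n) \<longleftrightarrow> (\<exists>\<phi> \<in> bot_maps (Suc m) n. a = (m, (0, 1), (Suc m, n, \<phi>)))"
  unfolding El.elements_over F_two_simps
  by (auto simp: Hom_Two Delta_simps id_adjn_def Hom_Delta Hom_Delta_bot bot_maps_def LR_adjn_simps LR_left_simps)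

lemma El_cmp:
  "\<phi> \<in> mono_maps m n \<Longrightarrow> Cmp (Tot El) (m, (0, 0), (m, n, \<phi>)) (n, (0, 0), (n, k, \<psi>)) =
    (m, (0, 0), (m, k, \<lambda>i \<in> {..<m}. \<psi> (\<phi> i)))"
  "\<phi> \<in> bot_maps m n \<Longrightarrow> Cmp (Tot El) (m, (1, 1), (m, n, \<phi>)) (n, (1, 1), (n, k, \<psi>)) =
    (m, (1, 1), (m, k, \<lambda>i \<in> {..<m}. \<psi> (\<phi> i)))"
  "\<phi> \<in> bot_maps (Suc m) n \<Longrightarrow> Cmp (Tot El) (m, (0, 1), (Suc m, n, \<phi>)) (n, (1, 1), (n, k, \<psi>)) =
    (m, (0, 1), (Suc m, k, \<lambda>i \<in> {..<Suc m}. \<psi> (\<phi> i)))"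
  "\<phi> \<in> mono_maps m n \<Longrightarrow> Cmp (Tot El) (m, (0, 0), (m, n, \<phi>)) (n, (0, 1), (Suc n, k, \<psi>)) =
    (m, (0, 1), (Suc m, k, \<lambda>i \<in> {..<Suc m}. \<psi> (add_bot m \<phi> i)))"
  unfolding El.elements_simps Two_simps fst_conv snd_conv F_two_simps
  by (simp_all add: id_adjn_def Arr_Delta Delta_simps LR_adjn_simps LR_left_simps)

lemma El_ide:
  "Ide (Tot El) (0, n) = (n, (0, 0), (n, n, \<lambda>i \<in> {..<n}. i))"
  "Ide (Tot El) (1, n) = (n, (1, 1), (n, n, \<lambda>i \<in> {..<n}. i))"
  unfolding El.elements_simps F_two_simps by (simp_all add: Delta_simps)

lemma El_lifts:
  "push El (0, 1) (0, n) = (n, (0, 1), (Suc n, Suc n, \<lambda>i \<in> {..<Suc n}. i))"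
  "0 < n \<Longrightarrow> pull El (0, 1) (1, n) = (n, (0, 1), (Suc n, n, merge n))"
  "pushed El (0, 1) (0, n) = (1, Suc n)" "0 < n \<Longrightarrow> pulled El (0, 1) (1, n) = (0, n)"
  "push El (0, 0) (0, n) = Ide (Tot El) (0, n)" "pull El (0, 0) (0, n) = Ide (Tot El) (0, n)"
  "0 < n \<Longrightarrow> push El (1, 1) (1, n) = Ide (Tot El) (1, n)" "0 < n \<Longrightarrow> pull El (1, 1) (1, n) = Ide (Tot El) (1, n)"
  unfolding El.elements_simps Two_simps fst_conv snd_conv F_two_simps
  by (simp_all add: LR_adjn_simps LR_left_simps LR_right_simps Delta_simps id_adjn_def)

lemma countable_El: "countable (Obj (Tot El))" "countable (Arr (Tot El))"
proof -
  show "countable (Obj (Tot El))" by (rule countableI_type)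
  have "Arr (Tot El) \<subseteq> (\<Union>m. \<Union>n. UNIV \<times> UNIV \<times> {m} \<times> {n} \<times> ({..<m} \<rightarrow>\<^sub>E {..<n}))"
  proof
    fix a assume a: "a \<in> Arr (Tot El)"
    obtain S f m n \<phi> where a': "a = (S, f, (m, n, \<phi>))" by (metis surj_pair)
    have "f \<in> Arr Two" "(m, n, \<phi>) \<in> Arr (omap F_two (Cod Two f))"
      using a unfolding a' El.elements_simps by auto
    then have "(m, n, \<phi>) \<in> Arr Delta \<or> (m, n, \<phi>) \<in> Arr Delta_bot"
      using F_two_simps by auto
    then have "\<phi> \<in> mono_maps m n" using bot_maps_mono by (auto simp: Arr_Delta)
    then show "a \<in> (\<Union>m. \<Union>n. UNIV \<times> UNIV \<times> {m} \<times> {n} \<times> ({..<m} \<rightarrow>\<^sub>E {..<n}))"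
      by (auto simp: a' mono_maps_def)
  qed
  moreover have "countable ({..<m} \<rightarrow>\<^sub>E {..<n} :: (nat \<Rightarrow> nat) set)" for m n
    by (intro countable_finite finite_PiE) auto
  ultimately show "countable (Arr (Tot El))"
    by (elim countable_subset) (intro countable_UN countable_SIGMA; simp)
qed

(* Keeps the object 1 of the category 2 in the form used by the equations about it. *)
declare One_nat_def [simp del]

lemma El_ide_lifts:
  assumes "e \<in> Obj (Tot El)" "omap (prj El) e = A"
  shows "push El (A, A) e = Ide (Tot El) e" "pull El (A, A) e = Ide (Tot El) e"
    "pushed El (A, A) e = e" "pulled El (A, A) e = e"
proof -
  have "fst e = A" using assms El.elements_prj(1) by simp
  then show "push El (A, A) e = Ide (Tot El) e" "pull El (A, A) e = Ide (Tot El) e"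
    using assms(1) by (auto simp: El_Obj El_lifts)
  then show "pushed El (A, A) e = e" "pulled El (A, A) e = e"
    using HomD[OF ide_Hom[OF El.elements_category assms(1)]] by auto
qed

lemma El_Hom_cases:
  assumes "e \<in> Hom (Tot El) x y"
  obtains (zero) m n \<phi> where "x = (0, m)" "y = (0, n)" "\<phi> \<in> mono_maps m n" "e = (m, (0, 0), (m, n, \<phi>))"
  | (one) m n \<phi> where "x = (1, m)" "y = (1, n)" "\<phi> \<in> bot_maps m n" "e = (m, (1, 1), (m, n, \<phi>))"
  | (across) m n \<phi> where "x = (0, m)" "y = (1, n)" "\<phi> \<in> bot_maps (Suc m) n" "e = (m, (0, 1), (Suc m, n, \<phi>))"
proof -
  have e: "e \<in> hom_over El (amap (prj El) e) x y" using assms by (rule hom_overI) simp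
  have xy: "x \<in> Obj (Tot El)" "y \<in> Obj (Tot El)" "amap (prj El) e \<in> Hom Two (fst x) (fst y)"
    using hom_over_obj[OF El.elements_bifibration e] El.elements_prj(1) by auto
  then have "(fst x, fst y) \<in> {(0, 0), (0, 1), (1, 1)}" "amap (prj El) e = (fst x, fst y)"
    by (auto simp: Hom_Two)
  then show thesis
    using e zero one across El_over[of e "snd x" "snd y"] by (cases x; cases y) auto
qed


section \<open>Bifibrations over \<open>2\<close>\<close>

text \<open>A bifibration over \<open>2\<close> is essentially a pair of categories, its fibers \<open>V0\<close> and \<open>V1\<close>, and an adjunction
  between them: \<open>L\<close> and \<open>R\<close> push and pull along the non-identity arrow \<open>(0, 1)\<close>, with chosen
  liftings \<open>P S : S \<rightarrow> L S\<close> and \<open>V T : R T \<rightarrow> T\<close>.\<close>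

locale bifibration_over_two =
  fixes Q :: "('o, 'a, nat, nat \<times> nat) bifib"
  assumes Q: "is_bifibration Two Q"
begin

abbreviation cmp (infixl "\<cdot>" 70) where "f \<cdot> g \<equiv> Cmp (Tot Q) f g"
abbreviation ide where "ide X \<equiv> Ide (Tot Q) X"

definition Ob0 :: "'o set" where "Ob0 = {X \<in> Obj (Tot Q). omap (prj Q) X = 0}"
definition Ob1 :: "'o set" where "Ob1 = {X \<in> Obj (Tot Q). omap (prj Q) X = 1}"

abbreviation V0 :: "'o \<Rightarrow> 'o \<Rightarrow> 'a set" where "V0 \<equiv> hom_over Q (0, 0)"
abbreviation V1 :: "'o \<Rightarrow> 'o \<Rightarrow> 'a set" where "V1 \<equiv> hom_over Q (1, 1)"
abbreviation V01 :: "'o \<Rightarrow> 'o \<Rightarrow> 'a set" where "V01 \<equiv> hom_over Q (0, 1)"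

abbreviation P :: "'o \<Rightarrow> 'a" where "P \<equiv> push Q (0, 1)"
abbreviation V :: "'o \<Rightarrow> 'a" where "V \<equiv> pull Q (0, 1)"
abbreviation L :: "'o \<Rightarrow> 'o" where "L \<equiv> pushed Q (0, 1)"
abbreviation R :: "'o \<Rightarrow> 'o" where "R \<equiv> pulled Q (0, 1)"

lemma QC: "is_category (Tot Q)" by (rule bif_cat(1)[OF Q])

lemma assoc: "f \<in> Hom (Tot Q) X Y \<Longrightarrow> g \<in> Hom (Tot Q) Y Z \<Longrightarrow> h \<in> Hom (Tot Q) Z W \<Longrightarrow>
    (f \<cdot> g) \<cdot> h = f \<cdot> (g \<cdot> h)"
  by (rule cmp_assoc[OF QC])

lemma over_Hom: "f \<in> hom_over Q g X Y \<Longrightarrow> f \<in> Hom (Tot Q) X Y"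
  by (rule hom_overD(1))

lemma ide_l: "f \<in> hom_over Q g X Y \<Longrightarrow> ide X \<cdot> f = f"
  using ide_cmp[OF QC] hom_overD(1) by metis

lemma ide_r: "f \<in> hom_over Q g X Y \<Longrightarrow> f \<cdot> ide Y = f"
  using cmp_ide[OF QC] hom_overD(1) by metis

lemma V_obj:
  "f \<in> V0 X Y \<Longrightarrow> X \<in> Ob0" "f \<in> V0 X Y \<Longrightarrow> Y \<in> Ob0"
  "f \<in> V1 X Y \<Longrightarrow> X \<in> Ob1" "f \<in> V1 X Y \<Longrightarrow> Y \<in> Ob1"
  "f \<in> V01 X Y \<Longrightarrow> X \<in> Ob0" "f \<in> V01 X Y \<Longrightarrow> Y \<in> Ob1"
  using hom_over_obj[OF Q, of f _ X Y] by (auto simp: Ob0_def Ob1_def Hom_Two)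

lemma V_cmp:
  "f \<in> V0 X Y \<Longrightarrow> g \<in> V0 Y Z \<Longrightarrow> f \<cdot> g \<in> V0 X Z"
  "f \<in> V1 X Y \<Longrightarrow> g \<in> V1 Y Z \<Longrightarrow> f \<cdot> g \<in> V1 X Z"
  "f \<in> V0 X Y \<Longrightarrow> h \<in> V01 Y Z \<Longrightarrow> f \<cdot> h \<in> V01 X Z"
  "h \<in> V01 X Y \<Longrightarrow> g \<in> V1 Y Z \<Longrightarrow> h \<cdot> g \<in> V01 X Z"
  using hom_over_cmp[OF Q, of _ _ X Y _ _ Z] by fastforce+

lemma V_ide: "X \<in> Ob0 \<Longrightarrow> ide X \<in> V0 X X" "X \<in> Ob1 \<Longrightarrow> ide X \<in> V1 X X"
  using hom_over_ide[OF Q, of X] by (auto simp: Ob0_def Ob1_def)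

lemma P: "S \<in> Ob0 \<Longrightarrow> P S \<in> V01 S (L S)"
  and L: "S \<in> Ob0 \<Longrightarrow> L S \<in> Ob1"
  using push_over[OF Q, of "(0, 1)" 0 1 S] by (auto simp: Ob0_def Ob1_def Hom_Two)

lemma V: "T \<in> Ob1 \<Longrightarrow> V T \<in> V01 (R T) T"
  and R: "T \<in> Ob1 \<Longrightarrow> R T \<in> Ob0"
  using pull_over[OF Q, of "(0, 1)" 0 1 T] by (auto simp: Ob0_def Ob1_def Hom_Two)

lemma P_factor: "h \<in> V01 S T \<Longrightarrow> \<exists>!b. b \<in> V1 (L S) T \<and> P S \<cdot> b = h"
  using push_factor[OF Q, of "(0, 1)" 0 1 "(1, 1)" 1 S h T] V_obj(5)[of h S T]
  by (simp add: Hom_Two Ob0_def)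

lemma V_factor: "h \<in> V01 S T \<Longrightarrow> \<exists>!b. b \<in> V0 S (R T) \<and> b \<cdot> V T = h"
  using pull_factor[OF Q, of "(0, 0)" 0 0 "(0, 1)" 1 T h S] V_obj(6)[of h S T]
  by (simp add: Hom_Two Ob1_def)

lemma P_cancel:
  assumes S: "S \<in> Ob0" and b: "b \<in> V1 (L S) T" "b' \<in> V1 (L S) T" "P S \<cdot> b = P S \<cdot> b'"
  shows "b = b'"
  using P_factor[OF V_cmp(4)[OF P[OF S] b(1)]] b by metis

lemma V_cancel:
  assumes T: "T \<in> Ob1" and b: "b \<in> V0 S (R T)" "b' \<in> V0 S (R T)" "b \<cdot> V T = b' \<cdot> V T"
  shows "b = b'"
  using V_factor[OF V_cmp(3)[OF b(1) V[OF T]]] b by metis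

text \<open>The action of \<open>L\<close> and \<open>R\<close> on vertical arrows, and the unit \<open>un\<close> and the counit \<open>co\<close> of the
  adjunction with left adjoint \<open>L\<close> and right adjoint \<open>R\<close>, all obtained by factoring through liftings.\<close>

definition Lm :: "'a \<Rightarrow> 'a" where
  "Lm \<alpha> = (let S = Dom (Tot Q) \<alpha>; S' = Cod (Tot Q) \<alpha> in THE b. b \<in> V1 (L S) (L S') \<and> P S \<cdot> b = \<alpha> \<cdot> P S')"

definition Rm :: "'a \<Rightarrow> 'a" where
  "Rm \<beta> = (let T = Dom (Tot Q) \<beta>; T' = Cod (Tot Q) \<beta> in THE b. b \<in> V0 (R T) (R T') \<and> b \<cdot> V T' = V T \<cdot> \<beta>)"

definition un :: "'o \<Rightarrow> 'a" where
  "un S = (THE b. b \<in> V0 S (R (L S)) \<and> b \<cdot> V (L S) = P S)"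

definition co :: "'o \<Rightarrow> 'a" where
  "co T = (THE b. b \<in> V1 (L (R T)) T \<and> P (R T) \<cdot> b = V T)"

lemma Lm:
  assumes a: "\<alpha> \<in> V0 S S'" shows "Lm \<alpha> \<in> V1 (L S) (L S')" "P S \<cdot> Lm \<alpha> = \<alpha> \<cdot> P S'"
proof -
  have "Lm \<alpha> \<in> V1 (L S) (L S') \<and> P S \<cdot> Lm \<alpha> = \<alpha> \<cdot> P S'"
    using theI'[OF P_factor[OF V_cmp(3)[OF a P[OF V_obj(2)[OF a]]]]] HomD[OF over_Hom[OF a]]
    by (simp add: Lm_def)
  then show "Lm \<alpha> \<in> V1 (L S) (L S')" "P S \<cdot> Lm \<alpha> = \<alpha> \<cdot> P S'" by auto
qed

lemma Rm:
  assumes b: "\<beta> \<in> V1 T T'" shows "Rm \<beta> \<in> V0 (R T) (R T')" "Rm \<beta> \<cdot> V T' = V T \<cdot> \<beta>"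
proof -
  have "Rm \<beta> \<in> V0 (R T) (R T') \<and> Rm \<beta> \<cdot> V T' = V T \<cdot> \<beta>"
    using theI'[OF V_factor[OF V_cmp(4)[OF V[OF V_obj(3)[OF b]] b]]] HomD[OF over_Hom[OF b]]
    by (simp add: Rm_def)
  then show "Rm \<beta> \<in> V0 (R T) (R T')" "Rm \<beta> \<cdot> V T' = V T \<cdot> \<beta>" by auto
qed

lemma un:
  assumes S: "S \<in> Ob0" shows "un S \<in> V0 S (R (L S))" "un S \<cdot> V (L S) = P S"
  using theI'[OF V_factor[OF P[OF S]]] by (auto simp: un_def)

lemma co:
  assumes T: "T \<in> Ob1" shows "co T \<in> V1 (L (R T)) T" "P (R T) \<cdot> co T = V T"
  using theI'[OF P_factor[OF V[OF T]]] by (auto simp: co_def)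

lemma Lm_eqI: "\<alpha> \<in> V0 S S' \<Longrightarrow> b \<in> V1 (L S) (L S') \<Longrightarrow> P S \<cdot> b = \<alpha> \<cdot> P S' \<Longrightarrow> Lm \<alpha> = b"
  using P_cancel[OF V_obj(1)] Lm by metis

lemma Rm_eqI: "\<beta> \<in> V1 T T' \<Longrightarrow> b \<in> V0 (R T) (R T') \<Longrightarrow> b \<cdot> V T' = V T \<cdot> \<beta> \<Longrightarrow> Rm \<beta> = b"
  using V_cancel[OF V_obj(4)] Rm by metis

lemma Lm_ide: "S \<in> Ob0 \<Longrightarrow> Lm (ide S) = ide (L S)"
  by (rule Lm_eqI[OF V_ide(1) V_ide(2)[OF L]]) (simp_all add: ide_l[OF P] ide_r[OF P])

lemma Rm_ide: "T \<in> Ob1 \<Longrightarrow> Rm (ide T) = ide (R T)"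
  by (rule Rm_eqI[OF V_ide(2) V_ide(1)[OF R]]) (simp_all add: ide_l[OF V] ide_r[OF V])

lemma Lm_cmp:
  assumes a: "\<alpha> \<in> V0 S S'" and b: "\<beta> \<in> V0 S' S''"
  shows "Lm (\<alpha> \<cdot> \<beta>) = Lm \<alpha> \<cdot> Lm \<beta>"
proof (rule Lm_eqI[OF V_cmp(1)[OF a b] V_cmp(2)[OF Lm(1)[OF a] Lm(1)[OF b]]])
  note PS = P[OF V_obj(1)[OF a]] and PS' = P[OF V_obj(1)[OF b]] and PS'' = P[OF V_obj(2)[OF b]]
  have "P S \<cdot> (Lm \<alpha> \<cdot> Lm \<beta>) = \<alpha> \<cdot> P S' \<cdot> Lm \<beta>"
    using assoc[OF over_Hom[OF PS] over_Hom[OF Lm(1)[OF a]] over_Hom[OF Lm(1)[OF b]]] Lm(2)[OF a] by simp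
  also have "\<dots> = \<alpha> \<cdot> \<beta> \<cdot> P S''"
    using assoc[OF over_Hom[OF a] over_Hom[OF PS'] over_Hom[OF Lm(1)[OF b]]] Lm(2)[OF b]
      assoc[OF over_Hom[OF a] over_Hom[OF b] over_Hom[OF PS'']] by simp
  finally show "P S \<cdot> (Lm \<alpha> \<cdot> Lm \<beta>) = \<alpha> \<cdot> \<beta> \<cdot> P S''" .
qed

lemma Rm_cmp:
  assumes a: "\<alpha> \<in> V1 T T'" and b: "\<beta> \<in> V1 T' T''"
  shows "Rm (\<alpha> \<cdot> \<beta>) = Rm \<alpha> \<cdot> Rm \<beta>"
proof (rule Rm_eqI[OF V_cmp(2)[OF a b] V_cmp(1)[OF Rm(1)[OF a] Rm(1)[OF b]]])
  note VT = V[OF V_obj(3)[OF a]] and VT' = V[OF V_obj(3)[OF b]] and VT'' = V[OF V_obj(4)[OF b]]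
  have "Rm \<alpha> \<cdot> Rm \<beta> \<cdot> V T'' = Rm \<alpha> \<cdot> V T' \<cdot> \<beta>"
    using assoc[OF over_Hom[OF Rm(1)[OF a]] over_Hom[OF Rm(1)[OF b]] over_Hom[OF VT'']] Rm(2)[OF b]
      assoc[OF over_Hom[OF Rm(1)[OF a]] over_Hom[OF VT'] over_Hom[OF b]] by simp
  also have "\<dots> = V T \<cdot> (\<alpha> \<cdot> \<beta>)"
    using Rm(2)[OF a] assoc[OF over_Hom[OF VT] over_Hom[OF a] over_Hom[OF b]] by simp
  finally show "Rm \<alpha> \<cdot> Rm \<beta> \<cdot> V T'' = V T \<cdot> (\<alpha> \<cdot> \<beta>)" .
qed

lemma un_natural:
  assumes a: "\<alpha> \<in> V0 S S'" shows "\<alpha> \<cdot> un S' = un S \<cdot> Rm (Lm \<alpha>)"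
proof -
  note S = V_obj(1)[OF a] and S' = V_obj(2)[OF a]
  note uS = un(1)[OF S] and uS' = un(1)[OF S'] and RLa = Rm(1)[OF Lm(1)[OF a]]
  have "\<alpha> \<cdot> un S' \<cdot> V (L S') = \<alpha> \<cdot> P S'"
    using assoc[OF over_Hom[OF a] over_Hom[OF uS'] over_Hom[OF V[OF L[OF S']]]] un(2)[OF S'] by simp
  also have "\<dots> = un S \<cdot> V (L S) \<cdot> Lm \<alpha>"
    using Lm(2)[OF a] un(2)[OF S] by simp
  also have "\<dots> = un S \<cdot> Rm (Lm \<alpha>) \<cdot> V (L S')"
    using assoc[OF over_Hom[OF uS] over_Hom[OF V[OF L[OF S]]] over_Hom[OF Lm(1)[OF a]]] Rm(2)[OF Lm(1)[OF a]]
      assoc[OF over_Hom[OF uS] over_Hom[OF RLa] over_Hom[OF V[OF L[OF S']]]] by simp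
  finally show ?thesis
    by (rule V_cancel[OF L[OF S'] V_cmp(1)[OF a uS'] V_cmp(1)[OF uS RLa]])
qed

lemma co_natural:
  assumes b: "\<beta> \<in> V1 T T'" shows "Lm (Rm \<beta>) \<cdot> co T' = co T \<cdot> \<beta>"
proof -
  note T = V_obj(3)[OF b] and T' = V_obj(4)[OF b]
  note cT = co(1)[OF T] and cT' = co(1)[OF T'] and LRb = Lm(1)[OF Rm(1)[OF b]]
  note PR = P[OF R[OF T]] and PR' = P[OF R[OF T']]
  have "P (R T) \<cdot> (Lm (Rm \<beta>) \<cdot> co T') = Rm \<beta> \<cdot> V T'"
    using assoc[OF over_Hom[OF PR] over_Hom[OF LRb] over_Hom[OF cT']] Lm(2)[OF Rm(1)[OF b]]
      assoc[OF over_Hom[OF Rm(1)[OF b]] over_Hom[OF PR'] over_Hom[OF cT']] co(2)[OF T'] by simp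
  also have "\<dots> = P (R T) \<cdot> (co T \<cdot> \<beta>)"
    using Rm(2)[OF b] co(2)[OF T] assoc[OF over_Hom[OF PR] over_Hom[OF cT] over_Hom[OF b]] by simp
  finally show ?thesis
    by (rule P_cancel[OF R[OF T] V_cmp(2)[OF LRb cT'] V_cmp(2)[OF cT b]])
qed

lemma triangle_R:
  assumes T: "T \<in> Ob1" shows "un (R T) \<cdot> Rm (co T) = ide (R T)"
proof -
  note u = un(1)[OF R[OF T]] and c = co(1)[OF T] and Rc = Rm(1)[OF co(1)[OF T]]
  have "un (R T) \<cdot> Rm (co T) \<cdot> V T = un (R T) \<cdot> V (L (R T)) \<cdot> co T"
    using assoc[OF over_Hom[OF u] over_Hom[OF Rc] over_Hom[OF V[OF T]]] Rm(2)[OF c]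
      assoc[OF over_Hom[OF u] over_Hom[OF V[OF L[OF R[OF T]]]] over_Hom[OF c]] by simp
  also have "\<dots> = ide (R T) \<cdot> V T"
    using un(2)[OF R[OF T]] co(2)[OF T] ide_l[OF V[OF T]] by simp
  finally show ?thesis
    by (rule V_cancel[OF T V_cmp(1)[OF u Rc] V_ide(1)[OF R[OF T]]])
qed

lemma triangle_L:
  assumes S: "S \<in> Ob0" shows "Lm (un S) \<cdot> co (L S) = ide (L S)"
proof -
  note u = un(1)[OF S] and c = co(1)[OF L[OF S]] and Lu = Lm(1)[OF un(1)[OF S]]
  have "P S \<cdot> (Lm (un S) \<cdot> co (L S)) = un S \<cdot> (P (R (L S)) \<cdot> co (L S))"
    using assoc[OF over_Hom[OF P[OF S]] over_Hom[OF Lu] over_Hom[OF c]] Lm(2)[OF u]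
      assoc[OF over_Hom[OF u] over_Hom[OF P[OF R[OF L[OF S]]]] over_Hom[OF c]] by simp
  also have "\<dots> = P S \<cdot> ide (L S)"
    using un(2)[OF S] co(2)[OF L[OF S]] ide_r[OF P[OF S]] by simp
  finally show ?thesis
    by (rule P_cancel[OF S V_cmp(2)[OF Lu c] V_ide(2)[OF L[OF S]]])
qed

lemma V_vert_iso:
  "vert_iso Two Q X Y i i' \<Longrightarrow> X \<in> Ob0 \<Longrightarrow> i \<in> V0 X Y \<and> i' \<in> V0 Y X \<and> i \<cdot> i' = ide X \<and> i' \<cdot> i = ide Y"
  "vert_iso Two Q X Y i i' \<Longrightarrow> X \<in> Ob1 \<Longrightarrow> i \<in> V1 X Y \<and> i' \<in> V1 Y X \<and> i \<cdot> i' = ide X \<and> i' \<cdot> i = ide Y"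
  using vert_isoD[OF Q, of X Y i i'] by (auto simp: Ob0_def Ob1_def)

lemma vert_isoI0:
  assumes "i \<in> V0 X Y" "i' \<in> V0 Y X" "i \<cdot> i' = ide X" "i' \<cdot> i = ide Y"
  shows "vert_iso Two Q X Y i i'"
  using assms V_obj(1)[OF assms(1)]
  by (intro vert_isoI[of _ _ _ _ _ _ 0]) (auto simp: iso_pair_def hom_overD(1) Ob0_def)

lemma vert_isoI1:
  assumes "i \<in> V1 X Y" "i' \<in> V1 Y X" "i \<cdot> i' = ide X" "i' \<cdot> i = ide Y"
  shows "vert_iso Two Q X Y i i'"
  using assms V_obj(3)[OF assms(1)]
  by (intro vert_isoI[of _ _ _ _ _ _ 1]) (auto simp: iso_pair_def hom_overD(1) Ob1_def)

lemma vert_iso_Lm: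
  assumes i: "vert_iso Two Q X Y i i'" and X: "X \<in> Ob0"
  shows "vert_iso Two Q (L X) (L Y) (Lm i) (Lm i')"
proof -
  note I = V_vert_iso(1)[OF i X]
  then have "Y \<in> Ob0" using V_obj by blast
  then show ?thesis
    using I X Lm_cmp[of i X Y i' X] Lm_cmp[of i' Y X i Y] by (intro vert_isoI1) (simp_all add: Lm(1) Lm_ide)
qed

lemma vert_iso_Rm:
  assumes i: "vert_iso Two Q X Y i i'" and X: "X \<in> Ob1"
  shows "vert_iso Two Q (R X) (R Y) (Rm i) (Rm i')"
proof -
  note I = V_vert_iso(2)[OF i X]
  then have "Y \<in> Ob1" using V_obj by blast
  then show ?thesis
    using I X Rm_cmp[of i X Y i' X] Rm_cmp[of i' Y X i Y] by (intro vert_isoI0) (simp_all add: Rm(1) Rm_ide)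
qed

text \<open>The chosen liftings along an identity need not be identities, but they are isomorphisms.\<close>

lemma push_ide_vert_iso:
  assumes X: "X \<in> Obj (Tot Q)" and A: "omap (prj Q) X = A"
  shows "\<exists>k. vert_iso Two Q X (pushed Q (A, A) X) (push Q (A, A) X) k"
    "\<exists>k. vert_iso Two Q (pulled Q (A, A) X) X (pull Q (A, A) X) k"
proof -
  have AA: "(A, A) \<in> Hom Two A A"
    using functor_obj[OF bif_functor[OF Q] X] A by (auto simp: Hom_Two)
  have i: "ide X \<in> hom_over Q (Cmp Two (A, A) (A, A)) X X"
    using hom_over_ide[OF Q X] A by simp
  have VC: "f \<cdot> g \<in> hom_over Q (A, A) Y W"
    if "f \<in> hom_over Q (A, A) Y Z" "g \<in> hom_over Q (A, A) Z W" for f g Y Z W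
    using hom_over_cmp[OF Q that] by simp
  {
    note p = push_over[OF Q AA X A]
    obtain k where k: "k \<in> hom_over Q (A, A) (pushed Q (A, A) X) X" "push Q (A, A) X \<cdot> k = ide X"
      using push_factor[OF Q AA AA A i] by blast
    have "push Q (A, A) X \<cdot> (k \<cdot> push Q (A, A) X) = push Q (A, A) X"
      using assoc[OF over_Hom[OF p(1)] over_Hom[OF k(1)] over_Hom[OF p(1)]] k(2) ide_l[OF p(1)] by simp
    moreover have "push Q (A, A) X \<cdot> ide (pushed Q (A, A) X) = push Q (A, A) X" by (rule ide_r[OF p(1)])
    moreover have "ide (pushed Q (A, A) X) \<in> hom_over Q (A, A) (pushed Q (A, A) X) (pushed Q (A, A) X)"
      using hom_over_ide[OF Q p(2)] p(3) by simp
    ultimately have "k \<cdot> push Q (A, A) X = ide (pushed Q (A, A) X)"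
      using push_factor[OF Q AA AA A, of "push Q (A, A) X" "pushed Q (A, A) X"] p(1) VC[OF k(1) p(1)] by auto
    then show "\<exists>k. vert_iso Two Q X (pushed Q (A, A) X) (push Q (A, A) X) k"
      using k p(1) A by (intro exI[of _ k] vert_isoI[of _ _ _ _ _ _ A]) (auto simp: iso_pair_def over_Hom)
  next
    note p = pull_over[OF Q AA X A]
    obtain k where k: "k \<in> hom_over Q (A, A) X (pulled Q (A, A) X)" "k \<cdot> pull Q (A, A) X = ide X"
      using pull_factor[OF Q AA AA A i] by blast
    have "(pull Q (A, A) X \<cdot> k) \<cdot> pull Q (A, A) X = pull Q (A, A) X"
      using assoc[OF over_Hom[OF p(1)] over_Hom[OF k(1)] over_Hom[OF p(1)]] k(2) ide_r[OF p(1)] by simp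
    moreover have "ide (pulled Q (A, A) X) \<cdot> pull Q (A, A) X = pull Q (A, A) X" by (rule ide_l[OF p(1)])
    moreover have "ide (pulled Q (A, A) X) \<in> hom_over Q (A, A) (pulled Q (A, A) X) (pulled Q (A, A) X)"
      using hom_over_ide[OF Q p(2)] p(3) by simp
    ultimately have "pull Q (A, A) X \<cdot> k = ide (pulled Q (A, A) X)"
      using pull_factor[OF Q AA AA A, of "pull Q (A, A) X" "pulled Q (A, A) X"] p(1) VC[OF p(1) k(1)] by auto
    then show "\<exists>k. vert_iso Two Q (pulled Q (A, A) X) X (pull Q (A, A) X) k"
      using k p A by (intro exI[of _ k] vert_isoI[of _ _ _ _ _ _ A]) (auto simp: iso_pair_def over_Hom)
  }
qed

end


section \<open>Normal forms\<close>

text \<open>In a bifibration over \<open>2\<close> with a distinguished object \<open>a\<close> over \<open>0\<close>, let \<open>s n\<close> be the result of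
  applying \<open>R \<circ> L\<close> to \<open>a\<close> \<open>n\<close> times, and \<open>t (n + 1) = L (s n)\<close>; the object \<open>t 0\<close> plays no role. These
  correspond to the ordinals in \<open>\<Delta>\<close> and \<open>\<Delta>\<^sub>\<bottom>\<close>.\<close>

locale pointed_bifibration_over_two = bifibration_over_two Q
  for Q :: "('o, 'a, nat, nat \<times> nat) bifib" +
  fixes a :: 'o
  assumes a: "a \<in> Ob0"
begin

primrec s :: "nat \<Rightarrow> 'o" where
  "s 0 = a"
| "s (Suc n) = R (L (s n))"

definition t :: "nat \<Rightarrow> 'o" where
  "t n = L (s (n - 1))"

lemma t_Suc [simp]: "t (Suc n) = L (s n)" by (simp add: t_def)

lemma s_Ob0 [simp]: "s n \<in> Ob0"
  by (induction n) (simp_all add: a L R)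

lemma t_Ob1 [simp]: "t n \<in> Ob1" by (simp add: t_def L)

lemma R_t: "0 < n \<Longrightarrow> R (t n) = s n" by (cases n) simp_all

text \<open>Arrows \<open>s m \<rightarrow> s n\<close> (\<open>nf0\<close>) and \<open>t m \<rightarrow> t n\<close> (\<open>nf1\<close>) built by applying \<open>R\<close> and \<open>L\<close>, postcomposing
  with the unit and precomposing with the counit. Each monotone map is built in exactly one way by
  the corresponding rules: \<open>nf_R\<close> forgets that it preserves \<open>0\<close>, \<open>nf_un\<close> adds a new \<open>0\<close> to the codomain
  only, \<open>nf_L\<close> adds a new \<open>0\<close> on both sides, and \<open>nf_co\<close> doubles the \<open>0\<close> of the domain.\<close>

inductive nf0 :: "nat \<Rightarrow> nat \<Rightarrow> 'a \<Rightarrow> bool" and nf1 :: "nat \<Rightarrow> nat \<Rightarrow> 'a \<Rightarrow> bool" where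
  nf_id: "nf0 0 0 (ide a)"
| nf_R: "nf1 m n \<beta> \<Longrightarrow> nf0 m n (Rm \<beta>)"
| nf_un: "nf0 m n \<alpha> \<Longrightarrow> nf0 m (Suc n) (\<alpha> \<cdot> un (s n))"
| nf_L: "nf0 m n \<alpha> \<Longrightarrow> nf1 (Suc m) (Suc n) (Lm \<alpha>)"
| nf_co: "nf1 m n \<beta> \<Longrightarrow> nf1 (Suc m) n (co (t m) \<cdot> \<beta>)"

lemma nf_over:
  "nf0 m n \<alpha> \<Longrightarrow> \<alpha> \<in> V0 (s m) (s n)"
  "nf1 m n \<beta> \<Longrightarrow> 0 < m \<and> 0 < n \<and> \<beta> \<in> V1 (t m) (t n)"
proof (induction rule: nf0_nf1.inducts)
  case nf_id
  then show ?case using V_ide(1)[OF a] by simp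
next
  case (nf_R m n \<beta>)
  then show ?case using Rm(1)[of \<beta> "t m" "t n"] by (simp add: R_t)
next
  case (nf_un m n \<alpha>)
  then show ?case using V_cmp(1)[OF nf_un(2) un(1)[OF s_Ob0]] by simp
next
  case (nf_L m n \<alpha>)
  then show ?case using Lm(1)[OF nf_L(2)] by simp
next
  case (nf_co m n \<beta>)
  then have "\<beta> \<in> V1 (t m) (t n)" "L (s m) = L (R (t m))" by (simp_all add: R_t)
  then show ?case using V_cmp(2)[OF co(1)[OF t_Ob1]] nf_co by simp
qed

lemma nf_ide: "nf0 n n (ide (s n))" "nf1 (Suc n) (Suc n) (ide (t (Suc n)))"
proof (induction n)
  case 0
  show "nf0 0 0 (ide (s 0))" using nf_id by simp
  then show "nf1 (Suc 0) (Suc 0) (ide (t (Suc 0)))" using nf_L[of 0 0 "ide (s 0)"] Lm_ide[OF a] by simp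
next
  case (Suc n)
  then show "nf0 (Suc n) (Suc n) (ide (s (Suc n)))"
    using nf_R[OF Suc(2)] Rm_ide[OF t_Ob1[of "Suc n"]] by simp
  then show "nf1 (Suc (Suc n)) (Suc (Suc n)) (ide (t (Suc (Suc n))))"
    using nf_L[of "Suc n" "Suc n" "ide (s (Suc n))"] Lm_ide[OF s_Ob0, of "Suc n"] by simp
qed

text \<open>Closure under composition is a form of cut elimination: two factors built by the same functor are
  composed under it, and a unit meeting a counit cancels by a triangle identity. Every
  recursive step lowers \<open>m + n + k\<close>, except that two factors built by \<open>nf_R\<close> are replaced by their
  premises with the same indices; this is why composites in \<open>nf0\<close> count for one more.\<close>

lemma nf_cmp_aux:
  "(\<forall>m n k \<alpha> \<beta>. N = 2 * (m + n + k) + 1 \<longrightarrow> nf0 m n \<alpha> \<longrightarrow> nf0 n k \<beta> \<longrightarrow> nf0 m k (\<alpha> \<cdot> \<beta>)) \<and>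
   (\<forall>m n k \<alpha> \<beta>. N = 2 * (m + n + k) \<longrightarrow> nf1 m n \<alpha> \<longrightarrow> nf1 n k \<beta> \<longrightarrow> nf1 m k (\<alpha> \<cdot> \<beta>))"
proof (induction N rule: less_induct)
  case (less N)
  have IH0: "nf0 m k (\<alpha> \<cdot> \<beta>)" if "2 * (m + n + k) + 1 < N" "nf0 m n \<alpha>" "nf0 n k \<beta>" for m n k \<alpha> \<beta>
    using less[OF that(1)] that(2,3) by blast
  have IH1: "nf1 m k (\<alpha> \<cdot> \<beta>)" if "2 * (m + n + k) < N" "nf1 m n \<alpha>" "nf1 n k \<beta>" for m n k \<alpha> \<beta>
    using less[OF that(1)] that(2,3) by blast
  show ?case
  proof (intro conjI allI impI)
    fix m n k \<alpha> \<beta>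
    assume N: "N = 2 * (m + n + k) + 1" and \<alpha>: "nf0 m n \<alpha>" and \<beta>: "nf0 n k \<beta>"
    note \<alpha>V = nf_over(1)[OF \<alpha>] and \<beta>V = nf_over(1)[OF \<beta>]
    show "nf0 m k (\<alpha> \<cdot> \<beta>)"
      using \<beta>
    proof (cases rule: nf0.cases)
      case nf_id
      then show ?thesis using \<alpha> ide_r[OF \<alpha>V] by simp
    next
      case (nf_un k' \<beta>')
      then have "nf0 m k' (\<alpha> \<cdot> \<beta>')" using IH0[OF _ \<alpha> nf_un(3)] N nf_un(1) by simp
      moreover have "\<alpha> \<cdot> \<beta> = (\<alpha> \<cdot> \<beta>') \<cdot> un (s k')"
        using assoc[OF over_Hom[OF \<alpha>V] over_Hom[OF nf_over(1)[OF nf_un(3)]] over_Hom[OF un(1)[OF s_Ob0]]] nf_un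
        by simp
      ultimately show ?thesis using nf0_nf1.nf_un nf_un(1) by simp
    next
      case (nf_R \<beta>')
      note \<beta>' = nf_over(2)[OF nf_R(2)]
      show ?thesis
        using \<alpha>
      proof (cases rule: nf0.cases)
        case nf_id
        then show ?thesis using \<beta>' by simp
      next
        case (nf_R \<alpha>')
        note \<alpha>' = nf_over(2)[OF nf_R(2)]
        have "nf1 m k (\<alpha>' \<cdot> \<beta>')" using IH1[OF _ nf_R(2) \<open>nf1 n k \<beta>'\<close>] N by simp
        then show ?thesis
          using nf0_nf1.nf_R[of m k "\<alpha>' \<cdot> \<beta>'"] Rm_cmp[of \<alpha>' "t m" "t n" \<beta>' "t k"] \<alpha>' \<beta>' nf_R(1) \<open>\<beta> = Rm \<beta>'\<close> by simp
      next
        case (nf_un n' \<alpha>')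
        note n = nf_un(1) and \<alpha>'V = nf_over(1)[OF nf_un(3)]
        from \<open>nf1 n k \<beta>'\<close> show ?thesis
        proof (cases rule: nf1.cases)
          case (nf_L n'' k' \<gamma>)
          then have [simp]: "n'' = n'" using n by simp
          have \<gamma>: "nf0 n' k' \<gamma>" using nf_L by simp
          note \<gamma>V = nf_over(1)[OF \<gamma>]
          have "nf0 m k' (\<alpha>' \<cdot> \<gamma>)" using IH0[OF _ nf_un(3) \<gamma>] N nf_L(2) n by simp
          moreover have "\<alpha> \<cdot> \<beta> = (\<alpha>' \<cdot> \<gamma>) \<cdot> un (s k')"
            using assoc[OF over_Hom[OF \<alpha>'V] over_Hom[OF un(1)[OF s_Ob0]] over_Hom[OF Rm(1)[OF Lm(1)[OF \<gamma>V]]]]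
              assoc[OF over_Hom[OF \<alpha>'V] over_Hom[OF \<gamma>V] over_Hom[OF un(1)[OF s_Ob0]]]
              un_natural[OF \<gamma>V] nf_un(2) \<open>\<beta> = Rm \<beta>'\<close> nf_L(3) by simp
          ultimately show ?thesis using nf0_nf1.nf_un nf_L(2) by simp
        next
          case (nf_co n'' \<gamma>)
          then have [simp]: "n'' = n'" using n by simp
          have \<gamma>: "nf1 n' k \<gamma>" using nf_co by simp
          note \<gamma>V = nf_over(2)[OF \<gamma>]
          then have Rt: "R (t n') = s n'" and \<gamma>V1: "\<gamma> \<in> V1 (t n') (t k)" by (simp_all add: R_t)
          have u: "un (s n') \<in> V0 (s n') (R (L (s n')))" by (rule un(1)) simp
          have c: "co (t n') \<in> V1 (L (s n')) (t n')" using co(1)[of "t n'"] by (simp add: Rt)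
          have Rc: "Rm (co (t n')) \<in> V0 (R (L (s n'))) (s n')" using Rm(1)[OF c] by (simp add: Rt)
          have R\<gamma>: "Rm \<gamma> \<in> V0 (s n') (R (t k))" using Rm(1)[OF \<gamma>V1] by (simp add: Rt)
          \<comment> \<open>The unit at the end of the first factor meets the counit of the second one.\<close>
          have "un (s n') \<cdot> (Rm (co (t n')) \<cdot> Rm \<gamma>) = Rm \<gamma>"
            using assoc[OF over_Hom[OF u] over_Hom[OF Rc] over_Hom[OF R\<gamma>]] triangle_R[of "t n'"] ide_l[OF R\<gamma>]
            by (simp add: Rt)
          then have "\<alpha> \<cdot> \<beta> = \<alpha>' \<cdot> Rm \<gamma>"
            using assoc[OF over_Hom[OF \<alpha>'V] over_Hom[OF u] over_Hom[OF V_cmp(1)[OF Rc R\<gamma>]]] Rm_cmp[OF c \<gamma>V1]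
              nf_un(2) \<open>\<beta> = Rm \<beta>'\<close> nf_co(2) by simp
          moreover have "nf0 m k (\<alpha>' \<cdot> Rm \<gamma>)"
            using IH0[OF _ nf_un(3) nf0_nf1.nf_R[OF \<gamma>]] N n by simp
          ultimately show ?thesis by simp
        qed
      qed
    qed
  next
    fix m n k \<alpha> \<beta>
    assume N: "N = 2 * (m + n + k)" and \<alpha>: "nf1 m n \<alpha>" and \<beta>: "nf1 n k \<beta>"
    note \<alpha>V = nf_over(2)[OF \<alpha>] and \<beta>V = nf_over(2)[OF \<beta>]
    show "nf1 m k (\<alpha> \<cdot> \<beta>)"
      using \<alpha>
    proof (cases rule: nf1.cases)
      case (nf_co m' \<alpha>')
      note \<alpha>'V = nf_over(2)[OF nf_co(3)]
      have "nf1 m' k (\<alpha>' \<cdot> \<beta>)" using IH1[OF _ nf_co(3) \<beta>] N nf_co(1) by simp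
      moreover have "\<alpha> \<cdot> \<beta> = co (t m') \<cdot> (\<alpha>' \<cdot> \<beta>)"
        using assoc[OF over_Hom[OF co(1)[OF t_Ob1, of m']], of \<alpha>' "t n" \<beta> "t k"]
          over_Hom[OF conjunct2[OF conjunct2[OF \<alpha>'V]]] over_Hom[OF conjunct2[OF conjunct2[OF \<beta>V]]] nf_co(2)
        by simp
      ultimately show ?thesis using nf0_nf1.nf_co nf_co(1) by simp
    next
      case (nf_L m' n' \<alpha>')
      note n = nf_L(2) and \<alpha>'V = nf_over(1)[OF nf_L(4)]
      from \<beta> show ?thesis
      proof (cases rule: nf1.cases)
        case (nf_L n'' k' \<beta>')
        then have [simp]: "n'' = n'" using n by simp
        have \<beta>': "nf0 n' k' \<beta>'" using nf_L by simp
        have "nf0 m' k' (\<alpha>' \<cdot> \<beta>')" using IH0[OF _ \<open>nf0 m' n' \<alpha>'\<close> \<beta>'] N \<open>m = Suc m'\<close> n nf_L(2) by simp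
        moreover have "\<alpha> \<cdot> \<beta> = Lm (\<alpha>' \<cdot> \<beta>')"
          using Lm_cmp[OF \<alpha>'V nf_over(1)[OF \<beta>']] nf_L(3) \<open>\<alpha> = Lm \<alpha>'\<close> by simp
        ultimately show ?thesis using nf0_nf1.nf_L[of m' k' "\<alpha>' \<cdot> \<beta>'"] \<open>m = Suc m'\<close> nf_L(2) by simp
      next
        case (nf_co n'' \<beta>')
        then have [simp]: "n'' = n'" using n by simp
        have \<beta>': "nf1 n' k \<beta>'" using nf_co by simp
        then have n': "0 < n'" and \<beta>'V: "\<beta>' \<in> V1 (t n') (t k)" and Rt: "R (t n') = s n'"
          using nf_over(2)[OF \<beta>'] by (simp_all add: R_t)
        have c: "co (t n') \<in> V1 (L (s n')) (t n')" using co(1)[of "t n'"] by (simp add: Rt)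
        have \<beta>_eq: "\<beta> = co (t n') \<cdot> \<beta>'" using nf_co by simp
        from \<open>nf0 m' n' \<alpha>'\<close> show ?thesis
        proof (cases rule: nf0.cases)
          case nf_id
          then show ?thesis using n' by simp
        next
          case (nf_R \<gamma>)
          note \<gamma>V = nf_over(2)[OF nf_R(2)]
          then have \<gamma>V1: "\<gamma> \<in> V1 (t m') (t n')" and Rt': "R (t m') = s m'" by (simp_all add: R_t)
          have c': "co (t m') \<in> V1 (L (s m')) (t m')" using co(1)[of "t m'"] by (simp add: Rt')
          have "nf1 m' k (\<gamma> \<cdot> \<beta>')" using IH1[OF _ nf_R(2) \<beta>'] N \<open>m = Suc m'\<close> n by simp
          moreover have "\<alpha> \<cdot> \<beta> = co (t m') \<cdot> (\<gamma> \<cdot> \<beta>')"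
            using assoc[OF over_Hom[OF Lm(1)[OF \<alpha>'V]] over_Hom[OF c] over_Hom[OF \<beta>'V]]
              assoc[OF over_Hom[OF c'] over_Hom[OF \<gamma>V1] over_Hom[OF \<beta>'V]]
              co_natural[OF \<gamma>V1] nf_R(1) \<open>\<alpha> = Lm \<alpha>'\<close> \<beta>_eq by simp
          ultimately show ?thesis using nf0_nf1.nf_co \<open>m = Suc m'\<close> by simp
        next
          case (nf_un p \<gamma>)
          note \<gamma>V = nf_over(1)[OF nf_un(3)]
          have \<beta>'V': "\<beta>' \<in> V1 (L (s p)) (t k)" using \<beta>'V nf_un(1) by simp
          have u: "un (s p) \<in> V0 (s p) (R (L (s p)))" by (rule un(1)) simp
          have c'': "co (L (s p)) \<in> V1 (L (R (L (s p)))) (L (s p))" by (rule co(1)[OF L]) simp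
          have "nf1 (Suc m') (Suc p) (Lm \<gamma>)" using nf_un(3) by (rule nf0_nf1.nf_L)
          then have "nf1 m k (Lm \<gamma> \<cdot> \<beta>')"
            using IH1[of "Suc m'" "Suc p" k "Lm \<gamma>" \<beta>'] N \<open>m = Suc m'\<close> n nf_un(1) \<beta>' by simp
          moreover have "\<alpha> \<cdot> \<beta> = Lm \<gamma> \<cdot> \<beta>'"
          proof -
            \<comment> \<open>Again a unit meets a counit, here under \<open>L\<close>.\<close>
            have "\<alpha> \<cdot> \<beta> = Lm \<gamma> \<cdot> Lm (un (s p)) \<cdot> (co (L (s p)) \<cdot> \<beta>')"
              using Lm_cmp[OF \<gamma>V u] nf_un(1,2) \<open>\<alpha> = Lm \<alpha>'\<close> \<beta>_eq by simp
            also have "\<dots> = Lm \<gamma> \<cdot> (Lm (un (s p)) \<cdot> co (L (s p)) \<cdot> \<beta>')"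
              using assoc[OF over_Hom[OF Lm(1)[OF \<gamma>V]] over_Hom[OF Lm(1)[OF u]] over_Hom[OF V_cmp(2)[OF c'' \<beta>'V']]]
                assoc[OF over_Hom[OF Lm(1)[OF u]] over_Hom[OF c''] over_Hom[OF \<beta>'V']] by simp
            also have "\<dots> = Lm \<gamma> \<cdot> \<beta>'"
              using triangle_L[OF s_Ob0] ide_l[OF \<beta>'V'] by simp
            finally show ?thesis .
          qed
          ultimately show ?thesis by simp
        qed
      qed
    qed
  qed
qed

lemma nf_cmp:
  "nf0 m n \<alpha> \<Longrightarrow> nf0 n k \<beta> \<Longrightarrow> nf0 m k (\<alpha> \<cdot> \<beta>)"
  "nf1 m n \<alpha>' \<Longrightarrow> nf1 n k \<beta>' \<Longrightarrow> nf1 m k (\<alpha>' \<cdot> \<beta>')"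
  using nf_cmp_aux by blast+

end


section \<open>Comparison with the category of elements\<close>

text \<open>A morphism \<open>G\<close> to the category of elements that sends \<open>a\<close> to the empty ordinal.\<close>

locale comparison = pointed_bifibration_over_two Q a
  for Q :: "('o, 'a, nat, nat \<times> nat) bifib" and a :: 'o +
  fixes G :: "('o, 'a, nat \<times> nat, nat \<times> (nat \<times> nat) \<times> ord_arr) fctr"
  assumes G: "is_bifib_morphism Two Q El G" and Ga: "omap G a = (0, 0)"
begin

text \<open>The map of ordinals underlying the image of an arrow under \<open>G\<close>.\<close>

definition fn :: "'a \<Rightarrow> nat \<Rightarrow> nat" where
  "fn \<alpha> = snd (snd (snd (snd (amap G \<alpha>))))"

lemma GF: "is_functor (Tot Q) (Tot El) G" by (rule bifib_morphismD(3)[OF G])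

lemma G_L: "S \<in> Ob0 \<Longrightarrow> omap G (L S) = pushed El (0, 1) (omap G S)"
  and G_P: "S \<in> Ob0 \<Longrightarrow> amap G (P S) = push El (0, 1) (omap G S)"
  using bifib_morphism_push[OF G, of "(0, 1)" 0 1 S] by (auto simp: Hom_Two Ob0_def)

lemma G_R: "T \<in> Ob1 \<Longrightarrow> omap G (R T) = pulled El (0, 1) (omap G T)"
  and G_V: "T \<in> Ob1 \<Longrightarrow> amap G (V T) = pull El (0, 1) (omap G T)"
  using bifib_morphism_pull[OF G, of "(0, 1)" 0 1 T] by (auto simp: Hom_Two Ob1_def)

lemma G_s: "omap G (s n) = (0, n)"
  by (induction n) (simp_all add: Ga G_R[OF L] G_L El_lifts(3,4))

lemma G_t: "0 < n \<Longrightarrow> omap G (t n) = (1, n)"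
  by (cases n) (simp_all add: G_L G_s El_lifts(3))

lemma G_V0:
  assumes "\<alpha> \<in> V0 (s m) (s n)"
  shows "amap G \<alpha> = (m, (0, 0), (m, n, fn \<alpha>))" "fn \<alpha> \<in> mono_maps m n"
  using bifib_morphism_over[OF G assms] El_over(1) by (auto simp: G_s fn_def)

lemma G_V1:
  assumes "\<beta> \<in> V1 (t m) (t n)" "0 < m" "0 < n"
  shows "amap G \<beta> = (m, (1, 1), (m, n, fn \<beta>))" "fn \<beta> \<in> bot_maps m n"
  using bifib_morphism_over[OF G assms(1)] assms El_over(2) by (auto simp: G_t fn_def)

lemma fn_cmp0:
  assumes a: "\<alpha> \<in> V0 (s m) (s n)" and b: "\<beta> \<in> V0 (s n) (s k)"
  shows "fn (\<alpha> \<cdot> \<beta>) = (\<lambda>i \<in> {..<m}. fn \<beta> (fn \<alpha> i))"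
  using functor_cmp[OF GF over_Hom[OF a] over_Hom[OF b]] G_V0[OF a] G_V0[OF b] El_cmp(1)[OF G_V0(2)[OF a]]
  by (simp add: fn_def[of "\<alpha> \<cdot> \<beta>"])

lemma fn_cmp1:
  assumes a: "\<alpha> \<in> V1 (t m) (t n)" and b: "\<beta> \<in> V1 (t n) (t k)" and pos: "0 < m" "0 < n" "0 < k"
  shows "fn (\<alpha> \<cdot> \<beta>) = (\<lambda>i \<in> {..<m}. fn \<beta> (fn \<alpha> i))"
  using functor_cmp[OF GF over_Hom[OF a] over_Hom[OF b]] G_V1[OF a pos(1,2)] G_V1[OF b pos(2,3)]
    El_cmp(2)[OF G_V1(2)[OF a pos(1,2)]]
  by (simp add: fn_def[of "\<alpha> \<cdot> \<beta>"])

lemma fn_ide: "fn (ide (s n)) = (\<lambda>i \<in> {..<n}. i)" "0 < n \<Longrightarrow> fn (ide (t n)) = (\<lambda>i \<in> {..<n}. i)"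
  using functor_ide[OF GF, of "s n"] functor_ide[OF GF, of "t n"] s_Ob0[of n] t_Ob1[of n]
  by (simp_all add: fn_def G_s G_t El_ide Ob0_def Ob1_def del: s_Ob0 t_Ob1)

lemma fn_Lm:
  assumes a: "\<alpha> \<in> V0 (s m) (s n)" shows "fn (Lm \<alpha>) = add_bot m (fn \<alpha>)"
proof -
  have L: "Lm \<alpha> \<in> V1 (t (Suc m)) (t (Suc n))" using Lm(1)[OF a] by simp
  note g = G_V0[OF a] and l = G_V1[OF L]
  have "amap G (P (s m) \<cdot> Lm \<alpha>) = amap G (\<alpha> \<cdot> P (s n))" by (simp add: Lm(2)[OF a])
  then have "Cmp (Tot El) (push El (0, 1) (0, m)) (amap G (Lm \<alpha>)) = Cmp (Tot El) (amap G \<alpha>) (push El (0, 1) (0, n))"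
    using functor_cmp[OF GF over_Hom[OF P[of "s m"]] over_Hom[OF Lm(1)[OF a]]]
      functor_cmp[OF GF over_Hom[OF a] over_Hom[OF P]] by (simp add: G_P G_s)
  then have "(\<lambda>i \<in> {..<Suc m}. fn (Lm \<alpha>) ((\<lambda>i \<in> {..<Suc m}. i) i))
      = (\<lambda>i \<in> {..<Suc m}. (\<lambda>i \<in> {..<Suc n}. i) (add_bot m (fn \<alpha>) i))"
    unfolding l(1)[OF zero_less_Suc zero_less_Suc] g(1) El_lifts
    by (subst (asm) El_cmp(3), simp add: bot_maps_def mono_maps_id, subst (asm) El_cmp(4)[OF g(2)]) (simp only: prod.inject)
  then show ?thesis
    using mono_maps_unit_assoc(1)[OF bot_maps_mono[OF l(2)]]
      mono_maps_unit_assoc(2)[OF bot_maps_mono[OF add_bot_maps[OF g(2)]]] by (simp only: zero_less_Suc)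
qed

lemma fn_Rm:
  assumes b: "\<beta> \<in> V1 (t m) (t n)" and pos: "0 < m" "0 < n" shows "fn (Rm \<beta>) = fn \<beta>"
proof -
  have R: "Rm \<beta> \<in> V0 (s m) (s n)" using Rm(1)[OF b] by (simp add: R_t pos)
  note g = G_V1[OF b pos] and r = G_V0[OF R]
  have "amap G (Rm \<beta> \<cdot> V (t n)) = amap G (V (t m) \<cdot> \<beta>)" by (simp add: Rm(2)[OF b])
  then have "Cmp (Tot El) (amap G (Rm \<beta>)) (pull El (0, 1) (1, n)) = Cmp (Tot El) (pull El (0, 1) (1, m)) (amap G \<beta>)"
    using functor_cmp[OF GF over_Hom[OF V[of "t m"]] over_Hom[OF b]]
      functor_cmp[OF GF over_Hom[OF Rm(1)[OF b]] over_Hom[OF V]] by (simp add: G_V G_t pos)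
  then have eq: "(\<lambda>i \<in> {..<Suc m}. merge n (add_bot m (fn (Rm \<beta>)) i)) = (\<lambda>i \<in> {..<Suc m}. fn \<beta> (merge m i))"
    by (simp add: g(1) r(1) El_lifts pos El_cmp(4)[OF r(2)] El_cmp(3)[OF merge_maps])
  show ?thesis
  proof (rule mono_maps_eqI[OF r(2) bot_maps_mono[OF g(2)]])
    fix i assume i: "i < m"
    then show "fn (Rm \<beta>) i = fn \<beta> i"
      using fun_cong[OF eq, of "Suc i"] mono_mapsD(1)[OF r(2) i] by (simp add: merge_def)
  qed
qed

lemma fn_un: "fn (un (s n)) = shift n"
proof -
  have u: "un (s n) \<in> V0 (s n) (s (Suc n))" using un(1)[of "s n"] by simp
  note r = G_V0[OF u]
  have "amap G (un (s n) \<cdot> V (L (s n))) = amap G (P (s n))" by (simp add: un(2))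
  then have "Cmp (Tot El) (amap G (un (s n))) (pull El (0, 1) (1, Suc n)) = push El (0, 1) (0, n)"
    using functor_cmp[OF GF over_Hom[OF un(1)[of "s n"]] over_Hom[OF V[OF L]]] G_t[of "Suc n"]
    by (simp add: G_V[OF L] G_P G_s)
  then have eq: "(\<lambda>i \<in> {..<Suc n}. merge (Suc n) (add_bot n (fn (un (s n))) i)) = (\<lambda>i \<in> {..<Suc n}. i)"
    by (simp add: r(1) El_lifts El_cmp(4)[OF r(2)])
  show ?thesis
  proof (rule mono_maps_eqI[OF r(2) shift_maps])
    fix i assume i: "i < n"
    then show "fn (un (s n)) i = shift n i"
      using fun_cong[OF eq, of "Suc i"] mono_mapsD(1)[OF r(2) i] by (simp add: merge_def shift_def)
  qed
qed

lemma co_t: "0 < n \<Longrightarrow> co (t n) \<in> V1 (t (Suc n)) (t n)"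
  using co(1)[of "t n"] by (simp add: R_t)

lemma fn_co:
  assumes n: "0 < n" shows "fn (co (t n)) = merge n"
proof -
  note r = G_V1[OF co_t[OF n] zero_less_Suc n]
  have "amap G (P (s n) \<cdot> co (t n)) = amap G (V (t n))" using co(2)[of "t n"] by (simp add: R_t n)
  then have "Cmp (Tot El) (push El (0, 1) (0, n)) (amap G (co (t n))) = pull El (0, 1) (1, n)"
    using functor_cmp[OF GF over_Hom[OF P[of "s n"]] over_Hom, of "co (t n)" "(1, 1)" "t n"] co_t[OF n]
    by (simp add: G_V G_t n G_P G_s)
  then have "(\<lambda>i \<in> {..<Suc n}. fn (co (t n)) ((\<lambda>i \<in> {..<Suc n}. i) i)) = merge n"
    unfolding r(1) El_lifts(1) El_lifts(2)[OF n]
    by (subst (asm) El_cmp(3), simp add: bot_maps_def mono_maps_id) (simp only: prod.inject)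
  then show ?thesis
    using mono_maps_unit_assoc(1)[OF bot_maps_mono[OF r(2)]] by (simp only:)
qed

text \<open>Effect of the rules on underlying maps.\<close>

lemma fn_nf:
  "nf1 m n \<beta> \<Longrightarrow> fn (Rm \<beta>) = fn \<beta>"
  "nf0 m n \<alpha> \<Longrightarrow> i < m \<Longrightarrow> fn (\<alpha> \<cdot> un (s n)) i = Suc (fn \<alpha> i)"
  "nf0 m n \<alpha> \<Longrightarrow> fn (Lm \<alpha>) = add_bot m (fn \<alpha>)"
  "nf1 m n \<beta> \<Longrightarrow> i < m \<Longrightarrow> fn (co (t m) \<cdot> \<beta>) (Suc i) = fn \<beta> i"
proof -
  show "fn (Rm \<beta>) = fn \<beta>" if "nf1 m n \<beta>"
    using fn_Rm nf_over(2)[OF that] by blast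
  show "fn (Lm \<alpha>) = add_bot m (fn \<alpha>)" if "nf0 m n \<alpha>"
    using fn_Lm nf_over(1)[OF that] by blast
  show "fn (\<alpha> \<cdot> un (s n)) i = Suc (fn \<alpha> i)" if \<alpha>: "nf0 m n \<alpha>" "i < m"
    using fn_cmp0[OF nf_over(1)[OF \<alpha>(1)], of "un (s n)" "Suc n"] un(1)[of "s n"] \<alpha>(2)
      mono_mapsD(1)[OF G_V0(2)[OF nf_over(1)[OF \<alpha>(1)]] \<alpha>(2)] fn_un by (simp add: shift_def)
  show "fn (co (t m) \<cdot> \<beta>) (Suc i) = fn \<beta> i" if \<beta>: "nf1 m n \<beta>" "i < m"
    using fn_cmp1[OF co_t, of m \<beta> n] nf_over(2)[OF \<beta>(1)] \<beta>(2) fn_co[of m] by (simp add: merge_def)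
qed

lemma nf_maps: "nf0 m n \<alpha> \<Longrightarrow> fn \<alpha> \<in> mono_maps m n" "nf1 m n \<beta> \<Longrightarrow> fn \<beta> \<in> bot_maps m n"
  using G_V0(2)[OF nf_over(1)] G_V1(2) nf_over(2) by blast+

text \<open>A normal form is determined by its image: the last rule of its derivation can be read off from
  the domain and the values of the underlying map at \<open>0\<close> and \<open>1\<close>.\<close>

lemma nf_inj_aux:
  "nf0 m n \<alpha> \<Longrightarrow> \<forall>\<alpha>'. nf0 m n \<alpha>' \<longrightarrow> fn \<alpha> = fn \<alpha>' \<longrightarrow> \<alpha> = \<alpha>'"
  "nf1 m n \<beta> \<Longrightarrow> \<forall>\<beta>'. nf1 m n \<beta>' \<longrightarrow> fn \<beta> = fn \<beta>' \<longrightarrow> \<beta> = \<beta>'"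
proof (induction rule: nf0_nf1.inducts)
  case nf_id
  show ?case by (auto elim: nf0.cases dest: nf_over(2))
next
  case (nf_R m n \<beta>)
  show ?case
  proof (intro allI impI)
    fix \<alpha>' assume *: "nf0 m n \<alpha>'" "fn (Rm \<beta>) = fn \<alpha>'"
    from *(1) show "Rm \<beta> = \<alpha>'"
    proof (cases rule: nf0.cases)
      case nf_id
      then show ?thesis using nf_over(2)[OF nf_R(1)] by simp
    next
      case (nf_R \<beta>')
      then show ?thesis using * fn_nf(1)[OF \<open>nf1 m n \<beta>\<close>] fn_nf(1)[OF nf_R(2)] \<open>\<forall>\<beta>'. _ \<beta>'\<close> by simp
    next
      case (nf_un n' \<gamma>)
      have "0 < m" "fn \<beta> 0 = 0"
        using nf_over(2)[OF nf_R(1)] nf_maps(2)[OF nf_R(1)] by (auto simp: bot_maps_def)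
      then show ?thesis using * nf_un fn_nf(1)[OF nf_R(1)] fn_nf(2)[OF nf_un(3), of 0] by simp
    qed
  qed
next
  case (nf_un m n \<alpha>)
  show ?case
  proof (intro allI impI)
    fix \<alpha>' assume *: "nf0 m (Suc n) \<alpha>'" "fn (\<alpha> \<cdot> un (s n)) = fn \<alpha>'"
    from *(1) show "\<alpha> \<cdot> un (s n) = \<alpha>'"
    proof (cases rule: nf0.cases)
      case (nf_R \<beta>')
      have "0 < m" "fn \<beta>' 0 = 0"
        using nf_over(2)[OF nf_R(2)] nf_maps(2)[OF nf_R(2)] by (auto simp: bot_maps_def)
      then show ?thesis using * nf_R fn_nf(1)[OF nf_R(2)] fn_nf(2)[OF nf_un(1), of 0] by simp
    next
      case (nf_un \<gamma>)
      then have \<gamma>: "nf0 m n \<gamma>" "\<alpha>' = \<gamma> \<cdot> un (s n)" by auto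
      have "fn \<alpha> = fn \<gamma>"
        using *(2) fn_nf(2)[OF \<open>nf0 m n \<alpha>\<close>] fn_nf(2)[OF \<gamma>(1)] \<gamma>(2)
        by (intro mono_maps_eqI[OF nf_maps(1)[OF \<open>nf0 m n \<alpha>\<close>] nf_maps(1)[OF \<gamma>(1)]]) (metis Suc_inject)
      then show ?thesis using \<open>\<forall>\<alpha>'. _ \<alpha>'\<close> \<gamma> by blast
    qed
  qed
next
  case (nf_L m n \<alpha>)
  show ?case
  proof (intro allI impI)
    fix \<beta>' assume *: "nf1 (Suc m) (Suc n) \<beta>'" "fn (Lm \<alpha>) = fn \<beta>'"
    from *(1) show "Lm \<alpha> = \<beta>'"
    proof (cases rule: nf1.cases)
      case (nf_L \<gamma>)
      then have \<gamma>: "nf0 m n \<gamma>" "\<beta>' = Lm \<gamma>" by auto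
      have "add_bot m (fn \<alpha>) = add_bot m (fn \<gamma>)"
        using *(2) fn_nf(3)[OF \<open>nf0 m n \<alpha>\<close>] fn_nf(3)[OF \<gamma>(1)] \<gamma>(2) by simp
      then have "fn \<alpha> = fn \<gamma>"
        by (intro mono_maps_eqI[OF nf_maps(1)[OF \<open>nf0 m n \<alpha>\<close>] nf_maps(1)[OF \<gamma>(1)]]) (metis add_bot_simps(2) Suc_inject)
      then show ?thesis using \<open>\<forall>\<alpha>'. _ \<alpha>'\<close> \<gamma> by blast
    next
      case (nf_co \<gamma>)
      then have \<gamma>: "nf1 m (Suc n) \<gamma>" "\<beta>' = co (t m) \<cdot> \<gamma>" by auto
      have "0 < m" "fn \<gamma> 0 = 0"
        using nf_over(2)[OF \<gamma>(1)] nf_maps(2)[OF \<gamma>(1)] by (auto simp: bot_maps_def)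
      then show ?thesis
        using *(2) fn_nf(3)[OF nf_L(1)] fn_nf(4)[OF \<gamma>(1), of 0] \<gamma>(2) add_bot_simps(2)[of 0 m "fn \<alpha>"] by simp
    qed
  qed
next
  case (nf_co m n \<beta>)
  have m: "0 < m" "fn \<beta> 0 = 0"
    using nf_over(2)[OF nf_co(1)] nf_maps(2)[OF nf_co(1)] by (auto simp: bot_maps_def)
  show ?case
  proof (intro allI impI)
    fix \<beta>' assume *: "nf1 (Suc m) n \<beta>'" "fn (co (t m) \<cdot> \<beta>) = fn \<beta>'"
    from *(1) show "co (t m) \<cdot> \<beta> = \<beta>'"
    proof (cases rule: nf1.cases)
      case (nf_L n' \<gamma>)
      then have \<gamma>: "nf0 m n' \<gamma>" "\<beta>' = Lm \<gamma>" by auto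
      then show ?thesis
        using *(2) fn_nf(3)[OF \<gamma>(1)] fn_nf(4)[OF nf_co(1), of 0] m add_bot_simps(2)[of 0 m "fn \<gamma>"] by simp
    next
      case (nf_co \<gamma>)
      then have \<gamma>: "nf1 m n \<gamma>" "\<beta>' = co (t m) \<cdot> \<gamma>" by auto
      have "fn \<beta> = fn \<gamma>"
        using *(2) fn_nf(4)[OF \<open>nf1 m n \<beta>\<close>] fn_nf(4)[OF \<gamma>(1)] \<gamma>(2)
        by (intro mono_maps_eqI[OF bot_maps_mono[OF nf_maps(2)[OF \<open>nf1 m n \<beta>\<close>]]
              bot_maps_mono[OF nf_maps(2)[OF \<gamma>(1)]]]) metis
      then show ?thesis using \<open>\<forall>\<beta>'. _ \<beta>'\<close> \<gamma> by blast
    qed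
  qed
qed

lemma nf_inj:
  "nf0 m n \<alpha> \<Longrightarrow> nf0 m n \<alpha>' \<Longrightarrow> fn \<alpha> = fn \<alpha>' \<Longrightarrow> \<alpha> = \<alpha>'"
  "nf1 m n \<beta> \<Longrightarrow> nf1 m n \<beta>' \<Longrightarrow> fn \<beta> = fn \<beta>' \<Longrightarrow> \<beta> = \<beta>'"
  using nf_inj_aux by blast+

text \<open>Every monotone map underlies a normal form. As in the closure under composition, the measure
  lets \<open>nf_R\<close> be undone although it does not change \<open>m\<close> and \<open>n\<close>.\<close>

lemma nf_surj_aux:
  "(\<forall>m n \<phi>. N = 2 * (m + n) + 1 \<longrightarrow> \<phi> \<in> mono_maps m n \<longrightarrow> (\<exists>\<alpha>. nf0 m n \<alpha> \<and> fn \<alpha> = \<phi>)) \<and>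
   (\<forall>m n \<psi>. N = 2 * (m + n) \<longrightarrow> \<psi> \<in> bot_maps m n \<longrightarrow> (\<exists>\<beta>. nf1 m n \<beta> \<and> fn \<beta> = \<psi>))"
proof (induction N rule: less_induct)
  case (less N)
  have IH0: "\<exists>\<alpha>. nf0 m n \<alpha> \<and> fn \<alpha> = \<phi>" if "2 * (m + n) + 1 < N" "\<phi> \<in> mono_maps m n" for m n \<phi>
    using less[OF that(1)] that(2) by blast
  have IH1: "\<exists>\<beta>. nf1 m n \<beta> \<and> fn \<beta> = \<psi>" if "2 * (m + n) < N" "\<psi> \<in> bot_maps m n" for m n \<psi>
    using less[OF that(1)] that(2) by blast
  show ?case
  proof (intro conjI allI impI)
    fix m n \<phi> assume N: "N = 2 * (m + n) + 1" and \<phi>: "\<phi> \<in> mono_maps m n"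
    note \<phi>D = mono_mapsD[OF \<phi>]
    consider "m = 0" "n = 0" | "0 < m" "\<phi> 0 = 0" | n' where "n = Suc n'" "\<forall>i<m. 0 < \<phi> i"
    proof (cases "m = 0 \<or> 0 < \<phi> 0")
      case True
      then have "\<forall>i<m. 0 < \<phi> i" using \<phi>D(3)[of 0] by fastforce
      then show ?thesis using that(1,3) True \<phi>D(1)[of 0] by (cases n; cases "m = 0") auto
    next
      case False
      then show ?thesis using that(2) by simp
    qed
    then show "\<exists>\<alpha>. nf0 m n \<alpha> \<and> fn \<alpha> = \<phi>"
    proof cases
      case 1
      then have "fn (ide a) = \<phi>"
        using mono_maps_eqI[OF nf_maps(1)[OF nf_id], of \<phi> n] \<phi> by simp
      then show ?thesis using 1 nf_id by blast
    next
      case 2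
      then have "\<phi> \<in> bot_maps m n" using \<phi> \<phi>D(1)[of 0] by (simp add: bot_maps_def)
      then obtain \<beta> where "nf1 m n \<beta>" "fn \<beta> = \<phi>" using IH1[of m n] N by auto
      then show ?thesis using nf_R fn_nf(1) by blast
    next
      case 3
      let ?\<phi> = "\<lambda>i \<in> {..<m}. \<phi> i - 1"
      have "?\<phi> \<in> mono_maps m n'"
        using 3 \<phi>D(1,3) by (intro mono_mapsI) (fastforce simp: diff_le_mono)+
      then obtain \<alpha> where \<alpha>: "nf0 m n' \<alpha>" "fn \<alpha> = ?\<phi>" using IH0[of m n' ?\<phi>] N 3(1) by auto
      have "nf0 m n (\<alpha> \<cdot> un (s n'))" using nf_un[OF \<alpha>(1)] 3(1) by simp
      moreover have "fn (\<alpha> \<cdot> un (s n')) = \<phi>"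
        using fn_nf(2)[OF \<alpha>(1)] \<alpha>(2) 3(2) by (intro mono_maps_eqI[OF nf_maps(1)[OF calculation] \<phi>]) simp
      ultimately show ?thesis by blast
    qed
  next
    fix m n \<psi> assume N: "N = 2 * (m + n)" and \<psi>: "\<psi> \<in> bot_maps m n"
    note \<psi>D = mono_mapsD[OF bot_maps_mono[OF \<psi>]]
    obtain m' n' where mn: "m = Suc m'" "n = Suc n'" and \<psi>0: "\<psi> 0 = 0"
      using \<psi> by (cases m; cases n) (auto simp: bot_maps_def)
    show "\<exists>\<beta>. nf1 m n \<beta> \<and> fn \<beta> = \<psi>"
    proof (cases "0 < m' \<and> \<psi> (Suc 0) = 0")
      case True
      let ?\<psi> = "\<lambda>i \<in> {..<m'}. \<psi> (Suc i)"
      have "?\<psi> \<in> mono_maps m' n"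
        using \<psi>D mn by (intro mono_mapsI) auto
      then have "?\<psi> \<in> bot_maps m' n" using True mn by (simp add: bot_maps_def)
      then obtain \<beta> where \<beta>: "nf1 m' n \<beta>" "fn \<beta> = ?\<psi>" using IH1[of m' n ?\<psi>] N mn by auto
      have *: "nf1 m n (co (t m') \<cdot> \<beta>)" using nf_co[OF \<beta>(1)] mn by simp
      have "fn (co (t m') \<cdot> \<beta>) = \<psi>"
      proof (rule mono_maps_eqI[OF bot_maps_mono[OF nf_maps(2)[OF *]] bot_maps_mono[OF \<psi>]])
        fix i assume "i < m"
        then show "fn (co (t m') \<cdot> \<beta>) i = \<psi> i"
          using fn_nf(4)[OF \<beta>(1), of "i - 1"] \<beta>(2) nf_maps(2)[OF *] \<psi>0 mn
          by (cases i) (auto simp: bot_maps_def)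
      qed
      then show ?thesis using * by blast
    next
      case False
      then have pos: "0 < \<psi> (Suc i)" if "i < m'" for i
        using \<psi>D(3)[of "Suc 0" "Suc i"] that mn by fastforce
      let ?\<phi> = "\<lambda>i \<in> {..<m'}. \<psi> (Suc i) - 1"
      have "?\<phi> \<in> mono_maps m' n'"
      proof (rule mono_mapsI)
        show "?\<phi> i < n'" if "i < m'" for i
          using \<psi>D(1)[of "Suc i"] pos[of i] that mn by simp
        show "?\<phi> i \<le> ?\<phi> j" if "i \<le> j" "j < m'" for i j
          using \<psi>D(3)[of "Suc i" "Suc j"] that mn by (simp add: diff_le_mono)
      qed simp
      then obtain \<alpha> where \<alpha>: "nf0 m' n' \<alpha>" "fn \<alpha> = ?\<phi>" using IH0[of m' n' ?\<phi>] N mn by auto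
      have *: "nf1 m n (Lm \<alpha>)" using nf_L[OF \<alpha>(1)] mn by simp
      have "fn (Lm \<alpha>) = \<psi>"
      proof (rule mono_maps_eqI[OF bot_maps_mono[OF nf_maps(2)[OF *]] bot_maps_mono[OF \<psi>]])
        fix i assume "i < m"
        then show "fn (Lm \<alpha>) i = \<psi> i"
          using fn_nf(3)[OF \<alpha>(1)] \<alpha>(2) pos[of "i - 1"] \<psi>0 mn by (cases i) auto
      qed
      then show ?thesis using * by blast
    qed
  qed
qed

text \<open>The normal form with a given underlying map.\<close>

definition h0 :: "nat \<Rightarrow> nat \<Rightarrow> (nat \<Rightarrow> nat) \<Rightarrow> 'a" where
  "h0 m n \<phi> = (THE \<alpha>. nf0 m n \<alpha> \<and> fn \<alpha> = \<phi>)"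

definition h1 :: "nat \<Rightarrow> nat \<Rightarrow> (nat \<Rightarrow> nat) \<Rightarrow> 'a" where
  "h1 m n \<psi> = (THE \<beta>. nf1 m n \<beta> \<and> fn \<beta> = \<psi>)"

lemma nf_ex1:
  "\<phi> \<in> mono_maps m n \<Longrightarrow> \<exists>!\<alpha>. nf0 m n \<alpha> \<and> fn \<alpha> = \<phi>"
  "\<psi> \<in> bot_maps m n \<Longrightarrow> \<exists>!\<beta>. nf1 m n \<beta> \<and> fn \<beta> = \<psi>"
  using conjunct1[OF nf_surj_aux[of "2 * (m + n) + 1"]] conjunct2[OF nf_surj_aux[of "2 * (m + n)"]] nf_inj
  by metis+

lemma h0: "\<phi> \<in> mono_maps m n \<Longrightarrow> nf0 m n (h0 m n \<phi>) \<and> fn (h0 m n \<phi>) = \<phi>"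
  unfolding h0_def by (rule theI'[OF nf_ex1(1)])

lemma h1: "\<psi> \<in> bot_maps m n \<Longrightarrow> nf1 m n (h1 m n \<psi>) \<and> fn (h1 m n \<psi>) = \<psi>"
  unfolding h1_def by (rule theI'[OF nf_ex1(2)])

lemma h0_eq: "nf0 m n \<alpha> \<Longrightarrow> fn \<alpha> = \<phi> \<Longrightarrow> h0 m n \<phi> = \<alpha>"
  using h0 nf_maps(1) nf_inj(1) by metis

lemma h1_eq: "nf1 m n \<beta> \<Longrightarrow> fn \<beta> = \<psi> \<Longrightarrow> h1 m n \<psi> = \<beta>"
  using h1 nf_maps(2) nf_inj(2) by metis

lemma h_over:
  "\<phi> \<in> mono_maps m n \<Longrightarrow> h0 m n \<phi> \<in> V0 (s m) (s n)"
  "\<psi> \<in> bot_maps m n \<Longrightarrow> h1 m n \<psi> \<in> V1 (t m) (t n)"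
  using h0 h1 nf_over by blast+

lemma h_ide:
  "h0 n n (\<lambda>i \<in> {..<n}. i) = ide (s n)" "0 < n \<Longrightarrow> h1 n n (\<lambda>i \<in> {..<n}. i) = ide (t n)"
proof -
  show "h0 n n (\<lambda>i \<in> {..<n}. i) = ide (s n)" by (rule h0_eq[OF nf_ide(1) fn_ide(1)])
  show "h1 n n (\<lambda>i \<in> {..<n}. i) = ide (t n)" if "0 < n"
    using h1_eq[OF nf_ide(2) fn_ide(2)[OF zero_less_Suc]] that by (cases n) simp_all
qed

lemma h_cmp:
  "\<phi> \<in> mono_maps m n \<Longrightarrow> \<psi> \<in> mono_maps n k \<Longrightarrow> h0 m k (\<lambda>i \<in> {..<m}. \<psi> (\<phi> i)) = h0 m n \<phi> \<cdot> h0 n k \<psi>"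
  "\<phi>' \<in> bot_maps m n \<Longrightarrow> \<psi>' \<in> bot_maps n k \<Longrightarrow> h1 m k (\<lambda>i \<in> {..<m}. \<psi>' (\<phi>' i)) = h1 m n \<phi>' \<cdot> h1 n k \<psi>'"
proof -
  assume *: "\<phi> \<in> mono_maps m n" "\<psi> \<in> mono_maps n k"
  show "h0 m k (\<lambda>i \<in> {..<m}. \<psi> (\<phi> i)) = h0 m n \<phi> \<cdot> h0 n k \<psi>"
    using h0[OF *(1)] h0[OF *(2)] nf_cmp(1) fn_cmp0[OF h_over(1)[OF *(1)] h_over(1)[OF *(2)]]
    by (intro h0_eq) auto
next
  assume *: "\<phi>' \<in> bot_maps m n" "\<psi>' \<in> bot_maps n k"
  then have "0 < m" "0 < n" "0 < k" by (auto simp: bot_maps_def)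
  then show "h1 m k (\<lambda>i \<in> {..<m}. \<psi>' (\<phi>' i)) = h1 m n \<phi>' \<cdot> h1 n k \<psi>'"
    using h1[OF *(1)] h1[OF *(2)] nf_cmp(2) fn_cmp1[OF h_over(2)[OF *(1)] h_over(2)[OF *(2)]]
    by (intro h1_eq) auto
qed

lemma h_add_bot: "\<phi> \<in> mono_maps m n \<Longrightarrow> h1 (Suc m) (Suc n) (add_bot m \<phi>) = Lm (h0 m n \<phi>)"
  using h0[of \<phi> m n] nf_L fn_nf(3)[of m n "h0 m n \<phi>"] by (intro h1_eq) auto

lemma h_merge: "0 < n \<Longrightarrow> h1 (Suc n) n (merge n) = co (t n)"
proof -
  assume n: "0 < n"
  then have "nf1 n n (ide (t n))" using nf_ide(2)[of "n - 1"] by simp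
  then have "nf1 (Suc n) n (co (t n) \<cdot> ide (t n))" by (rule nf_co)
  then show ?thesis using ide_r[OF co(1)[of "t n"]] fn_co[OF n] by (intro h1_eq) simp_all
qed

text \<open>The functor from the category of elements that assigns normal forms; an arrow over the
  non-identity arrow of \<open>2\<close> is a lifting followed by a normal form.\<close>

definition H :: "(nat \<times> nat, nat \<times> (nat \<times> nat) \<times> ord_arr, 'o, 'a) fctr" where
  "H = \<lparr>omap = (\<lambda>(i, n) \<in> Obj (Tot El). if i = 0 then s n else t n),
    amap = (\<lambda>(S, f, m, n, \<phi>) \<in> Arr (Tot El).
      if f = (0, 0) then h0 m n \<phi> else if f = (1, 1) then h1 m n \<phi> else P (s S) \<cdot> h1 m n \<phi>)\<rparr>"

lemma H_obj: "omap H (0, n) = s n" "0 < n \<Longrightarrow> omap H (1, n) = t n"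
  by (auto simp: H_def El_Obj)

lemma El_arrI:
  "\<phi> \<in> mono_maps m n \<Longrightarrow> (m, (0, 0), (m, n, \<phi>)) \<in> Hom (Tot El) (0, m) (0, n)"
  "\<psi> \<in> bot_maps m n \<Longrightarrow> (m, (1, 1), (m, n, \<psi>)) \<in> Hom (Tot El) (1, m) (1, n)"
  "\<chi> \<in> bot_maps (Suc m) n \<Longrightarrow> (m, (0, 1), (Suc m, n, \<chi>)) \<in> Hom (Tot El) (0, m) (1, n)"
  by (rule hom_overD(1)[of _ El "(0, 0)"] hom_overD(1)[of _ El "(1, 1)"] hom_overD(1)[of _ El "(0, 1)"],
      unfold El_over, blast)+

lemma H_arr:
  "\<phi> \<in> mono_maps m n \<Longrightarrow> amap H (m, (0, 0), (m, n, \<phi>)) = h0 m n \<phi>"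
  "\<psi> \<in> bot_maps m n \<Longrightarrow> amap H (m, (1, 1), (m, n, \<psi>)) = h1 m n \<psi>"
  "\<chi> \<in> bot_maps (Suc m) n \<Longrightarrow> amap H (m, (0, 1), (Suc m, n, \<chi>)) = P (s m) \<cdot> h1 (Suc m) n \<chi>"
  using HomD(1)[OF El_arrI(1)] HomD(1)[OF El_arrI(2)] HomD(1)[OF El_arrI(3)] by (simp_all add: H_def)

lemma P_h1: "\<chi> \<in> bot_maps (Suc m) n \<Longrightarrow> P (s m) \<cdot> h1 (Suc m) n \<chi> \<in> V01 (s m) (t n)"
  using V_cmp(4)[OF P[OF s_Ob0, of m]] h_over(2)[of \<chi> "Suc m" n] by simp

lemma bot_pos: "\<psi> \<in> bot_maps m n \<Longrightarrow> 0 < m \<and> 0 < n" by (simp add: bot_maps_def)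

lemma H_over:
  assumes "e \<in> Hom (Tot El) x y"
  shows "amap H e \<in> hom_over Q (amap (prj El) e) (omap H x) (omap H y)"
  using assms
proof (cases rule: El_Hom_cases)
  case (zero m n \<phi>)
  then show ?thesis
    using El.elements_prj(2)[OF HomD(1)[OF assms]] h_over(1) by (simp add: H_obj H_arr)
next
  case (one m n \<phi>)
  then show ?thesis
    using El.elements_prj(2)[OF HomD(1)[OF assms]] h_over(2) bot_pos[of \<phi>] by (simp add: H_obj H_arr)
next
  case (across m n \<phi>)
  then show ?thesis
    using El.elements_prj(2)[OF HomD(1)[OF assms]] P_h1 bot_pos[of \<phi>] by (simp add: H_obj H_arr)
qed

lemma H_functor: "is_functor (Tot El) (Tot Q) H"
proof (rule is_functorI[OF El.elements_category QC])
  show "omap H x \<in> Obj (Tot Q)" if "x \<in> Obj (Tot El)" for x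
    using that s_Ob0 t_Ob1 by (auto simp: El_Obj H_obj Ob0_def Ob1_def simp del: s_Ob0 t_Ob1)
  show "amap H (Ide (Tot El) x) = ide (omap H x)" if "x \<in> Obj (Tot El)" for x
    using that by (auto simp: El_Obj H_obj El_ide H_arr mono_maps_id bot_maps_def h_ide)
  fix e x y assume e: "e \<in> Hom (Tot El) x y"
  show "amap H e \<in> Hom (Tot Q) (omap H x) (omap H y)"
    by (rule over_Hom[OF H_over[OF e]])
  fix d z assume d: "d \<in> Hom (Tot El) y z"
  from e show "amap H (Cmp (Tot El) e d) = amap H e \<cdot> amap H d"
  proof (cases rule: El_Hom_cases)
    case e: (zero m n \<phi>)
    from d show ?thesis
    proof (cases rule: El_Hom_cases)
      case (zero n' k \<psi>)
      then show ?thesis using e mono_maps_comp[of \<phi> m n \<psi> k] by (simp add: El_cmp H_arr h_cmp)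
    next
      case (one n' k \<psi>)
      then show ?thesis using e by simp
    next
      case (across n' k \<psi>)
      then have [simp]: "n' = n" using e by simp
      have \<psi>: "\<psi> \<in> bot_maps (Suc n) k" using across by simp
      note \<phi> = add_bot_maps[OF e(3)]
      have "h0 m n \<phi> \<cdot> (P (s n) \<cdot> h1 (Suc n) k \<psi>) = P (s m) \<cdot> (Lm (h0 m n \<phi>) \<cdot> h1 (Suc n) k \<psi>)"
        using assoc[OF over_Hom[OF h_over(1)[OF e(3)]] over_Hom[OF P[OF s_Ob0]], of "h1 (Suc n) k \<psi>" "t k"]
          assoc[OF over_Hom[OF P[OF s_Ob0]] over_Hom[OF Lm(1)[OF h_over(1)[OF e(3)]]], of "h1 (Suc n) k \<psi>" "t k"]
          over_Hom[OF h_over(2)[OF \<psi>]] Lm(2)[OF h_over(1)[OF e(3)]] by simp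
      then show ?thesis
        using e across h_cmp(2)[OF \<phi> \<psi>] bot_maps_comp[OF \<phi> \<psi>] by (simp add: El_cmp H_arr h_add_bot)
    qed
  next
    case e: (one m n \<phi>)
    from d show ?thesis
    proof (cases rule: El_Hom_cases)
      case (one n' k \<psi>)
      then show ?thesis using e bot_maps_comp[of \<phi> m n \<psi> k] by (simp add: El_cmp H_arr h_cmp)
    qed (use e in simp_all)
  next
    case e: (across m n \<phi>)
    from d show ?thesis
    proof (cases rule: El_Hom_cases)
      case (one n' k \<psi>)
      then have \<psi>: "\<psi> \<in> bot_maps n k" and [simp]: "n' = n" using e by simp_all
      have h: "h1 (Suc m) n \<phi> \<in> V1 (L (s m)) (t n)" using h_over(2)[OF e(3)] by simp
      show ?thesis
        using e one bot_maps_comp[OF e(3) \<psi>] h_cmp(2)[OF e(3) \<psi>]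
          assoc[OF over_Hom[OF P[OF s_Ob0]] over_Hom[OF h] over_Hom[OF h_over(2)[OF \<psi>]]]
        by (simp add: El_cmp H_arr)
    qed (use e in simp_all)
  qed
qed (simp_all add: H_def)

lemma H_prj: "comp_functor (Tot El) H (prj Q) = prj El"
proof (rule functor_eqI[OF comp_functor[OF H_functor bif_functor[OF Q]] El.elements_prj_functor])
  show "omap (comp_functor (Tot El) H (prj Q)) x = omap (prj El) x" if "x \<in> Obj (Tot El)" for x
    using that El.elements_prj(1)[OF that] s_Ob0 t_Ob1
    by (auto simp: El_Obj H_obj Ob0_def Ob1_def simp del: s_Ob0 t_Ob1)
  show "amap (comp_functor (Tot El) H (prj Q)) e = amap (prj El) e" if "e \<in> Arr (Tot El)" for e
    using that hom_overD(2)[OF H_over[OF Hom_Dom_Cod[OF that]]] by simp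
qed

lemma H_G: "comp_functor (Tot El) H G = id_functor (Tot El)"
proof (rule functor_eqI[OF comp_functor[OF H_functor GF] id_functor[OF El.elements_category]])
  show "omap (comp_functor (Tot El) H G) x = omap (id_functor (Tot El)) x" if "x \<in> Obj (Tot El)" for x
    using that by (auto simp: El_Obj H_obj G_s G_t)
  fix e assume e: "e \<in> Arr (Tot El)"
  have "amap G (amap H e) = e"
    using Hom_Dom_Cod[OF e]
  proof (cases rule: El_Hom_cases)
    case (zero m n \<phi>)
    then show ?thesis using G_V0[OF h_over(1)[OF zero(3)]] h0[OF zero(3)] by (simp add: H_arr)
  next
    case (one m n \<phi>)
    then show ?thesis
      using G_V1[OF h_over(2)[OF one(3)]] h1[OF one(3)] bot_pos[OF one(3)] by (simp add: H_arr)
  next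
    case (across m n \<phi>)
    have h: "h1 (Suc m) n \<phi> \<in> V1 (L (s m)) (t n)" using h_over(2)[OF across(3)] by simp
    have "amap G (h1 (Suc m) n \<phi>) = (Suc m, (1, 1), (Suc m, n, \<phi>))"
      using G_V1[OF h_over(2)[OF across(3)]] h1[OF across(3)] bot_pos[OF across(3)] by simp
    then have "amap G (amap H e) = Cmp (Tot El) (push El (0, 1) (0, m)) (Suc m, (1, 1), (Suc m, n, \<phi>))"
      using across functor_cmp[OF GF over_Hom[OF P[OF s_Ob0]] over_Hom[OF h]] by (simp add: H_arr G_P G_s)
    also have "\<dots> = (m, (0, 1), (Suc m, n, \<lambda>i \<in> {..<Suc m}. \<phi> ((\<lambda>i \<in> {..<Suc m}. i) i)))"
      unfolding El_lifts by (rule El_cmp(3)) (simp add: bot_maps_def mono_maps_id)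
    also have "\<dots> = e"
      using mono_maps_unit_assoc(1)[OF bot_maps_mono[OF across(3)]] across by (simp only:)
    finally show ?thesis .
  qed
  then show "amap (comp_functor (Tot El) H G) e = amap (id_functor (Tot El)) e" using e by simp
qed

text \<open>\<open>H\<close> preserves the chosen liftings up to vertical isomorphism.\<close>

lemma H_push:
  assumes f: "f \<in> Hom Two A B" and e: "e \<in> Obj (Tot El)" "omap (prj El) e = A"
    and i: "vert_iso Two Q (omap H e) T i i'"
  shows "\<exists>j j'. vert_iso Two Q (omap H (pushed El f e)) (pushed Q f T) j j' \<and>
    amap H (push El f e) \<cdot> j = i \<cdot> push Q f T"
proof -
  note I = vert_isoD[OF Q i]
  have prj_T: "omap (prj Q) T = A"
    using I(7) comp_functor_apply(1)[OF e(1), of H "prj Q"] e(2) by (simp add: H_prj)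
  have A: "fst e = A" using e El.elements_prj(1) by simp
  consider "f = (A, A)" | n where "f = (0, 1)" "A = 0" "e = (0, n)"
    using f A e(1) by (cases e) (auto simp: Hom_Two El_Obj)
  then show ?thesis
  proof cases
    case 1
    obtain k where k: "vert_iso Two Q T (pushed Q (A, A) T) (push Q (A, A) T) k"
      using push_ide_vert_iso(1)[OF I(6) prj_T] by blast
    note ik = vert_iso_cmp[OF Q i k]
    have "amap H (push El f e) \<cdot> (i \<cdot> push Q f T) = i \<cdot> push Q f T"
      using 1 El_ide_lifts(1)[OF e] functor_ide[OF H_functor e(1)] ide_l[OF vert_isoD(1)[OF Q ik]] by simp
    then show ?thesis using ik 1 El_ide_lifts(3)[OF e] by auto
  next
    case 2
    have i': "vert_iso Two Q (s n) T i i'" using i 2 by (simp add: H_obj)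
    note I' = V_vert_iso(1)[OF i' s_Ob0]
    have "amap H (push El (0, 1) (0, n)) = P (s n) \<cdot> ide (t (Suc n))"
      unfolding El_lifts using h_ide(2)[of "Suc n"] by (subst H_arr(3)) (simp_all add: bot_maps_def mono_maps_id)
    then have "amap H (push El f e) = P (s n)" using ide_r[OF P[OF s_Ob0]] 2 by simp
    moreover have "omap H (pushed El f e) = L (s n)"
      using 2 H_obj(2)[of "Suc n"] by (simp add: El_lifts(3))
    ultimately show ?thesis
      using vert_iso_Lm[OF i' s_Ob0] Lm(2)[of i "s n" T] I' 2 by auto
  qed
qed

lemma H_pull:
  assumes f: "f \<in> Hom Two A B" and e: "e \<in> Obj (Tot El)" "omap (prj El) e = B"
    and i: "vert_iso Two Q (omap H e) T i i'"
  shows "\<exists>j j'. vert_iso Two Q (omap H (pulled El f e)) (pulled Q f T) j j' \<and>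
    amap H (pull El f e) \<cdot> i = j \<cdot> pull Q f T"
proof -
  note I = vert_isoD[OF Q i]
  have prj_T: "omap (prj Q) T = B"
    using I(7) comp_functor_apply(1)[OF e(1), of H "prj Q"] e(2) by (simp add: H_prj)
  have B: "fst e = B" using e El.elements_prj(1) by simp
  consider "f = (B, B)" | n where "f = (0, 1)" "B = 1" "e = (1, n)" "0 < n"
    using f B e(1) by (cases e) (auto simp: Hom_Two El_Obj)
  then show ?thesis
  proof cases
    case 1
    obtain k where k: "vert_iso Two Q (pulled Q (B, B) T) T (pull Q (B, B) T) k"
      using push_ide_vert_iso(2)[OF I(6) prj_T] by blast
    note ik = vert_iso_cmp[OF Q i vert_iso_sym[OF Q k]]
    have "(i \<cdot> k) \<cdot> pull Q (B, B) T = i"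
      using assoc[OF over_Hom[OF I(1)] over_Hom[OF vert_isoD(2)[OF Q k]] over_Hom[OF vert_isoD(1)[OF Q k]]]
        vert_isoD(4)[OF Q k] ide_r[OF I(1)] by simp
    moreover have "amap H (pull El f e) \<cdot> i = i"
      using 1 El_ide_lifts(2)[OF e] functor_ide[OF H_functor e(1)] ide_l[OF I(1)] by simp
    ultimately show ?thesis using ik 1 El_ide_lifts(4)[OF e] by metis
  next
    case 2
    have i': "vert_iso Two Q (t n) T i i'" using i 2 by (simp add: H_obj)
    note I' = V_vert_iso(2)[OF i' t_Ob1]
    have "amap H (pull El f e) = P (R (t n)) \<cdot> co (t n)"
      using 2 merge_maps h_merge by (simp add: El_lifts H_arr R_t)
    then have "amap H (pull El f e) = V (t n)" using co(2)[OF t_Ob1] by simp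
    moreover have "omap H (pulled El f e) = R (t n)"
      using 2 by (simp add: El_lifts(4) H_obj R_t)
    ultimately show ?thesis
      using vert_iso_Rm[OF i' t_Ob1] Rm(2)[of i "t n" T] I' 2 by auto
  qed
qed

end

section \<open>The equivalences\<close>

context comparison
begin

lemma G_fiber:
  assumes "X \<in> Ob0" shows "omap G X = (0, snd (omap G X))"
proof -
  have X: "X \<in> Obj (Tot Q)" "omap (prj Q) X = 0" using assms by (auto simp: Ob0_def)
  have "fst (omap G X) = 0"
    using El.elements_prj(1)[OF functor_obj[OF GF X(1)]] bifib_morphism_prj(1)[OF G X(1)] X(2) by simp
  then show ?thesis by (metis prod.collapse)
qed

lemma G_fiber_arr:
  assumes \<alpha>: "\<alpha> \<in> V0 X Y"
  obtains \<phi> where "amap G \<alpha> = (snd (omap G X), (0, 0), (snd (omap G X), snd (omap G Y), \<phi>))"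
    "\<phi> \<in> mono_maps (snd (omap G X)) (snd (omap G Y))"
  using bifib_morphism_over[OF G \<alpha>] G_fiber[OF V_obj(1)[OF \<alpha>]] G_fiber[OF V_obj(2)[OF \<alpha>]] El_over(1)
  by metis

text \<open>Restricting the equivalence to the fibers over \<open>0\<close>, and identifying the fiber of the category of
  elements with \<open>\<Delta>\<close>.\<close>

theorem fiber_equivalent_Delta:
  assumes \<sigma>: "is_nat_iso (Tot Q) (Tot Q) (id_functor (Tot Q)) (comp_functor (Tot Q) G H) \<sigma>"
    and \<sigma>_vert: "\<And>X. X \<in> Obj (Tot Q) \<Longrightarrow> \<exists>i. vert_iso Two Q X (omap H (omap G X)) (\<sigma> X) i"
  shows "equivalent Delta (fiber Q Two 0)"
proof -
  let ?F0 = "fiber Q Two 0"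
  have F0: "is_category ?F0" by (rule category_fiber[OF Q]) simp
  have Obj_F0: "X \<in> Obj ?F0 \<longleftrightarrow> X \<in> Ob0" for X by (simp add: Ob0_def)
  have Hom_F0: "Hom ?F0 X Y = V0 X Y" for X Y by (simp add: Hom_fiber)
  define K where "K = \<lparr>omap = (\<lambda>X \<in> Obj ?F0. snd (omap G X)), amap = (\<lambda>\<alpha> \<in> Arr ?F0. snd (snd (amap G \<alpha>)))\<rparr>"
  define J where "J = \<lparr>omap = s, amap = (\<lambda>(m, n, \<phi>) \<in> Arr Delta. h0 m n \<phi>)\<rparr>"
  have K_obj: "omap K X = snd (omap G X)" if "X \<in> Ob0" for X
    using that by (simp add: K_def Ob0_def)
  have K_arr: "amap K \<alpha> = snd (snd (amap G \<alpha>))" if "\<alpha> \<in> V0 X Y" for \<alpha> X Y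
    using HomD(1)[of \<alpha> ?F0 X Y] that by (simp add: K_def Hom_F0)
  have J_arr: "amap J (m, n, \<phi>) = h0 m n \<phi>" if "\<phi> \<in> mono_maps m n" for m n \<phi>
    using that by (simp add: J_def Arr_Delta)
  have K: "is_functor ?F0 Delta K"
  proof (rule is_functorI[OF F0 category_Delta])
    show "amap K (Ide ?F0 X) = Ide Delta (omap K X)" if "X \<in> Obj ?F0" for X
    proof -
      have X: "X \<in> Ob0" using that Obj_F0 by blast
      have "amap G (ide X) = Ide (Tot El) (0, snd (omap G X))"
        using functor_ide[OF GF, of X] G_fiber[OF X] X by (simp add: Ob0_def)
      then show ?thesis
        using K_arr[OF V_ide(1)[OF X]] K_obj[OF X] by (simp add: El_ide Delta_simps)
    qed
    fix \<alpha> X Y assume "\<alpha> \<in> Hom ?F0 X Y"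
    then have \<alpha>: "\<alpha> \<in> V0 X Y" by (simp add: Hom_F0)
    then obtain \<phi> where \<phi>: "amap G \<alpha> = (snd (omap G X), (0, 0), (snd (omap G X), snd (omap G Y), \<phi>))"
      "\<phi> \<in> mono_maps (snd (omap G X)) (snd (omap G Y))"
      by (rule G_fiber_arr)
    show "amap K \<alpha> \<in> Hom Delta (omap K X) (omap K Y)"
      using K_arr[OF \<alpha>] K_obj[OF V_obj(1)[OF \<alpha>]] K_obj[OF V_obj(2)[OF \<alpha>]] \<phi> by (simp add: Hom_Delta)
    fix \<beta> Z assume "\<beta> \<in> Hom ?F0 Y Z"
    then have \<beta>: "\<beta> \<in> V0 Y Z" by (simp add: Hom_F0)
    then obtain \<psi> where \<psi>: "amap G \<beta> = (snd (omap G Y), (0, 0), (snd (omap G Y), snd (omap G Z), \<psi>))"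
      by (rule G_fiber_arr)
    show "amap K (Cmp ?F0 \<alpha> \<beta>) = Cmp Delta (amap K \<alpha>) (amap K \<beta>)"
      using K_arr[OF \<alpha>] K_arr[OF \<beta>] K_arr[OF V_cmp(1)[OF \<alpha> \<beta>]] \<psi> \<phi>(1)
        functor_cmp[OF GF over_Hom[OF \<alpha>] over_Hom[OF \<beta>]] El_cmp(1)[OF \<phi>(2)] by (simp add: Delta_simps)
  qed (simp_all add: K_def Delta_simps)
  have J: "is_functor Delta ?F0 J"
  proof (rule is_functorI[OF category_Delta F0])
    show "omap J n \<in> Obj ?F0" for n using Obj_F0 s_Ob0 by (simp add: J_def del: s_Ob0)
    show "amap J (Ide Delta n) = Ide ?F0 (omap J n)" for n
      using h_ide(1)[of n] by (simp add: Delta_simps J_arr mono_maps_id) (simp add: J_def)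
    fix u m n assume "u \<in> Hom Delta m n"
    then obtain \<phi> where u: "u = (m, n, \<phi>)" "\<phi> \<in> mono_maps m n" by (auto simp: Hom_Delta)
    show "amap J u \<in> Hom ?F0 (omap J m) (omap J n)"
      using u h_over(1)[OF u(2)] by (simp add: J_arr Hom_F0) (simp add: J_def)
    fix v k assume "v \<in> Hom Delta n k"
    then obtain \<psi> where v: "v = (n, k, \<psi>)" "\<psi> \<in> mono_maps n k" by (auto simp: Hom_Delta)
    show "amap J (Cmp Delta u v) = Cmp ?F0 (amap J u) (amap J v)"
      using u v mono_maps_comp[OF u(2) v(2)] h_cmp(1)[OF u(2) v(2)] by (simp add: Delta_simps J_arr)
  qed (auto simp: J_def Delta_simps)
  have JK: "comp_functor Delta J K = id_functor Delta"
  proof (rule functor_eqI[OF comp_functor[OF J K] id_functor[OF category_Delta]])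
    show "omap (comp_functor Delta J K) n = omap (id_functor Delta) n" if "n \<in> Obj Delta" for n
      using that K_obj[OF s_Ob0, of n] by (simp add: J_def G_s)
    fix u assume u: "u \<in> Arr Delta"
    obtain m n \<phi> where u': "u = (m, n, \<phi>)" "\<phi> \<in> mono_maps m n" using u by (cases u) (simp add: Arr_Delta)
    show "amap (comp_functor Delta J K) u = amap (id_functor Delta) u"
      using u u' K_arr[OF h_over(1)[OF u'(2)]] G_V0(1)[OF h_over(1)[OF u'(2)]] h0[OF u'(2)] by (simp add: J_arr)
  qed
  have KJ: "omap (comp_functor ?F0 K J) X = omap H (omap G X)" if "X \<in> Ob0" for X
  proof -
    have "omap H (omap G X) = s (snd (omap G X))" by (subst G_fiber[OF that]) (rule H_obj)
    then show ?thesis using that Obj_F0[of X] K_obj[OF that] by (simp add: J_def)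
  qed
  have KJ': "amap (comp_functor ?F0 K J) \<alpha> = amap H (amap G \<alpha>)" if \<alpha>: "\<alpha> \<in> V0 X Y" for \<alpha> X Y
  proof -
    obtain \<phi> where \<phi>: "amap G \<alpha> = (snd (omap G X), (0, 0), (snd (omap G X), snd (omap G Y), \<phi>))"
      "\<phi> \<in> mono_maps (snd (omap G X)) (snd (omap G Y))"
      by (rule G_fiber_arr[OF \<alpha>])
    then show ?thesis
      using HomD(1)[of \<alpha> ?F0 X Y] \<alpha> K_arr[OF \<alpha>] by (simp add: Hom_F0 J_arr H_arr)
  qed
  have "is_nat_iso ?F0 ?F0 (id_functor ?F0) (comp_functor ?F0 K J) (restrict \<sigma> (Obj ?F0))"
    unfolding is_nat_iso_def is_nat_trans_def
  proof (intro conjI ballI)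
    fix X assume X: "X \<in> Obj ?F0"
    then have X': "X \<in> Ob0" "X \<in> Obj (Tot Q)" by (simp_all add: Ob0_def)
    obtain i where i: "vert_iso Two Q X (omap H (omap G X)) (\<sigma> X) i" using \<sigma>_vert[OF X'(2)] by blast
    note I = V_vert_iso(1)[OF i X'(1)]
    show "restrict \<sigma> (Obj ?F0) X \<in> Hom ?F0 (omap (id_functor ?F0) X) (omap (comp_functor ?F0 K J) X)"
      using I X KJ[OF X'(1)] by (simp only: restrict_apply' id_functor_apply Hom_F0)
    have "iso_pair ?F0 X (omap H (omap G X)) (\<sigma> X) i"
      using I by (simp add: iso_pair_def Hom_F0)
    then show "is_iso ?F0 (restrict \<sigma> (Obj ?F0) X)"
      using iso_pair_iso X by (simp only: restrict_apply')
  next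
    fix \<alpha> assume \<alpha>: "\<alpha> \<in> Arr ?F0"
    then have \<alpha>': "\<alpha> \<in> Arr (Tot Q)" "\<alpha> \<in> V0 (Dom (Tot Q) \<alpha>) (Cod (Tot Q) \<alpha>)"
      by (auto simp: hom_over_def Hom_def)
    have "Dom (Tot Q) \<alpha> \<in> Obj ?F0" "Cod (Tot Q) \<alpha> \<in> Obj ?F0"
      using V_obj(1,2)[OF \<alpha>'(2)] Obj_F0 by blast+
    moreover have "Cmp (Tot Q) \<alpha> (\<sigma> (Cod (Tot Q) \<alpha>)) = Cmp (Tot Q) (\<sigma> (Dom (Tot Q) \<alpha>)) (amap H (amap G \<alpha>))"
      using \<sigma> \<alpha>'(1) by (auto simp: is_nat_iso_def is_nat_trans_def)
    ultimately show "Cmp ?F0 (amap (id_functor ?F0) \<alpha>) (restrict \<sigma> (Obj ?F0) (Cod ?F0 \<alpha>))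
        = Cmp ?F0 (restrict \<sigma> (Obj ?F0) (Dom ?F0 \<alpha>)) (amap (comp_functor ?F0 K J) \<alpha>)"
      using \<alpha> KJ'[OF \<alpha>'(2)] by (simp only: restrict_apply' id_functor_apply fiber_simps(3-6))
  qed (rule id_functor[OF F0] comp_functor[OF K J] restrict_extensional)+
  moreover have "is_nat_iso Delta Delta (comp_functor Delta J K) (id_functor Delta)
      (\<lambda>n \<in> Obj Delta. Ide Delta (omap (id_functor Delta) n))"
    unfolding JK by (rule nat_iso_refl[OF id_functor[OF category_Delta]])
  ultimately have "is_equivalence ?F0 Delta K"
    by (rule is_equivalenceI[OF K J])
  then show ?thesis unfolding equivalent_def by (rule equivalence_inverse)
qed

end

section \<open>The free bifibration on \<open>0 : 1 \<rightarrow> 2\<close>\<close>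

theorem proposition5p1:
  fixes Bif :: "('o::infinite, 'a::infinite, nat, nat \<times> nat) bifib"
    and \<eta> :: "(unit, unit, 'o, 'a) fctr"
  assumes "is_free_bifibration Two One p_two Bif \<eta>"
  shows "(\<exists>!G. is_bifib_morphism Two Bif (elements Two F_two) G \<and> omap G (omap \<eta> ()) = (0, 0)) \<and>
    (\<forall>G. is_bifib_morphism Two Bif (elements Two F_two) G \<and> omap G (omap \<eta> ()) = (0, 0) \<longrightarrow>
       is_equivalence (Tot Bif) (Tot (elements Two F_two)) G) \<and>
    equivalent Delta (fiber Bif Two 0)"
proof -
  note free = assms
  note Q = free_bifibrationD(2)[OF free] and \<eta> = free_bifibrationD(3)[OF free]
  have One: "Obj One = UNIV" "Arr One = UNIV" "Ide One () = ()" "is_category One"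
    by (auto simp: One_def is_category_def Hom_def)
  define a where "a = omap \<eta> ()"
  have a_Obj: "a \<in> Obj (Tot Bif)" using functor_obj[OF \<eta>, of "()"] by (simp add: One a_def)
  have \<eta>_arr: "amap \<eta> () = Ide (Tot Bif) a" using functor_ide[OF \<eta>, of "()"] by (simp add: One a_def)
  have "omap (prj Bif) a = omap p_two ()"
    using comp_functor_apply(1)[of "()" One \<eta> "prj Bif"] free_bifibrationD(4)[OF free] by (simp add: One a_def)
  then have prj_a: "omap (prj Bif) a = 0" by (simp add: p_two_def)
  define \<theta> :: "(unit, unit, nat \<times> nat, nat \<times> (nat \<times> nat) \<times> ord_arr) fctr"
    where "\<theta> = \<lparr>omap = \<lambda>_. (0, 0), amap = \<lambda>_. Ide (Tot El) (0, 0)\<rparr>"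
  have z: "(0, 0) \<in> Obj (Tot El)" by (simp add: El_Obj)
  note z_Hom = ide_Hom[OF El.elements_category z]
  have \<theta>: "is_functor One (Tot El) \<theta>"
    using One(4) El.elements_category z z_Hom ide_cmp[OF El.elements_category z_Hom]
    by (intro is_functorI) (auto simp: \<theta>_def One(1,2))
  have "comp_functor One \<theta> (prj El) = p_two"
    using El.elements_prj(1)[OF z] functor_ide[OF El.elements_prj_functor z]
    by (simp add: comp_functor_def \<theta>_def p_two_def One restrict_def)
  note ex1 = free_bifibration_countable_ex1[OF free El.elements_bifibration countable_El \<theta> this]
  \<comment> \<open>As \<open>1\<close> has no arrow but the identity, the arrow part of the condition on \<open>G\<close> is automatic.\<close>
  have iff: "comp_functor One \<eta> G = \<theta> \<longleftrightarrow> omap G (omap \<eta> ()) = (0, 0)"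
    if G: "is_bifib_morphism Two Bif El G" for G
  proof
    assume "comp_functor One \<eta> G = \<theta>"
    then show "omap G (omap \<eta> ()) = (0, 0)"
      using comp_functor_apply(1)[of "()" One \<eta> G] by (simp add: One \<theta>_def)
  next
    assume *: "omap G (omap \<eta> ()) = (0, 0)"
    then have "amap G (amap \<eta> ()) = Ide (Tot El) (0, 0)"
      using functor_ide[OF bifib_morphismD(3)[OF G] a_Obj] by (simp add: \<eta>_arr a_def)
    then show "comp_functor One \<eta> G = \<theta>" using * by (simp add: comp_functor_def One \<theta>_def restrict_def)
  qed
  have ex1': "\<exists>!G. is_bifib_morphism Two Bif El G \<and> omap G (omap \<eta> ()) = (0, 0)"
    using ex1 iff by metis
  have main: "is_equivalence (Tot Bif) (Tot El) G \<and> equivalent Delta (fiber Bif Two 0)"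
    if G: "is_bifib_morphism Two Bif El G" "omap G (omap \<eta> ()) = (0, 0)" for G
  proof -
    interpret comparison Bif a G
    proof
      show "a \<in> bifibration_over_two.Ob0 Bif"
        using a_Obj prj_a bifibration_over_two.Ob0_def[of Bif] Q by (simp add: bifibration_over_two_def)
    qed (use Q G a_def in auto)
    have HG\<eta>: "comp_functor One \<eta> (comp_functor (Tot Bif) G H) = \<eta>"
    proof (rule functor_eqI[OF comp_functor[OF \<eta> comp_functor[OF GF H_functor]] \<eta>])
      have HGa: "omap H (omap G a) = a" using Ga H_obj(1)[of 0] by simp
      show "omap (comp_functor One \<eta> (comp_functor (Tot Bif) G H)) x = omap \<eta> x" for x
        using HGa a_Obj by (simp add: One) (simp flip: a_def)
      have "amap H (amap G (ide a)) = ide a"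
        using functor_ide[OF comp_functor[OF GF H_functor] a_Obj] HomD(1)[OF ide_Hom[OF QC a_Obj]] a_Obj HGa by simp
      then show "amap (comp_functor One \<eta> (comp_functor (Tot Bif) G H)) x = amap \<eta> x" for x
        using HomD(1)[OF ide_Hom[OF QC a_Obj]] by (simp add: One \<eta>_arr)
    qed
    have "\<exists>\<sigma>. is_nat_iso (Tot Bif) (Tot Bif) (id_functor (Tot Bif)) (comp_functor (Tot Bif) G H) \<sigma> \<and>
        (\<forall>X \<in> Obj (Tot Bif). \<exists>i. vert_iso Two Bif X (omap H (omap G X)) (\<sigma> X) i)"
      by (rule free_bifibration_pseudo_retract[OF free countable_El G(1) H_functor H_prj HG\<eta>];
          (erule (3) H_push | erule (3) H_pull))
    then obtain \<sigma> where \<sigma>: "is_nat_iso (Tot Bif) (Tot Bif) (id_functor (Tot Bif)) (comp_functor (Tot Bif) G H) \<sigma>"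
      "\<forall>X \<in> Obj (Tot Bif). \<exists>i. vert_iso Two Bif X (omap H (omap G X)) (\<sigma> X) i"
      by (elim exE conjE)
    have \<tau>: "is_nat_iso (Tot El) (Tot El) (comp_functor (Tot El) H G) (id_functor (Tot El))
        (\<lambda>x \<in> Obj (Tot El). Ide (Tot El) (omap (id_functor (Tot El)) x))"
      unfolding H_G by (rule nat_iso_refl[OF id_functor[OF El.elements_category]])
    have "is_equivalence (Tot Bif) (Tot El) G"
      by (rule is_equivalenceI[OF GF H_functor \<sigma>(1) \<tau>])
    moreover have "equivalent Delta (fiber Bif Two 0)"
      by (rule fiber_equivalent_Delta[OF \<sigma>(1)]) (use \<sigma>(2) in blast)
    ultimately show ?thesis by blast
  qed
  obtain G where "is_bifib_morphism Two Bif El G" "omap G (omap \<eta> ()) = (0, 0)" using ex1' by blast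
  then show ?thesis using ex1' main by blast
qed

end
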